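(* Let $(a_j)_{j\ge1}$ be positive reals with $a_{j+1}\le a_j$ and $a_j\to0$; let $\bar K\in[2,\infty)$ and $b_i\in[2,\bar K]$ for all $i\ge1$; let $A_i\ge0$ for all $i\ge 1$, $A_1>0$, $\sum_{i=1}^\infty A_i=K<\infty$. (1) Let $\{\bar x_i\}_{i=1}^\infty$ be a sequence of points in $\mathbb S^2$ converging to some $\bar x_\infty\in\mathbb S^2$, and let $\bar r_i(x)=d_{\mathbb S^2}(x,\bar x_i)$. Then the metrics $$g_{\mathbb S^2}+\Big(\sum_{i=1}^jA_if_{a_j,b_i}(\bar r_i(x))\Big)^2g_{\mathbb S^1}$$ converge as $j\to\infty$ in $W^{1,p}(\mathbb S^2\times\mathbb S^1,g_0)$ norm, for $p\in[1,2)$, to $$\bar g_\infty=g_{\mathbb S^2}+\Big(\sum_{i=1}^\infty A_if_{0,b_i}(\bar r_i(x))\Big)^2g_{\mathbb S^1}.$$ (2) Let $\{\hat x_i\}_{i=1}^\infty$ be an enumeration of a countable dense subset of $\mathbb S^2$, and let $\hat r_i(x)=d_{\mathbb S^2}(x,\hat x_i)$. Then the metrics $$g_{\mathbb S^2}+\Big(\sum_{i=1}^jA_if_{a_j,b_i}(\hat r_i(x))\Big)^2g_{\mathbb S^1}$$ converge as $j\to\infty$ in $W^{1,p}(\mathbb S^2\times\mathbb S^1,g_0)$ norm, for $p\in[1,2)$, to $$\hat g_\infty=g_{\mathbb S^2}+\Big(\sum_{i=1}^\infty A_if_{0,b_i}(\hat r_i(x))\Big)^2g_{\mathbb S^1}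.$$
   Context: $(\mathbb S^2,g_{\mathbb S^2})$ is the standard unit round sphere with distance $d_{\mathbb S^2}$; $(\mathbb S^1,g_{\mathbb S^1})$ is the standard circle of length $2\pi$; $g_0=g_{\mathbb S^2}+g_{\mathbb S^1}$. For $a>0$, $b\ge2$: $f_{a,b}(r)=\ln\left(\frac{1+a}{\sin^2r+a}\right)+b$ for $r\in[0,\pi]$; and $f_{0,b}(r)=-2\ln(\sin r)+b$ for $r\in(0,\pi)$ (equal to $+\infty$ at $r=0,\pi$). The $W^{1,p}(\mathbb S^2\times\mathbb S^1,g_0)$ norm of a symmetric 2-tensor is the sum of the $L^p$ norms of the tensor and of its weak covariant derivative, with pointwise norms, measure and connection those of $g_0$. *)

theory Defs
  imports "HOL-Analysis.Analysis"
begin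

text \<open>
  The manifold is the product of the unit sphere of \<open>real^3\<close> and the unit circle of \<open>complex\<close>,
  seen as a submanifold of the Euclidean space \<open>real^3 \<times> complex\<close>. A tangent vector is an ambient
  vector, and \<open>g\<^sub>0\<close> is the restriction of the ambient inner product to the tangent spaces.
\<close>

type_synonym ambient = "(real^3) \<times> complex"

type_synonym tensor2 = "ambient \<Rightarrow> ambient \<Rightarrow> ambient \<Rightarrow> real"
type_synonym tensor3 = "ambient \<Rightarrow> ambient \<Rightarrow> ambient \<Rightarrow> ambient \<Rightarrow> real"

abbreviation S2 :: "(real^3) set" where "S2 \<equiv> sphere 0 1"
abbreviation S1 :: "complex set" where "S1 \<equiv> sphere 0 1"

definition tangent_space :: "ambient \<Rightarrow> ambient set" where
  "tangent_space m = {(v, w). v \<bullet> fst m = 0 \<and> w \<bullet> snd m = 0}"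

text \<open>For \<open>m\<close> on the manifold this is the orthogonal projection onto the tangent space; it is
  polynomial in \<open>m\<close> and hence smooth on the ambient space.\<close>
definition tproj :: "ambient \<Rightarrow> ambient \<Rightarrow> ambient" where
  "tproj m v = (fst v - (fst v \<bullet> fst m) *\<^sub>R fst m, snd v - (snd v \<bullet> snd m) *\<^sub>R snd m)"

definition onb :: "ambient \<Rightarrow> ambient set" where
  "onb m = (SOME B. pairwise orthogonal B \<and> (\<forall>e\<in>B. norm e = 1) \<and> span B = tangent_space m)"


section \<open>Geodesic distance and Riemannian volume\<close>

definition dist_S2 :: "real^3 \<Rightarrow> real^3 \<Rightarrow> real" where
  "dist_S2 x y = arccos (x \<bullet> y)"

definition spherical_coords :: "real \<times> real \<Rightarrow> real^3" where
  "spherical_coords = (\<lambda>(\<theta>, \<phi>). vector [sin \<theta> * cos \<phi>, sin \<theta> * sin \<phi>, cos \<theta>])"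

text \<open>In spherical coordinates the round metric is \<open>d\<theta>\<^sup>2 + sin\<^sup>2 \<theta> d\<phi>\<^sup>2\<close>, whose volume density is
  \<open>sin \<theta>\<close>; the chart omits a null set only.\<close>
definition S2_measure :: "(real^3) measure" where
  "S2_measure =
     distr (density lborel (\<lambda>(\<theta>, \<phi>). ennreal (indicator ({0..pi} \<times> {0..<2*pi}) (\<theta>, \<phi>) * sin \<theta>)))
       (restrict_space borel S2) spherical_coords"

definition S1_measure :: "complex measure" where
  "S1_measure =
     distr (density lborel (indicator {0..<2*pi})) (restrict_space borel S1) cis"

definition vol :: "ambient measure" where
  "vol = S2_measure \<Otimes>\<^sub>M S1_measure"


section \<open>Tensors\<close>

text \<open>A covariant tensor at \<open>m\<close> is given by a multilinear form on the ambient space, of which only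
  the restriction to the tangent space at \<open>m\<close> is relevant; likewise only the points \<open>m\<close> of the
  manifold are relevant.\<close>

definition symmetric_tensor2 :: "tensor2 \<Rightarrow> bool" where
  "symmetric_tensor2 h \<longleftrightarrow>
     (\<forall>m \<in> S2 \<times> S1. bilinear (h m) \<and> (\<forall>u v. h m u v = h m v u))"

definition trilinear :: "(ambient \<Rightarrow> ambient \<Rightarrow> ambient \<Rightarrow> real) \<Rightarrow> bool" where
  "trilinear t \<longleftrightarrow>
     (\<forall>v w. linear (\<lambda>u. t u v w)) \<and> (\<forall>u w. linear (\<lambda>v. t u v w)) \<and> (\<forall>u v. linear (\<lambda>w. t u v w))"

definition inner2 ::
  "ambient \<Rightarrow> (ambient \<Rightarrow> ambient \<Rightarrow> real) \<Rightarrow> (ambient \<Rightarrow> ambient \<Rightarrow> real) \<Rightarrow> real" where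
  "inner2 m s t = (\<Sum>u\<in>onb m. \<Sum>v\<in>onb m. s u v * t u v)"

definition inner3 ::
  "ambient \<Rightarrow> (ambient \<Rightarrow> ambient \<Rightarrow> ambient \<Rightarrow> real) \<Rightarrow> (ambient \<Rightarrow> ambient \<Rightarrow> ambient \<Rightarrow> real) \<Rightarrow> real"
  where
  "inner3 m s t = (\<Sum>u\<in>onb m. \<Sum>v\<in>onb m. \<Sum>w\<in>onb m. s u v w * t u v w)"

definition norm2 :: "tensor2 \<Rightarrow> ambient \<Rightarrow> real" where
  "norm2 h m = sqrt (inner2 m (h m) (h m))"

definition norm3 :: "tensor3 \<Rightarrow> ambient \<Rightarrow> real" where
  "norm3 T m = sqrt (inner3 m (T m) (T m))"

text \<open>The projections of the constant ambient fields span every tangent space, so measurability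
  of a tensor field can be tested on them.\<close>

definition measurable_tensor2 :: "tensor2 \<Rightarrow> bool" where
  "measurable_tensor2 h \<longleftrightarrow>
     (\<forall>u v. (\<lambda>m. h m (tproj m u) (tproj m v)) \<in> borel_measurable vol)"

definition measurable_tensor3 :: "tensor3 \<Rightarrow> bool" where
  "measurable_tensor3 T \<longleftrightarrow>
     (\<forall>u v w. (\<lambda>m. T m (tproj m u) (tproj m v) (tproj m w)) \<in> borel_measurable vol)"


section \<open>Smooth test tensors and their covariant derivative\<close>

primrec C_k :: "nat \<Rightarrow> ('a::euclidean_space \<Rightarrow> real) \<Rightarrow> bool" where
  "C_k 0 = (\<lambda>f. continuous_on UNIV f)"
| "C_k (Suc n) =
     (\<lambda>f. f differentiable_on UNIV \<and> (\<forall>e\<in>Basis. C_k n (\<lambda>x. frechet_derivative f (at x) e)))"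

definition smooth :: "('a::euclidean_space \<Rightarrow> real) \<Rightarrow> bool" where
  "smooth f \<longleftrightarrow> (\<forall>n. C_k n f)"

text \<open>As the manifold is a closed submanifold, its smooth tensor fields are exactly the restrictions
  of the smooth tensor fields on the ambient space.\<close>
definition smooth_tensor3 :: "tensor3 \<Rightarrow> bool" where
  "smooth_tensor3 \<Phi> \<longleftrightarrow> (\<forall>m. trilinear (\<Phi> m)) \<and> (\<forall>u v w. smooth (\<lambda>m. \<Phi> m u v w))"

text \<open>The Levi-Civita connection of a submanifold of a Euclidean space is the tangential part of
  the ambient derivative.\<close>
definition levi_civita :: "ambient \<Rightarrow> ambient \<Rightarrow> (ambient \<Rightarrow> ambient) \<Rightarrow> ambient" where
  "levi_civita m X Y = tproj m (frechet_derivative Y (at m) X)"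

text \<open>\<open>(\<nabla>\<^sub>X \<Phi>)(U, V, W)\<close> at \<open>m\<close>, by the Leibniz rule applied to the tangential extensions
  \<open>n \<mapsto> tproj n U\<close> etc. of the tangent vectors \<open>U\<close>, \<open>V\<close>, \<open>W\<close> at \<open>m\<close>.\<close>
definition cov_deriv3 ::
  "tensor3 \<Rightarrow> ambient \<Rightarrow> ambient \<Rightarrow> ambient \<Rightarrow> ambient \<Rightarrow> ambient \<Rightarrow> real" where
  "cov_deriv3 \<Phi> m X U V W =
     frechet_derivative (\<lambda>n. \<Phi> n (tproj n U) (tproj n V) (tproj n W)) (at m) X
     - \<Phi> m (levi_civita m X (\<lambda>n. tproj n U)) V W
     - \<Phi> m U (levi_civita m X (\<lambda>n. tproj n V)) W
     - \<Phi> m U V (levi_civita m X (\<lambda>n. tproj n W))"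

text \<open>The formal adjoint of the covariant derivative on 2-tensors.\<close>
definition cov_adjoint :: "tensor3 \<Rightarrow> tensor2" where
  "cov_adjoint \<Phi> m U V = - (\<Sum>e\<in>onb m. cov_deriv3 \<Phi> m e e U V)"


section \<open>The Sobolev norm\<close>

text \<open>In \<open>T m X U V = (\<nabla>\<^sub>X h)(U, V)\<close> the first slot is the direction of differentiation.\<close>
definition weak_cov_deriv :: "tensor2 \<Rightarrow> tensor3 \<Rightarrow> bool" where
  "weak_cov_deriv h T \<longleftrightarrow>
     measurable_tensor2 h \<and> integrable vol (norm2 h) \<and>
     (\<forall>m \<in> S2 \<times> S1. trilinear (T m)) \<and> measurable_tensor3 T \<and> integrable vol (norm3 T) \<and>
     (\<forall>\<Phi>. smooth_tensor3 \<Phi> \<longrightarrow>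
        (LINT m|vol. inner3 m (T m) (\<Phi> m)) = (LINT m|vol. inner2 m (h m) (cov_adjoint \<Phi> m)))"

definition Lp_norm :: "real \<Rightarrow> (ambient \<Rightarrow> real) \<Rightarrow> ennreal" where
  "Lp_norm p F =
     (let I = \<integral>\<^sup>+ m. ennreal (\<bar>F m\<bar> powr p) \<partial>vol
      in if I = \<infinity> then \<infinity> else ennreal (enn2real I powr (1 / p)))"

text \<open>A weak covariant derivative is unique almost everywhere, so the infimum is over at most one
  value; it is \<open>\<infinity>\<close> if there is no weak covariant derivative.\<close>
definition W1p_norm :: "real \<Rightarrow> tensor2 \<Rightarrow> ennreal" where
  "W1p_norm p h = Lp_norm p (norm2 h) + (INF T\<in>{T. weak_cov_deriv h T}. Lp_norm p (norm3 T))"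

definition W1p :: "real \<Rightarrow> tensor2 set" where
  "W1p p = {h. symmetric_tensor2 h \<and> measurable_tensor2 h \<and> W1p_norm p h < \<infinity>}"

text \<open>Sequences are indexed from 1; the value at index 0 is irrelevant.\<close>
definition W1p_converges :: "real \<Rightarrow> (nat \<Rightarrow> tensor2) \<Rightarrow> tensor2 \<Rightarrow> bool" where
  "W1p_converges p g g' \<longleftrightarrow>
     (\<forall>j\<ge>1. g j \<in> W1p p) \<and> g' \<in> W1p p \<and>
     (\<lambda>j. W1p_norm p (\<lambda>m u v. g j m u v - g' m u v)) \<longlonglongrightarrow> 0"


section \<open>The warped product metrics\<close>

definition g_S2 :: tensor2 where
  "g_S2 m u v = fst u \<bullet> fst v"

definition g_S1 :: tensor2 where
  "g_S1 m u v = snd u \<bullet> snd v"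

definition warped_metric :: "(real^3 \<Rightarrow> real) \<Rightarrow> tensor2" where
  "warped_metric F m u v = g_S2 m u v + (F (fst m))\<^sup>2 * g_S1 m u v"

definition f_pos :: "real \<Rightarrow> real \<Rightarrow> real \<Rightarrow> real" where
  "f_pos a b r = ln ((1 + a) / ((sin r)\<^sup>2 + a)) + b"

definition f_zero :: "real \<Rightarrow> real \<Rightarrow> ereal" where
  "f_zero b r = (if r \<in> {0<..<pi} then ereal (-2 * ln (sin r) + b) else \<infinity>)"

definition warp :: "(nat \<Rightarrow> real) \<Rightarrow> (nat \<Rightarrow> real) \<Rightarrow> (nat \<Rightarrow> real) \<Rightarrow> (nat \<Rightarrow> real^3)
    \<Rightarrow> nat \<Rightarrow> real^3 \<Rightarrow> real" where
  "warp a b A c j x = (\<Sum>i=1..j. A i * f_pos (a j) (b i) (dist_S2 x (c i)))"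

text \<open>The series of nonnegative extended reals \<open>\<Sum>\<^sub>i\<^sub>\<ge>\<^sub>1\<close>; a term with \<open>A i = 0\<close> vanishes even
  where \<open>f_zero\<close> is infinite.\<close>
definition warp_limit :: "(nat \<Rightarrow> real) \<Rightarrow> (nat \<Rightarrow> real) \<Rightarrow> (nat \<Rightarrow> real^3) \<Rightarrow> real^3 \<Rightarrow> ereal" where
  "warp_limit b A c x = (\<Sum>i. ereal (A (Suc i)) * f_zero (b (Suc i)) (dist_S2 x (c (Suc i))))"

text \<open>The limit metric is defined where the limit warping function is finite. That this holds almost
  everywhere is part of the convergence; \<open>real_of_ereal\<close> then fixes irrelevant values on a null set.\<close>
definition warped_metrics_converge ::
  "real \<Rightarrow> (nat \<Rightarrow> real^3 \<Rightarrow> real) \<Rightarrow> (real^3 \<Rightarrow> ereal) \<Rightarrow> bool" where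
  "warped_metrics_converge p F F' \<longleftrightarrow>
     (AE x in S2_measure. \<bar>F' x\<bar> \<noteq> \<infinity>) \<and>
     W1p_converges p (\<lambda>j. warped_metric (F j)) (warped_metric (\<lambda>x. real_of_ereal (F' x)))"

end

(*
  The difference of two of the metrics is w(x) g_S1, and g_S1 is parallel, so its covariant
  derivative is dw (x) g_S1. For w of class C^1 on the sphere the weak formulation is the
  divergence theorem in polar coordinates. The singular kernels satisfy, with s = 1 - (x.c)^2 =
  sin^2 r, uniformly in a the bounds f <= C s^(-e) and |grad f| <= 2 s^(-1/2). Hence the squared
  warping functions and their gradients are bounded by a multiple of sum A_i s_i^(-1/2-e), whose
  p-th power is integrable by Jensen's inequality as soon as p (1/2 + e) < 1, because
  the integral of s^(-q) over the sphere is bounded independently of c for q < 1. Dominated convergence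
  then gives both the weak derivative of the limit and the convergence in L^p.
*)

theory Submission
  imports Defs
begin

section \<open>Traces over orthonormal frames\<close>

text \<open>A gradient of size s^(-1/2) is in L^p exactly for p < 2, so every further singularity
  has to be paid for out of the gap 2 - p. Squaring the warping function multiplies its gradient by
  a logarithm, which costs an exponent \<open>\<epsilon>\<close>; \<open>\<rho>\<close> is the
  midpoint of p/2 and 1, and \<open>\<epsilon>\<close> is what it leaves. Squaring a sum also
  produces products of singularities at different centres. Comparison with the smaller of the two
  distances reduces these to sums over single centres. The bases \<open>onb\<close> are arbitrary
  choices at each point, so nothing is known about their dependence on the point. Traces are
  therefore rewritten with projections of fixed ambient vectors, which makes all integrands visibly
  continuous. In the polar frame the integration by parts meets no singular factor at the poles:
  moving along a parallel has velocity sin \<theta>, which is also the area density. Since the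
  Sobolev norm is an infimum over weak derivatives, exhibiting one of them bounds it from
  above.\<close>

lemma tproj_linear: "linear (tproj m)"
  by (auto simp: tproj_def linear_iff inner_add_left algebra_simps prod_eq_iff)

lemma tangent_space_iff: "v \<in> tangent_space m \<longleftrightarrow> fst v \<bullet> fst m = 0 \<and> snd v \<bullet> snd m = 0"
  by (cases v) (simp add: tangent_space_def)

lemma subspace_tangent_space: "subspace (tangent_space m)"
  by (auto simp: subspace_def tangent_space_iff inner_add_left)

lemma unit_inner_self: "x \<in> sphere (0::'a::real_inner) 1 \<Longrightarrow> x \<bullet> x = 1"
  by (simp add: dot_square_norm)

lemma tproj_in_tangent_space:
  assumes "m \<in> S2 \<times> S1"
  shows "tproj m v \<in> tangent_space m"
  using assms by (auto simp: tproj_def tangent_space_iff inner_diff_left dot_square_norm)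

lemma tproj_tangent: "v \<in> tangent_space m \<Longrightarrow> tproj m v = v"
  by (auto simp: tproj_def tangent_space_iff prod_eq_iff)

lemma tproj_inner: "tproj m u \<bullet> v = u \<bullet> tproj m v"
  by (simp add: tproj_def inner_prod_def inner_diff_left inner_diff_right algebra_simps inner_commute)

definition orthonormal_frame :: "ambient set \<Rightarrow> ambient \<Rightarrow> bool" where
  "orthonormal_frame B m \<longleftrightarrow>
     pairwise orthogonal B \<and> (\<forall>e\<in>B. norm e = 1) \<and> span B = tangent_space m"

lemma orthonormal_frame_onb: "orthonormal_frame (onb m) m"
proof -
  obtain B where "pairwise orthogonal B" "\<And>x. x \<in> B \<Longrightarrow> norm x = 1" "span B = tangent_space m"
    using orthonormal_basis_subspace[OF subspace_tangent_space] by metis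
  then have "\<exists>B. pairwise orthogonal B \<and> (\<forall>e\<in>B. norm e = 1) \<and> span B = tangent_space m"
    by blast
  then show ?thesis
    unfolding onb_def orthonormal_frame_def by (rule someI_ex)
qed

lemma orthonormal_frame_tangent: "orthonormal_frame B m \<Longrightarrow> e \<in> B \<Longrightarrow> e \<in> tangent_space m"
  unfolding orthonormal_frame_def by (metis span_base)

lemma onb_tangent: "e \<in> onb m \<Longrightarrow> e \<in> tangent_space m"
  using orthonormal_frame_onb orthonormal_frame_tangent by blast

text \<open>A trace does not depend on the orthonormal basis, and the projected ambient basis
  computes it too, although it is linearly dependent. This replaces \<open>onb\<close> by fields
  that are polynomial in \<open>m\<close>.\<close>

lemma orthonormal_frame_trace:
  fixes q :: "ambient \<Rightarrow> ambient \<Rightarrow> real"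
  assumes m: "m \<in> S2 \<times> S1" and B: "orthonormal_frame B m" and q: "bilinear q"
  shows "(\<Sum>e\<in>B. q e e) = (\<Sum>b\<in>Basis. q (tproj m b) (tproj m b))"
proof -
  have orth: "pairwise orthogonal B" and n1: "\<And>e. e \<in> B \<Longrightarrow> norm e = 1"
    and sp: "span B = tangent_space m"
    using B by (auto simp: orthonormal_frame_def)
  have fin: "finite B" by (rule pairwise_orthogonal_imp_finite[OF orth])
  have delta: "e \<bullet> f = (if e = f then 1 else 0)" if "e \<in> B" "f \<in> B" for e f
    using orth n1[OF that(1)] that by (auto simp: pairwise_def orthogonal_def dot_square_norm)
  have exp: "tproj m b = (\<Sum>e\<in>B. (e \<bullet> b) *\<^sub>R e)" for b
  proof -
    have "tproj m b = (\<Sum>e\<in>B. (e \<bullet> tproj m b) *\<^sub>R e)"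
      using orthonormal_basis_expand[OF orth n1 _ fin, of "tproj m b"] tproj_in_tangent_space[OF m] sp
      by (simp add: inner_commute)
    also have "\<dots> = (\<Sum>e\<in>B. (e \<bullet> b) *\<^sub>R e)"
      by (intro sum.cong refl)
        (metis tproj_inner tproj_tangent orthonormal_frame_tangent[OF B])
    finally show ?thesis .
  qed
  have "(\<Sum>b\<in>Basis. q (tproj m b) (tproj m b))
      = (\<Sum>b\<in>Basis. \<Sum>e\<in>B. \<Sum>f\<in>B. ((e \<bullet> b) * (f \<bullet> b)) * q e f)"
    unfolding exp using q
    by (simp add: bilinear_sum bilinear_lmul bilinear_rmul sum.cartesian_product split_beta mult.assoc)
  also have "\<dots> = (\<Sum>e\<in>B. \<Sum>b\<in>Basis. \<Sum>f\<in>B. ((e \<bullet> b) * (f \<bullet> b)) * q e f)"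
    by (rule sum.swap)
  also have "\<dots> = (\<Sum>e\<in>B. \<Sum>f\<in>B. \<Sum>b\<in>Basis. ((e \<bullet> b) * (f \<bullet> b)) * q e f)"
    by (rule sum.cong[OF refl sum.swap])
  also have "\<dots> = (\<Sum>e\<in>B. \<Sum>f\<in>B. (e \<bullet> f) * q e f)"
    by (simp only: sum_distrib_right[symmetric] euclidean_inner[symmetric])
  also have "\<dots> = (\<Sum>e\<in>B. \<Sum>f\<in>B. (if e = f then 1 else 0) * q e f)"
    by (intro sum.cong refl) (simp add: delta)
  also have "\<dots> = (\<Sum>e\<in>B. q e e)"
    by (simp add: if_distrib[of "\<lambda>x. x * _"] fin cong: if_cong)
  finally show ?thesis by simp
qed

lemma bilinearI:
  fixes q :: "'a::real_vector \<Rightarrow> 'b::real_vector \<Rightarrow> 'c::real_vector"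
  assumes "\<And>v. linear (\<lambda>u. q u v)" "\<And>u. linear (q u)"
  shows "bilinear q"
  using assms by (auto simp: bilinear_def)

lemma linear_mult_right: "linear f \<Longrightarrow> linear (\<lambda>x. f x * (c::real))"
  by (auto simp: linear_iff algebra_simps)

lemma linear_mult_left: "linear f \<Longrightarrow> linear (\<lambda>x. (c::real) * f x)"
  by (auto simp: linear_iff algebra_simps)

lemma bilinearD:
  assumes "bilinear q" shows "linear (\<lambda>u. q u v)" "linear (\<lambda>v. q u v)"
  using assms by (auto simp: bilinear_def)

text \<open>The contraction is done slot by slot: for fixed \<open>u\<close> the sum over
  \<open>v\<close> is the trace of \<open>b1\<close>, and the remaining sum over \<open>u\<close> is
  the trace of \<open>b2\<close>.\<close>

lemma inner2_frame:
  assumes m: "m \<in> S2 \<times> S1" and B: "orthonormal_frame B m" and s: "bilinear s" and t: "bilinear t"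
  shows "inner2 m s t = (\<Sum>u\<in>B. \<Sum>v\<in>B. s u v * t u v)"
    and "inner2 m s t = (\<Sum>u\<in>Basis. \<Sum>v\<in>Basis.
           s (tproj m u) (tproj m v) * t (tproj m u) (tproj m v))"
proof -
  have b1: "bilinear (\<lambda>v v'. s u v * t u v')" for u
    by (auto intro!: bilinearI linear_mult_right linear_mult_left bilinearD[OF s] bilinearD[OF t])
  have b2: "bilinear (\<lambda>u u'. \<Sum>v\<in>Basis. s u (tproj m v) * t u' (tproj m v))"
    by (auto intro!: bilinearI linear_compose_sum linear_mult_right linear_mult_left
        bilinearD[OF s] bilinearD[OF t])
  have *: "(\<Sum>u\<in>C. \<Sum>v\<in>C. s u v * t u v) = (\<Sum>u\<in>Basis. \<Sum>v\<in>Basis.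
           s (tproj m u) (tproj m v) * t (tproj m u) (tproj m v))"
    if C: "orthonormal_frame C m" for C
    using orthonormal_frame_trace[OF m C b1] orthonormal_frame_trace[OF m C b2] by simp
  show "inner2 m s t = (\<Sum>u\<in>Basis. \<Sum>v\<in>Basis.
           s (tproj m u) (tproj m v) * t (tproj m u) (tproj m v))"
    unfolding inner2_def by (rule *[OF orthonormal_frame_onb])
  then show "inner2 m s t = (\<Sum>u\<in>B. \<Sum>v\<in>B. s u v * t u v)"
    by (simp add: *[OF B])
qed

lemma inner3_frame:
  assumes m: "m \<in> S2 \<times> S1" and B: "orthonormal_frame B m" and s: "trilinear s" and t: "trilinear t"
  shows "inner3 m s t = (\<Sum>u\<in>B. \<Sum>v\<in>B. \<Sum>w\<in>B. s u v w * t u v w)"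
proof -
  have s': "bilinear (s u)" "bilinear (\<lambda>u v. s u v w)" for u w
    using s unfolding trilinear_def bilinear_def by blast+
  have t': "bilinear (t u)" "bilinear (\<lambda>u v. t u v w)" for u w
    using t unfolding trilinear_def bilinear_def by blast+
  have s3: "linear (\<lambda>u. s u v w)" "linear (\<lambda>v. s u v w)" "linear (\<lambda>w. s u v w)" for u v w
    using s unfolding trilinear_def bilinear_def by blast+
  have t3: "linear (\<lambda>u. t u v w)" "linear (\<lambda>v. t u v w)" "linear (\<lambda>w. t u v w)" for u v w
    using t unfolding trilinear_def bilinear_def by blast+
  have b3: "bilinear (\<lambda>u u'. \<Sum>v\<in>Basis. \<Sum>w\<in>Basis.
      s u (tproj m v) (tproj m w) * t u' (tproj m v) (tproj m w))"
    by (auto intro!: bilinearI linear_compose_sum linear_mult_right linear_mult_left s3 t3)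
  have *: "(\<Sum>u\<in>C. \<Sum>v\<in>C. \<Sum>w\<in>C. s u v w * t u v w)
     = (\<Sum>u\<in>Basis. \<Sum>v\<in>Basis. \<Sum>w\<in>Basis.
           s (tproj m u) (tproj m v) (tproj m w) * t (tproj m u) (tproj m v) (tproj m w))"
    if C: "orthonormal_frame C m" for C
  proof -
    have "(\<Sum>v\<in>C. \<Sum>w\<in>C. s u v w * t u v w)
      = (\<Sum>v\<in>Basis. \<Sum>w\<in>Basis. s u (tproj m v) (tproj m w) * t u (tproj m v) (tproj m w))" for u
      using inner2_frame(1)[OF m C s'(1)[of u] t'(1)[of u]] inner2_frame(2)[OF m C s'(1)[of u] t'(1)[of u]] by simp
    then show ?thesis using orthonormal_frame_trace[OF m C b3] by simp
  qed
  show ?thesis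
    unfolding inner3_def by (simp add: *[OF orthonormal_frame_onb] *[OF B])
qed

section \<open>Covariant derivatives of smooth ambient tensors\<close>

lemma trilinearD:
  assumes "trilinear t"
  shows "linear (\<lambda>u. t u v w)" "linear (\<lambda>v. t u v w)" "linear (\<lambda>w. t u v w)"
  using assms unfolding trilinear_def by blast+

lemma trilinear_simps:
  assumes "trilinear t"
  shows "t (u + u') v w = t u v w + t u' v w" "t u (v + v') w = t u v w + t u v' w"
    "t u v (w + w') = t u v w + t u v w'"
    "t (c *\<^sub>R u) v w = c * t u v w" "t u (c *\<^sub>R v) w = c * t u v w" "t u v (c *\<^sub>R w) = c * t u v w"
    "t (- u) v w = - t u v w" "t u (- v) w = - t u v w" "t u v (- w) = - t u v w"
    "t 0 v w = 0" "t u 0 w = 0" "t u v 0 = 0"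
  by (rule linear_add[OF trilinearD(1)[OF assms]] linear_add[OF trilinearD(2)[OF assms]] linear_add[OF trilinearD(3)[OF assms]]
      linear_scale[OF trilinearD(1)[OF assms], unfolded real_scaleR_def] linear_scale[OF trilinearD(2)[OF assms], unfolded real_scaleR_def] linear_scale[OF trilinearD(3)[OF assms], unfolded real_scaleR_def]
      linear_neg[OF trilinearD(1)[OF assms]] linear_neg[OF trilinearD(2)[OF assms]] linear_neg[OF trilinearD(3)[OF assms]]
      linear_0[OF trilinearD(1)[OF assms]] linear_0[OF trilinearD(2)[OF assms]] linear_0[OF trilinearD(3)[OF assms]])+

lemma linear_basis_expansion:
  fixes f :: "'a::euclidean_space \<Rightarrow> real"
  assumes "linear f"
  shows "f x = (\<Sum>b\<in>Basis. (x \<bullet> b) * f b)"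
proof -
  have "f x = f (\<Sum>b\<in>Basis. (x \<bullet> b) *\<^sub>R b)" by (simp add: euclidean_representation)
  also have "\<dots> = (\<Sum>b\<in>Basis. (x \<bullet> b) * f b)"
    by (simp only: linear_sum[OF assms] linear_scale[OF assms] real_scaleR_def)
  finally show ?thesis .
qed

text \<open>\<open>smooth_tensor3\<close> speaks of fixed vector arguments only. This expansion
  transfers continuity and differentiability to arguments that move with the point.\<close>

lemma trilinear_basis_expansion:
  assumes "trilinear t"
  shows "t u v w = (\<Sum>a\<in>Basis. \<Sum>b\<in>Basis. \<Sum>c\<in>Basis. (u \<bullet> a) * (v \<bullet> b) * (w \<bullet> c) * t a b c)"
proof -
  have "t u v w = (\<Sum>a\<in>Basis. (u \<bullet> a) * t a v w)"
    by (rule linear_basis_expansion[OF trilinearD(1)[OF assms]])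
  also have "\<dots> = (\<Sum>a\<in>Basis. (u \<bullet> a) * (\<Sum>b\<in>Basis. (v \<bullet> b) * t a b w))"
    by (intro sum.cong refl arg_cong2[where f = "(*)"] linear_basis_expansion[OF trilinearD(2)[OF assms]])
  also have "\<dots> = (\<Sum>a\<in>Basis. (u \<bullet> a) * (\<Sum>b\<in>Basis. (v \<bullet> b) * (\<Sum>c\<in>Basis. (w \<bullet> c) * t a b c)))"
    by (intro sum.cong refl arg_cong2[where f = "(*)"] linear_basis_expansion[OF trilinearD(3)[OF assms]])
  finally show ?thesis by (simp only: sum_distrib_left mult.assoc)
qed

text \<open>The derivative for the flat ambient connection: the vector arguments are frozen as
  constant fields.\<close>

definition tensor3_deriv :: "tensor3 \<Rightarrow> ambient \<Rightarrow> ambient \<Rightarrow> ambient \<Rightarrow> ambient \<Rightarrow> ambient \<Rightarrow> real" where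
  "tensor3_deriv \<Phi> m X u v w = frechet_derivative (\<lambda>n. \<Phi> n u v w) (at m) X"

context
  fixes \<Phi> :: tensor3
  assumes \<Phi>: "smooth_tensor3 \<Phi>"
begin

lemma smooth_tensor3_trilinear: "trilinear (\<Phi> m)"
  using \<Phi> unfolding smooth_tensor3_def by blast

lemma smooth_tensor3_C_k: "C_k n (\<lambda>m. \<Phi> m u v w)"
  using \<Phi> unfolding smooth_tensor3_def smooth_def by blast

lemma has_derivative_smooth_tensor3:
  "((\<lambda>n. \<Phi> n u v w) has_derivative (\<lambda>X. tensor3_deriv \<Phi> m X u v w)) (at m)"
proof -
  have "(\<lambda>n. \<Phi> n u v w) differentiable at m"
    using smooth_tensor3_C_k[of "Suc 0" u v w] unfolding C_k.simps differentiable_on_def by blast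
  then show ?thesis
    unfolding tensor3_deriv_def by (simp only: frechet_derivative_works)
qed

lemma linear_tensor3_deriv_direction: "linear (\<lambda>X. tensor3_deriv \<Phi> m X u v w)"
  using has_derivative_smooth_tensor3 has_derivative_linear by blast

text \<open>Both sides of each identity are derivatives of the same function, so uniqueness of the
  derivative decides.\<close>

lemma trilinear_tensor3_deriv: "trilinear (tensor3_deriv \<Phi> m X)"
proof -
  note tri = trilinear_simps[OF smooth_tensor3_trilinear]
  note der = has_derivative_smooth_tensor3
  note eq = has_derivative_unique[THEN fun_cong, OF der]
  show ?thesis
    unfolding trilinear_def linear_iff
  proof (intro conjI allI)
    fix u u' v v' w w' :: ambient and c :: real
    show "tensor3_deriv \<Phi> m X (u + u') v w = tensor3_deriv \<Phi> m X u v w + tensor3_deriv \<Phi> m X u' v w"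
      by (rule eq) (simp only: tri, intro has_derivative_add der)
    show "tensor3_deriv \<Phi> m X u (v + v') w = tensor3_deriv \<Phi> m X u v w + tensor3_deriv \<Phi> m X u v' w"
      by (rule eq) (simp only: tri, intro has_derivative_add der)
    show "tensor3_deriv \<Phi> m X u v (w + w') = tensor3_deriv \<Phi> m X u v w + tensor3_deriv \<Phi> m X u v w'"
      by (rule eq) (simp only: tri, intro has_derivative_add der)
    show "tensor3_deriv \<Phi> m X (c *\<^sub>R u) v w = c *\<^sub>R tensor3_deriv \<Phi> m X u v w"
      by (rule eq) (simp only: tri real_scaleR_def, intro has_derivative_mult_right der)
    show "tensor3_deriv \<Phi> m X u (c *\<^sub>R v) w = c *\<^sub>R tensor3_deriv \<Phi> m X u v w"
      by (rule eq) (simp only: tri real_scaleR_def, intro has_derivative_mult_right der)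
    show "tensor3_deriv \<Phi> m X u v (c *\<^sub>R w) = c *\<^sub>R tensor3_deriv \<Phi> m X u v w"
      by (rule eq) (simp only: tri real_scaleR_def, intro has_derivative_mult_right der)
  qed
qed

lemma continuous_on_smooth_tensor3:
  fixes f :: "'a::topological_space \<Rightarrow> ambient"
  assumes "continuous_on S f" "continuous_on S u" "continuous_on S v" "continuous_on S w"
  shows "continuous_on S (\<lambda>s. \<Phi> (f s) (u s) (v s) (w s))"
proof -
  have "continuous_on UNIV (\<lambda>n. \<Phi> n a b c)" for a b c
    using smooth_tensor3_C_k[of 0 a b c] by simp
  then have "continuous_on S (\<lambda>s. \<Phi> (f s) a b c)" for a b c
    using assms(1) by (rule continuous_on_compose2) auto
  then show ?thesis
    unfolding trilinear_basis_expansion[OF smooth_tensor3_trilinear, of "f _" "u _"]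
    by (intro continuous_intros assms)
qed

lemma continuous_on_tensor3_deriv:
  fixes f :: "'a::topological_space \<Rightarrow> ambient"
  assumes "continuous_on S f" "continuous_on S X" "continuous_on S u" "continuous_on S v" "continuous_on S w"
  shows "continuous_on S (\<lambda>s. tensor3_deriv \<Phi> (f s) (X s) (u s) (v s) (w s))"
proof -
  have "continuous_on UNIV (\<lambda>n. tensor3_deriv \<Phi> n d a b c)" if "d \<in> Basis" for a b c d
    using smooth_tensor3_C_k[of "Suc 0" a b c] that unfolding tensor3_deriv_def by auto
  then have 1: "continuous_on S (\<lambda>s. tensor3_deriv \<Phi> (f s) d a b c)" if "d \<in> Basis" for a b c d
    using assms(1) that continuous_on_compose2 by blast
  have eq: "tensor3_deriv \<Phi> (f s) (X s) (u s) (v s) (w s) = (\<Sum>a\<in>Basis. \<Sum>b\<in>Basis. \<Sum>c\<in>Basis.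
     (u s \<bullet> a) * (v s \<bullet> b) * (w s \<bullet> c) * (\<Sum>d\<in>Basis. (X s \<bullet> d) * tensor3_deriv \<Phi> (f s) d a b c))" for s
    unfolding trilinear_basis_expansion[OF trilinear_tensor3_deriv, of "f s" "X s" "u s"]
    by (intro sum.cong refl arg_cong2[where f = "(*)"]
        linear_basis_expansion[OF linear_tensor3_deriv_direction])
  show ?thesis unfolding eq
    by (intro continuous_intros assms 1)
qed

text \<open>In components every summand is a product of four scalar functions. The product rule
  gives four sums, and each is regrouped into one tensor by reading the basis expansion
  backwards.\<close>

lemma has_derivative_tensor3_fields:
  fixes f :: "'a::real_normed_vector \<Rightarrow> ambient"
  assumes "(f has_derivative f') (at x within S)" "(u has_derivative u') (at x within S)"
    "(v has_derivative v') (at x within S)" "(w has_derivative w') (at x within S)"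
  shows "((\<lambda>s. \<Phi> (f s) (u s) (v s) (w s)) has_derivative
     (\<lambda>h. tensor3_deriv \<Phi> (f x) (f' h) (u x) (v x) (w x) + \<Phi> (f x) (u' h) (v x) (w x)
        + \<Phi> (f x) (u x) (v' h) (w x) + \<Phi> (f x) (u x) (v x) (w' h))) (at x within S)"
proof -
  have 1: "((\<lambda>s. \<Phi> (f s) a b c) has_derivative (\<lambda>h. tensor3_deriv \<Phi> (f x) (f' h) a b c)) (at x within S)" for a b c
    using has_derivative_compose[OF assms(1) has_derivative_smooth_tensor3] .
  have prod4: "((\<lambda>s. p s * q s * r s * t s) has_derivative
      (\<lambda>h. p x * q x * r x * t' h + p' h * q x * r x * t x + p x * q' h * r x * t x
         + p x * q x * r' h * t x)) (at x within S)"
    if "(p has_derivative p') (at x within S)" "(q has_derivative q') (at x within S)"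
       "(r has_derivative r') (at x within S)" "(t has_derivative t') (at x within S)"
    for p q r t p' q' r' t' :: "'a \<Rightarrow> real"
    by (rule has_derivative_eq_rhs,
        rule has_derivative_mult[OF has_derivative_mult[OF has_derivative_mult[OF that(1,2)] that(3)] that(4)])
       (rule ext, simp add: algebra_simps)
  have "((\<lambda>s. \<Sum>a\<in>Basis. \<Sum>b\<in>Basis. \<Sum>c\<in>Basis. (u s \<bullet> a) * (v s \<bullet> b) * (w s \<bullet> c) * \<Phi> (f s) a b c) has_derivative
    (\<lambda>h. \<Sum>a\<in>Basis. \<Sum>b\<in>Basis. \<Sum>c\<in>Basis.
        ((u x \<bullet> a) * (v x \<bullet> b) * (w x \<bullet> c) * tensor3_deriv \<Phi> (f x) (f' h) a b c
        + (u' h \<bullet> a) * (v x \<bullet> b) * (w x \<bullet> c) * \<Phi> (f x) a b c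
        + (u x \<bullet> a) * (v' h \<bullet> b) * (w x \<bullet> c) * \<Phi> (f x) a b c
        + (u x \<bullet> a) * (v x \<bullet> b) * (w' h \<bullet> c) * \<Phi> (f x) a b c))) (at x within S)"
    by (intro has_derivative_sum prod4 has_derivative_inner_left assms 1)
  then show ?thesis
    unfolding sum.distrib
      trilinear_basis_expansion[OF smooth_tensor3_trilinear, symmetric]
      trilinear_basis_expansion[OF trilinear_tensor3_deriv, symmetric] .
qed

end

text \<open>Up to sign, the second fundamental form of the product of the unit spheres: in each
  factor it is the inner product of the two vectors times the position vector.\<close>

definition second_form :: "ambient \<Rightarrow> ambient \<Rightarrow> ambient \<Rightarrow> ambient" where
  "second_form m X U = ((fst X \<bullet> fst U) *\<^sub>R fst m, (snd X \<bullet> snd U) *\<^sub>R snd m)"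

text \<open>On tangent vectors this is the covariant derivative: the extensions \<open>n \<mapsto> tproj n U\<close> then have the
  normal derivative \<open>- second_form m X U\<close>, so the Levi-Civita terms of \<open>cov_deriv3\<close> vanish.\<close>
definition tangent_deriv3 :: "tensor3 \<Rightarrow> ambient \<Rightarrow> ambient \<Rightarrow> ambient \<Rightarrow> ambient \<Rightarrow> ambient \<Rightarrow> real" where
  "tangent_deriv3 \<Phi> m X U V W = tensor3_deriv \<Phi> m X U V W - \<Phi> m (second_form m X U) V W
     - \<Phi> m U (second_form m X V) W - \<Phi> m U V (second_form m X W)"

lemma has_derivative_tproj:
  "((\<lambda>n. tproj n U) has_derivative
     (\<lambda>X. - second_form m X U - ((fst U \<bullet> fst m) *\<^sub>R fst X, (snd U \<bullet> snd m) *\<^sub>R snd X))) (at m)"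
  unfolding tproj_def second_form_def
  by (auto intro!: derivative_eq_intros ext simp: inner_commute)

lemma tproj_second_form:
  assumes "m \<in> S2 \<times> S1" shows "tproj m (- second_form m X U) = 0"
  using assms by (auto simp: tproj_def second_form_def prod_eq_iff dot_square_norm)

lemma cov_deriv3_tangent:
  assumes \<Phi>: "smooth_tensor3 \<Phi>" and m: "m \<in> S2 \<times> S1"
    and U: "U \<in> tangent_space m" and V: "V \<in> tangent_space m" and W: "W \<in> tangent_space m"
  shows "cov_deriv3 \<Phi> m X U V W = tangent_deriv3 \<Phi> m X U V W"
proof -
  have der: "((\<lambda>n. tproj n Z) has_derivative (\<lambda>X. - second_form m X Z)) (at m)" if "Z \<in> tangent_space m" for Z
    by (rule has_derivative_eq_rhs[OF has_derivative_tproj])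
      (use that in \<open>auto simp: tangent_space_iff prod_eq_iff\<close>)
  have lc: "levi_civita m X (\<lambda>n. tproj n Z) = 0" if "Z \<in> tangent_space m" for Z
    unfolding levi_civita_def frechet_derivative_at[OF der[OF that], symmetric] by (rule tproj_second_form[OF m])
  have "frechet_derivative (\<lambda>n. \<Phi> n (tproj n U) (tproj n V) (tproj n W)) (at m) X
     = tensor3_deriv \<Phi> m X (tproj m U) (tproj m V) (tproj m W)
      + \<Phi> m (- second_form m X U) (tproj m V) (tproj m W)
      + \<Phi> m (tproj m U) (- second_form m X V) (tproj m W)
      + \<Phi> m (tproj m U) (tproj m V) (- second_form m X W)"
    using has_derivative_tensor3_fields[OF \<Phi> has_derivative_ident der[OF U] der[OF V] der[OF W]]
    by (subst frechet_derivative_at[symmetric]) auto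
  then show ?thesis
    unfolding cov_deriv3_def tangent_deriv3_def lc[OF U] lc[OF V] lc[OF W]
    by (simp add: tproj_tangent U V W trilinear_simps[OF smooth_tensor3_trilinear[OF \<Phi>]])
qed

lemma linear_second_form: "linear (\<lambda>X. second_form m X U)" "linear (\<lambda>U. second_form m X U)"
  by (auto simp: second_form_def linear_iff inner_add_left inner_add_right algebra_simps)

text \<open>Linearity holds for arbitrary ambient vectors, not only tangent ones, as
  \<open>bilinear\<close> in the trace lemma demands.\<close>

lemma linear_tangent_deriv3:
  assumes \<Phi>: "smooth_tensor3 \<Phi>"
  shows "linear (\<lambda>X. tangent_deriv3 \<Phi> m X U V W)" and "linear (\<lambda>U. tangent_deriv3 \<Phi> m X U V W)"
    and "linear (\<lambda>V. tangent_deriv3 \<Phi> m X U V W)" and "linear (\<lambda>W. tangent_deriv3 \<Phi> m X U V W)"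
  unfolding tangent_deriv3_def
  by (intro linear_compose_sub linear_tensor3_deriv_direction[OF \<Phi>]
        trilinearD[OF trilinear_tensor3_deriv[OF \<Phi>]] trilinearD[OF smooth_tensor3_trilinear[OF \<Phi>]]
        linear_compose[OF linear_second_form(1) trilinearD(1)[OF smooth_tensor3_trilinear[OF \<Phi>]], unfolded o_def]
        linear_compose[OF linear_second_form(1) trilinearD(2)[OF smooth_tensor3_trilinear[OF \<Phi>]], unfolded o_def]
        linear_compose[OF linear_second_form(1) trilinearD(3)[OF smooth_tensor3_trilinear[OF \<Phi>]], unfolded o_def]
        linear_compose[OF linear_second_form(2) trilinearD(1)[OF smooth_tensor3_trilinear[OF \<Phi>]], unfolded o_def]
        linear_compose[OF linear_second_form(2) trilinearD(2)[OF smooth_tensor3_trilinear[OF \<Phi>]], unfolded o_def]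
        linear_compose[OF linear_second_form(2) trilinearD(3)[OF smooth_tensor3_trilinear[OF \<Phi>]], unfolded o_def])+

text \<open>On tangent vectors this is minus \<open>cov_adjoint\<close>. The sum runs over projected
  ambient vectors instead of \<open>onb\<close> to be continuous in \<open>m\<close>.\<close>

definition tangent_div3 :: "tensor3 \<Rightarrow> tensor2" where
  "tangent_div3 \<Phi> m U V = (\<Sum>b\<in>Basis. tangent_deriv3 \<Phi> m (tproj m b) (tproj m b) U V)"

lemma bilinear_tangent_div3: "smooth_tensor3 \<Phi> \<Longrightarrow> bilinear (tangent_div3 \<Phi> m)"
  unfolding tangent_div3_def
  by (intro bilinearI linear_compose_sum ballI linear_tangent_deriv3)

lemma tangent_div3_frame:
  assumes \<Phi>: "smooth_tensor3 \<Phi>" and m: "m \<in> S2 \<times> S1" and B: "orthonormal_frame B m"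
  shows "tangent_div3 \<Phi> m U V = (\<Sum>e\<in>B. tangent_deriv3 \<Phi> m e e U V)"
  unfolding tangent_div3_def
  by (rule orthonormal_frame_trace[OF m B, symmetric]) (intro bilinearI linear_tangent_deriv3[OF \<Phi>])

lemma cov_adjoint_tangent:
  assumes \<Phi>: "smooth_tensor3 \<Phi>" and m: "m \<in> S2 \<times> S1"
    and U: "U \<in> tangent_space m" and V: "V \<in> tangent_space m"
  shows "cov_adjoint \<Phi> m U V = - tangent_div3 \<Phi> m U V"
  unfolding cov_adjoint_def tangent_div3_frame[OF \<Phi> m orthonormal_frame_onb]
  by (simp add: cov_deriv3_tangent[OF \<Phi> m onb_tangent U V])

text \<open>\<open>inner2\<close> evaluates its arguments on \<open>onb m\<close> only, so agreement
  on tangent vectors suffices.\<close>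

lemma inner2_cov_adjoint:
  assumes \<Phi>: "smooth_tensor3 \<Phi>" and m: "m \<in> S2 \<times> S1"
  shows "inner2 m s (cov_adjoint \<Phi> m) = - inner2 m s (tangent_div3 \<Phi> m)"
  unfolding inner2_def by (simp add: cov_adjoint_tangent[OF \<Phi> m] onb_tangent sum_negf)

lemma continuous_on_second_form:
  fixes f :: "'a::topological_space \<Rightarrow> ambient"
  assumes "continuous_on S f" "continuous_on S X" "continuous_on S U"
  shows "continuous_on S (\<lambda>s. second_form (f s) (X s) (U s))"
  unfolding second_form_def by (intro continuous_intros assms)

lemma continuous_on_tangent_deriv3:
  fixes f :: "'a::topological_space \<Rightarrow> ambient"
  assumes \<Phi>: "smooth_tensor3 \<Phi>"
  and "continuous_on S f" "continuous_on S X" "continuous_on S U" "continuous_on S V" "continuous_on S W"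
  shows "continuous_on S (\<lambda>s. tangent_deriv3 \<Phi> (f s) (X s) (U s) (V s) (W s))"
  unfolding tangent_deriv3_def
  by (intro continuous_intros continuous_on_tensor3_deriv[OF \<Phi>] continuous_on_smooth_tensor3[OF \<Phi>]
      continuous_on_second_form assms)

section \<open>The polar frame\<close>

text \<open>The unit vectors along meridians and (\<open>e_phi\<close>) parallels. As functions of
  the parameters they are smooth and orthonormal even at the poles, where no such fields on the
  sphere exist.\<close>

definition e_theta :: "real \<Rightarrow> real \<Rightarrow> real^3" where
  "e_theta \<theta> \<phi> = vector [cos \<theta> * cos \<phi>, cos \<theta> * sin \<phi>, - sin \<theta>]"

definition e_phi :: "real \<Rightarrow> real^3" where
  "e_phi \<phi> = vector [- sin \<phi>, cos \<phi>, 0]"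

lemma inner_vec3: "(x::real^3) \<bullet> y = x $ 1 * y $ 1 + x $ 2 * y $ 2 + x $ 3 * y $ 3"
  by (simp add: inner_vec_def sum_3)

lemma vec3_eq_iff: "(x::real^3) = y \<longleftrightarrow> x $ 1 = y $ 1 \<and> x $ 2 = y $ 2 \<and> x $ 3 = y $ 3"
  by (simp add: vec_eq_iff forall_3)

lemma spherical_coords_nth [simp]:
  "spherical_coords (\<theta>, \<phi>) $ 1 = sin \<theta> * cos \<phi>" "spherical_coords (\<theta>, \<phi>) $ 2 = sin \<theta> * sin \<phi>"
  "spherical_coords (\<theta>, \<phi>) $ 3 = cos \<theta>"
  by (auto simp: spherical_coords_def)

lemma e_theta_nth [simp]:
  "e_theta \<theta> \<phi> $ 1 = cos \<theta> * cos \<phi>" "e_theta \<theta> \<phi> $ 2 = cos \<theta> * sin \<phi>" "e_theta \<theta> \<phi> $ 3 = - sin \<theta>"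
  by (auto simp: e_theta_def)

lemma e_phi_nth [simp]:
  "e_phi \<phi> $ 1 = - sin \<phi>" "e_phi \<phi> $ 2 = cos \<phi>" "e_phi \<phi> $ 3 = 0"
  by (auto simp: e_phi_def)

lemma polar_trig:
  fixes \<theta> \<phi> :: real
  shows "sin \<theta> * cos \<phi> * (sin \<theta> * cos \<phi>) + sin \<theta> * sin \<phi> * (sin \<theta> * sin \<phi>) + cos \<theta> * cos \<theta> = 1"
    and "cos \<theta> * cos \<phi> * (cos \<theta> * cos \<phi>) + cos \<theta> * sin \<phi> * (cos \<theta> * sin \<phi>) + sin \<theta> * sin \<theta> = 1"
proof -
  have "(sin \<theta>)\<^sup>2 + (cos \<theta>)\<^sup>2 = 1" "(sin \<phi>)\<^sup>2 + (cos \<phi>)\<^sup>2 = 1" by simp_all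
  then show "sin \<theta> * cos \<phi> * (sin \<theta> * cos \<phi>) + sin \<theta> * sin \<phi> * (sin \<theta> * sin \<phi>) + cos \<theta> * cos \<theta> = 1"
    and "cos \<theta> * cos \<phi> * (cos \<theta> * cos \<phi>) + cos \<theta> * sin \<phi> * (cos \<theta> * sin \<phi>) + sin \<theta> * sin \<theta> = 1"
    by algebra+
qed

lemma polar_frame_inner [simp]:
  "spherical_coords (\<theta>, \<phi>) \<bullet> spherical_coords (\<theta>, \<phi>) = 1"
  "e_theta \<theta> \<phi> \<bullet> e_theta \<theta> \<phi> = 1" "e_phi \<phi> \<bullet> e_phi \<phi> = 1"
  "e_theta \<theta> \<phi> \<bullet> spherical_coords (\<theta>, \<phi>) = 0" "e_phi \<phi> \<bullet> spherical_coords (\<theta>, \<phi>) = 0"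
  "e_theta \<theta> \<phi> \<bullet> e_phi \<phi> = 0"
  "spherical_coords (\<theta>, \<phi>) \<bullet> e_theta \<theta> \<phi> = 0" "spherical_coords (\<theta>, \<phi>) \<bullet> e_phi \<phi> = 0"
  "e_phi \<phi> \<bullet> e_theta \<theta> \<phi> = 0"
proof -
  have "(sin \<theta>)\<^sup>2 + (cos \<theta>)\<^sup>2 = 1" "(sin \<phi>)\<^sup>2 + (cos \<phi>)\<^sup>2 = 1" by simp_all
  then show *: "e_phi \<phi> \<bullet> e_phi \<phi> = 1"
    "e_theta \<theta> \<phi> \<bullet> spherical_coords (\<theta>, \<phi>) = 0" "e_phi \<phi> \<bullet> spherical_coords (\<theta>, \<phi>) = 0"
    "e_theta \<theta> \<phi> \<bullet> e_phi \<phi> = 0"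
    unfolding inner_vec3 by (simp_all, algebra+)
  then show "spherical_coords (\<theta>, \<phi>) \<bullet> e_theta \<theta> \<phi> = 0" "spherical_coords (\<theta>, \<phi>) \<bullet> e_phi \<phi> = 0"
    "e_phi \<phi> \<bullet> e_theta \<theta> \<phi> = 0" by (simp_all add: inner_commute)
  show "spherical_coords (\<theta>, \<phi>) \<bullet> spherical_coords (\<theta>, \<phi>) = 1" "e_theta \<theta> \<phi> \<bullet> e_theta \<theta> \<phi> = 1"
    unfolding inner_vec3 using polar_trig[of \<theta> \<phi>] by simp_all
qed

lemma polar_frame_expansion:
  fixes v :: "real^3"
  assumes "v \<bullet> spherical_coords (\<theta>, \<phi>) = 0"
  shows "v = (v \<bullet> e_theta \<theta> \<phi>) *\<^sub>R e_theta \<theta> \<phi> + (v \<bullet> e_phi \<phi>) *\<^sub>R e_phi \<phi>"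
proof -
  have t: "(sin \<theta>)\<^sup>2 + (cos \<theta>)\<^sup>2 = 1" "(sin \<phi>)\<^sup>2 + (cos \<phi>)\<^sup>2 = 1" by simp_all
  have a: "v $ 1 * (sin \<theta> * cos \<phi>) + v $ 2 * (sin \<theta> * sin \<phi>) + v $ 3 * cos \<theta> = 0"
    using assms by (simp add: inner_vec3)
  show ?thesis
    unfolding vec3_eq_iff inner_vec3
    apply simp
    apply (intro conjI)
    using a t apply algebra+
    done
qed

lemma spherical_coords_in_S2: "spherical_coords p \<in> S2"
proof (cases p)
  case (Pair \<theta> \<phi>)
  have "spherical_coords (\<theta>, \<phi>) \<bullet> spherical_coords (\<theta>, \<phi>) = 1" by simp
  then show ?thesis unfolding Pair by (simp only: mem_sphere_0 norm_eq_1)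
qed

lemma circle_expansion:
  fixes w :: complex
  assumes "w \<bullet> cis \<psi> = 0"
  shows "w = (w \<bullet> (\<i> * cis \<psi>)) *\<^sub>R (\<i> * cis \<psi>)"
proof -
  have t: "(sin \<psi>)\<^sup>2 + (cos \<psi>)\<^sup>2 = 1" by simp
  have a: "Re w * cos \<psi> + Im w * sin \<psi> = 0"
    using assms by (simp add: inner_complex_def)
  show ?thesis
    unfolding complex_eq_iff inner_complex_def
    apply simp
    apply (intro conjI)
    using a t apply algebra+
    done
qed

lemma circle_inner [simp]: "(\<i> * cis \<psi>) \<bullet> (\<i> * cis \<psi>) = 1" "(\<i> * cis \<psi>) \<bullet> cis \<psi> = 0" "cis \<psi> \<bullet> (\<i> * cis \<psi>) = 0"
  "cis \<psi> \<bullet> cis \<psi> = 1"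
  by (auto simp: inner_complex_def power2_eq_square[symmetric])

fun chart :: "(real \<times> real) \<times> real \<Rightarrow> ambient" where
  "chart ((\<theta>, \<phi>), \<psi>) = (spherical_coords (\<theta>, \<phi>), cis \<psi>)"

lemma chart_in: "chart q \<in> S2 \<times> S1"
  by (cases q rule: chart.cases) (use spherical_coords_in_S2 in auto)

lemma orthonormal_frame_polar:
  "orthonormal_frame {(e_theta \<theta> \<phi>, 0), (e_phi \<phi>, 0), (0, \<i> * cis \<psi>)} (chart ((\<theta>, \<phi>), \<psi>))"
    (is "orthonormal_frame ?B ?m")
  unfolding orthonormal_frame_def
proof (intro conjI)
  show "pairwise orthogonal ?B"
    by (auto simp: pairwise_def orthogonal_def inner_prod_def)
  show "\<forall>e\<in>?B. norm e = 1"
    by (auto simp: norm_eq_1 norm_Pair)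
  show "span ?B = tangent_space ?m"
  proof
    show "span ?B \<subseteq> tangent_space ?m"
      by (rule span_minimal[OF _ subspace_tangent_space]) (auto simp: tangent_space_iff)
    show "tangent_space ?m \<subseteq> span ?B"
    proof
      fix v assume v: "v \<in> tangent_space ?m"
      then have "v = (fst v \<bullet> e_theta \<theta> \<phi>) *\<^sub>R (e_theta \<theta> \<phi>, 0) + (fst v \<bullet> e_phi \<phi>) *\<^sub>R (e_phi \<phi>, 0)
           + (snd v \<bullet> (\<i> * cis \<psi>)) *\<^sub>R (0, \<i> * cis \<psi>)"
        using polar_frame_expansion[of "fst v" \<theta> \<phi>] circle_expansion[of "snd v" \<psi>]
        by (simp add: tangent_space_iff prod_eq_iff)
      also have "\<dots> \<in> span ?B"
        by (intro span_add span_scale span_base) auto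
      finally show "v \<in> span ?B" .
    qed
  qed
qed

lemma polar_frame_distinct [simp]:
  "e_theta \<theta> \<phi> \<noteq> e_phi \<phi>" "e_theta \<theta> \<phi> \<noteq> 0" "e_phi \<phi> \<noteq> 0"
proof -
  show "e_theta \<theta> \<phi> \<noteq> e_phi \<phi>"
    using polar_frame_inner(2,6)[of \<theta> \<phi>] by (metis zero_neq_one)
  show "e_theta \<theta> \<phi> \<noteq> 0" using polar_frame_inner(2)[of \<theta> \<phi>] by (metis inner_zero_left zero_neq_one)
  show "e_phi \<phi> \<noteq> 0" using polar_frame_inner(3)[of \<phi>] by (metis inner_zero_left zero_neq_one)
qed

lemma sum_polar_frame:
  "(\<Sum>e\<in>{(e_theta \<theta> \<phi>, 0), (e_phi \<phi>, 0), (0, \<i> * cis \<psi>)}. f e)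
    = f (e_theta \<theta> \<phi>, 0) + f (e_phi \<phi>, 0) + f (0, \<i> * cis \<psi>)"
  by (simp add: add.assoc)

section \<open>The tensors \<open>\<kappa>\<close> times \<open>g_S2\<close> plus \<open>w\<close>
  times \<open>g_S1\<close>, and their derivatives\<close>

text \<open>The metrics are the case \<open>\<kappa> = 1\<close>, their differences the case \<open>\<kappa> = 0\<close>.\<close>

definition warp_tensor :: "real \<Rightarrow> (real^3 \<Rightarrow> real) \<Rightarrow> tensor2" where
  "warp_tensor \<kappa> w m u v = \<kappa> * g_S2 m u v + w (fst m) * g_S1 m u v"

text \<open>The product of \<open>D\<close> with \<open>g_S1\<close>. The coefficient
  \<open>\<kappa>\<close> leaves no trace because \<open>g_S2\<close> is parallel as well.\<close>

definition warp_deriv :: "(real^3 \<Rightarrow> real^3) \<Rightarrow> tensor3" where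
  "warp_deriv D m X u v = (D (fst m) \<bullet> fst X) * (snd u \<bullet> snd v)"

lemma bilinear_warp_tensor: "bilinear (warp_tensor \<kappa> w m)"
  unfolding warp_tensor_def g_S2_def g_S1_def
  by (auto simp: bilinear_def linear_iff inner_add_left inner_add_right algebra_simps)

lemma trilinear_warp_deriv: "trilinear (warp_deriv D m)"
  unfolding warp_deriv_def trilinear_def
  by (auto simp: linear_iff inner_add_left inner_add_right algebra_simps)

text \<open>Turns pointwise identities on the manifold into computations in the polar frame.\<close>

lemma chart_surj:
  assumes "m \<in> S2 \<times> S1" obtains \<theta> \<phi> \<psi> where "m = chart ((\<theta>, \<phi>), \<psi>)"
proof -
  obtain x z where m: "m = (x, z)" "norm x = 1" "norm z = 1" using assms by auto
  have "x \<bullet> x = 1" using m by (simp add: dot_square_norm)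
  then have x1: "(x $ 1)\<^sup>2 + (x $ 2)\<^sup>2 + (x $ 3)\<^sup>2 = 1" by (simp add: inner_vec3 power2_eq_square)
  then have le: "\<bar>x $ 3\<bar> \<le> 1" by (metis abs_square_le_1 add_increasing le_add_same_cancel2 sum_power2_ge_zero)
  define \<theta> where "\<theta> = arccos (x $ 3)"
  have c: "cos \<theta> = x $ 3" using le by (simp add: \<theta>_def)
  \<comment> \<open>At a pole \<open>c'\<close> is 0 and its argument is a default value, which is
    harmless because it is multiplied by sin \<theta> = 0.\<close>
  define c' where "c' = Complex (x $ 1) (x $ 2)"
  have "sin \<theta> \<ge> 0" using le by (auto simp: \<theta>_def arccos_lbound arccos_ubound abs_le_iff intro!: sin_ge_zero)
  moreover have "(sin \<theta>)\<^sup>2 = (norm c')\<^sup>2"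
    using x1 c by (simp add: sin_squared_eq c'_def cmod_def)
  ultimately have s: "norm c' = sin \<theta>" by simp
  have "x = spherical_coords (\<theta>, Arg c')"
  proof -
    have "c' = rcis (norm c') (Arg c')" by (simp add: rcis_cmod_Arg)
    then have "x $ 1 = sin \<theta> * cos (Arg c')" "x $ 2 = sin \<theta> * sin (Arg c')"
      unfolding s by (auto simp: c'_def complex_eq_iff rcis_def)
    then show ?thesis by (simp add: vec3_eq_iff c)
  qed
  moreover have "z = cis (Arg z)" using rcis_cmod_Arg[of z] m by (simp add: rcis_def)
  ultimately show thesis using that[of \<theta> "Arg c'" "Arg z"] m by simp
qed

lemma inner2_warp_tensor_chart:
  fixes \<theta> \<phi> \<psi> :: real
  defines "m \<equiv> chart ((\<theta>, \<phi>), \<psi>)"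
  assumes t: "bilinear t"
  shows "inner2 m (warp_tensor \<kappa> w m) t = \<kappa> * (t (e_theta \<theta> \<phi>, 0) (e_theta \<theta> \<phi>, 0) + t (e_phi \<phi>, 0) (e_phi \<phi>, 0))
     + w (fst m) * t (0, \<i> * cis \<psi>) (0, \<i> * cis \<psi>)"
  unfolding inner2_frame(1)[OF chart_in orthonormal_frame_polar bilinear_warp_tensor t] m_def sum_polar_frame
  by (simp add: warp_tensor_def g_S2_def g_S1_def algebra_simps)

lemma inner3_warp_deriv_chart:
  fixes \<theta> \<phi> \<psi> :: real
  defines "m \<equiv> chart ((\<theta>, \<phi>), \<psi>)"
  assumes t: "trilinear t"
  shows "inner3 m (warp_deriv D m) t = (D (fst m) \<bullet> e_theta \<theta> \<phi>) * t (e_theta \<theta> \<phi>, 0) (0, \<i> * cis \<psi>) (0, \<i> * cis \<psi>)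
      + (D (fst m) \<bullet> e_phi \<phi>) * t (e_phi \<phi>, 0) (0, \<i> * cis \<psi>) (0, \<i> * cis \<psi>)"
  unfolding inner3_frame[OF chart_in orthonormal_frame_polar trilinear_warp_deriv t] m_def sum_polar_frame
  by (simp add: warp_deriv_def)

text \<open>The squared norms of \<open>g_S2\<close> and \<open>g_S1\<close> are the dimensions 2
  and 1 of the factors, and the two are orthogonal.\<close>

lemma norm2_warp_tensor:
  assumes "m \<in> S2 \<times> S1"
  shows "norm2 (warp_tensor \<kappa> w) m = sqrt (2 * \<kappa>\<^sup>2 + (w (fst m))\<^sup>2)"
proof -
  obtain \<theta> \<phi> \<psi> where m: "m = chart ((\<theta>, \<phi>), \<psi>)" using chart_surj[OF assms] .
  show ?thesis unfolding norm2_def m inner2_warp_tensor_chart[OF bilinear_warp_tensor]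
    by (simp add: warp_tensor_def g_S2_def g_S1_def power2_eq_square algebra_simps)
qed

lemma spherical_tangential_part:
  fixes v :: "real^3"
  shows "v - (v \<bullet> spherical_coords (\<theta>, \<phi>)) *\<^sub>R spherical_coords (\<theta>, \<phi>)
     = (v \<bullet> e_theta \<theta> \<phi>) *\<^sub>R e_theta \<theta> \<phi> + (v \<bullet> e_phi \<phi>) *\<^sub>R e_phi \<phi>"
  using polar_frame_expansion[of "v - (v \<bullet> spherical_coords (\<theta>, \<phi>)) *\<^sub>R spherical_coords (\<theta>, \<phi>)" \<theta> \<phi>]
  by (simp add: inner_diff_left)

lemma norm3_warp_deriv:
  assumes "m \<in> S2 \<times> S1"
  shows "norm3 (warp_deriv D) m = norm (D (fst m) - (D (fst m) \<bullet> fst m) *\<^sub>R fst m)"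
proof -
  obtain \<theta> \<phi> \<psi> where m: "m = chart ((\<theta>, \<phi>), \<psi>)" using chart_surj[OF assms] .
  show ?thesis unfolding norm3_def m inner3_warp_deriv_chart[OF trilinear_warp_deriv] norm_eq_sqrt_inner
    by (simp add: warp_deriv_def spherical_tangential_part inner_add_left inner_add_right)
qed

lemma norm3_warp_deriv_le:
  assumes m: "m \<in> S2 \<times> S1"
  shows "norm3 (warp_deriv D) m \<le> norm (D (fst m))"
proof -
  have "norm (v - (v \<bullet> x) *\<^sub>R x) \<le> norm v" if "x \<bullet> x = 1" for v x :: "real^3"
    unfolding norm_le using that by (simp add: inner_diff_left inner_diff_right inner_commute)
  then show ?thesis unfolding norm3_warp_deriv[OF m] using m by (auto simp: dot_square_norm)
qed

text \<open>The vector field dual to \<open>\<Phi>\<close> contracted with \<open>g_S1\<close> in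
  its last two slots; \<open>\<i> * snd m\<close> is the unit tangent of the circle. Unlike a
  formula in the polar frame it is defined and continuous on the manifold itself.\<close>

definition pair_field :: "tensor3 \<Rightarrow> ambient \<Rightarrow> real^3" where
  "pair_field \<Phi> m = (\<Sum>b\<in>Basis. \<Phi> m (tproj m (b, 0)) (0, \<i> * snd m) (0, \<i> * snd m) *\<^sub>R b)"

lemma inner3_warp_deriv:
  assumes \<Phi>: "smooth_tensor3 \<Phi>" and mm: "m \<in> S2 \<times> S1"
  shows "inner3 m (warp_deriv D m) (\<Phi> m) = D (fst m) \<bullet> pair_field \<Phi> m"
proof -
  obtain \<theta> \<phi> \<psi> where m: "m = chart ((\<theta>, \<phi>), \<psi>)" using chart_surj[OF mm] .
  note tri = smooth_tensor3_trilinear[OF \<Phi>]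
  let ?d = "D (fst m)" and ?t = "(0, \<i> * snd m)"
  have lin: "linear (\<lambda>v. \<Phi> m (tproj m (v, 0)) ?t ?t)"
    by (rule linear_compose[OF _ linear_compose[OF tproj_linear trilinearD(1)[OF tri]], unfolded o_def, of "\<lambda>v. (v, 0)"])
      (auto simp: linear_iff)
  have t: "tproj m (?d, 0) = (?d \<bullet> e_theta \<theta> \<phi>) *\<^sub>R (e_theta \<theta> \<phi>, 0) + (?d \<bullet> e_phi \<phi>) *\<^sub>R (e_phi \<phi>, 0)"
    by (simp add: tproj_def m spherical_tangential_part)
  have "inner3 m (warp_deriv D m) (\<Phi> m) = (?d \<bullet> e_theta \<theta> \<phi>) * \<Phi> m (e_theta \<theta> \<phi>, 0) ?t ?t
      + (?d \<bullet> e_phi \<phi>) * \<Phi> m (e_phi \<phi>, 0) ?t ?t"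
    unfolding m inner3_warp_deriv_chart[OF tri] by simp
  also have "\<dots> = \<Phi> m (tproj m (?d, 0)) ?t ?t"
    by (simp only: t trilinear_simps[OF tri])
  also have "\<dots> = (\<Sum>b\<in>Basis. (?d \<bullet> b) * \<Phi> m (tproj m (b, 0)) ?t ?t)"
    by (rule linear_basis_expansion[OF lin])
  also have "\<dots> = ?d \<bullet> pair_field \<Phi> m"
    by (simp add: pair_field_def inner_sum_right mult.commute)
  finally show ?thesis .
qed

lemma continuous_on_tproj:
  fixes f :: "'a::topological_space \<Rightarrow> ambient"
  assumes "continuous_on S f" "continuous_on S u"
  shows "continuous_on S (\<lambda>s. tproj (f s) (u s))"
  unfolding tproj_def by (intro continuous_intros assms)

lemma continuous_on_pair_field: "smooth_tensor3 \<Phi> \<Longrightarrow> continuous_on S (pair_field \<Phi>)"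
  unfolding pair_field_def
  by (intro continuous_intros continuous_on_smooth_tensor3 continuous_on_tproj)

text \<open>The pairing of \<open>g\<close> with the formal adjoint, in the projected ambient basis.
  It makes the pairing with \<open>warp_tensor\<close> affine in \<open>w\<close> with continuous
  coefficients.\<close>

definition adjoint_trace :: "tensor2 \<Rightarrow> tensor3 \<Rightarrow> ambient \<Rightarrow> real" where
  "adjoint_trace g \<Phi> m = - (\<Sum>u\<in>Basis. \<Sum>v\<in>Basis.
     g m (tproj m u) (tproj m v) * tangent_div3 \<Phi> m (tproj m u) (tproj m v))"

lemma inner2_warp_tensor_adjoint:
  assumes \<Phi>: "smooth_tensor3 \<Phi>" and m: "m \<in> S2 \<times> S1"
  shows "inner2 m (warp_tensor \<kappa> w m) (cov_adjoint \<Phi> m)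
    = \<kappa> * adjoint_trace g_S2 \<Phi> m + w (fst m) * adjoint_trace g_S1 \<Phi> m"
  unfolding inner2_cov_adjoint[OF \<Phi> m] adjoint_trace_def
    inner2_frame(2)[OF m orthonormal_frame_onb bilinear_warp_tensor bilinear_tangent_div3[OF \<Phi>]]
  by (simp add: warp_tensor_def distrib_right sum.distrib sum_distrib_left mult.assoc)

lemma continuous_on_adjoint_trace:
  assumes "smooth_tensor3 \<Phi>"
  shows "continuous_on S (adjoint_trace g_S2 \<Phi>)" "continuous_on S (adjoint_trace g_S1 \<Phi>)"
  unfolding adjoint_trace_def tangent_div3_def g_S2_def g_S1_def
  by (intro continuous_intros continuous_on_tangent_deriv3[OF assms] continuous_on_tproj)+

lemma continuous_on_bounded:
  fixes f :: "ambient \<Rightarrow> 'a::real_normed_vector"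
  assumes "continuous_on (S2 \<times> S1) f"
  obtains C where "C \<ge> 0" "\<And>m. m \<in> S2 \<times> S1 \<Longrightarrow> norm (f m) \<le> C"
proof -
  have "bounded (f ` (S2 \<times> S1))"
    by (intro compact_imp_bounded compact_continuous_image[OF assms] compact_Times compact_sphere)
  then show thesis using that unfolding bounded_pos by (metis image_eqI less_imp_le)
qed

section \<open>The volume measure in the polar chart\<close>

lemma AE_lborel_fst_snd_neq:
  fixes c :: real
  shows "AE p in lborel. fst (p :: real \<times> real) \<noteq> c" "AE p in lborel. snd (p :: real \<times> real) \<noteq> c"
proof -
  have *: "emeasure (lborel :: (real \<times> real) measure) ({c} \<times> UNIV) = 0"
     "emeasure (lborel :: (real \<times> real) measure) (UNIV \<times> {c}) = 0"
    by (simp_all add: lborel_prod[symmetric] lborel.emeasure_pair_measure_Times)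
  show "AE p in lborel. fst (p :: real \<times> real) \<noteq> c"
    by (rule AE_I[OF _ *(1)]) (auto simp: lborel_prod[symmetric])
  show "AE p in lborel. snd (p :: real \<times> real) \<noteq> c"
    by (rule AE_I[OF _ *(2)]) (auto simp: lborel_prod[symmetric])
qed

lemma vec3_expansion:
  "(v::real^3) = (v $ 1) *\<^sub>R vector [1, 0, 0] + (v $ 2) *\<^sub>R vector [0, 1, 0] + (v $ 3) *\<^sub>R vector [0, 0, 1]"
  by (simp add: vec3_eq_iff)

lemma vec3_fun_expansion:
  "(f :: 'a \<Rightarrow> real^3) = (\<lambda>s. (f s $ 1) *\<^sub>R vector [1, 0, 0] + (f s $ 2) *\<^sub>R vector [0, 1, 0]
     + (f s $ 3) *\<^sub>R vector [0, 0, 1])"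
  by (simp add: vec3_eq_iff fun_eq_iff)

lemma continuous_on_vec3:
  fixes f :: "'a::topological_space \<Rightarrow> real^3"
  assumes "continuous_on S (\<lambda>s. f s $ 1)" "continuous_on S (\<lambda>s. f s $ 2)" "continuous_on S (\<lambda>s. f s $ 3)"
  shows "continuous_on S f"
  by (subst vec3_fun_expansion) (intro continuous_intros assms)

lemma has_vector_derivative_vec3:
  fixes f :: "real \<Rightarrow> real^3"
  assumes "((\<lambda>s. f s $ 1) has_real_derivative f' $ 1) (at t)"
    "((\<lambda>s. f s $ 2) has_real_derivative f' $ 2) (at t)"
    "((\<lambda>s. f s $ 3) has_real_derivative f' $ 3) (at t)"
  shows "(f has_vector_derivative f') (at t)"
proof -
  have "((\<lambda>s. (f s $ 1) *\<^sub>R vector [1, 0, 0] + (f s $ 2) *\<^sub>R vector [0, 1, 0]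
     + (f s $ 3) *\<^sub>R vector [0, 0, 1] :: real^3) has_vector_derivative
     ((f' $ 1) *\<^sub>R vector [1, 0, 0] + (f' $ 2) *\<^sub>R vector [0, 1, 0] + (f' $ 3) *\<^sub>R vector [0, 0, 1])) (at t)"
    using assms by (auto intro!: derivative_eq_intros)
  then show ?thesis by (simp only: vec3_fun_expansion[symmetric] vec3_expansion[symmetric])
qed

lemma continuous_on_polar:
  fixes a b :: "'a::t2_space \<Rightarrow> real"
  assumes "continuous_on S a" "continuous_on S b"
  shows "continuous_on S (\<lambda>s. spherical_coords (a s, b s))" "continuous_on S (\<lambda>s. e_theta (a s) (b s))"
proof -
  show "continuous_on S (\<lambda>s. spherical_coords (a s, b s))"
    by (rule continuous_on_vec3; simp) (intro continuous_intros assms)+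
  show "continuous_on S (\<lambda>s. e_theta (a s) (b s))"
    by (rule continuous_on_vec3; simp) (intro continuous_intros assms)+
qed

lemma continuous_on_e_phi:
  fixes b :: "'a::t2_space \<Rightarrow> real"
  assumes "continuous_on S b"
  shows "continuous_on S (\<lambda>s. e_phi (b s))"
  by (rule continuous_on_vec3; simp) (intro continuous_intros assms)+

text \<open>The closed parameter box replaces the half-open one, at the cost of a null set: it is
  compact, and the fundamental theorem of calculus is applied on closed intervals.\<close>

definition S2_density :: "real \<times> real \<Rightarrow> real" where
  "S2_density p = indicator ({0..pi} \<times> {0..2*pi}) p * sin (fst p)"

lemma S2_density_nonneg: "0 \<le> S2_density p"
  by (auto simp: S2_density_def indicator_def intro!: mult_nonneg_nonneg sin_ge_zero)

lemma S2_density_measurable [measurable]: "S2_density \<in> borel_measurable borel"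
  unfolding S2_density_def by (auto simp: borel_prod[symmetric])

lemma spherical_coords_measurable [measurable]:
  "spherical_coords \<in> measurable borel (restrict_space borel S2)"
proof -
  have "continuous_on UNIV (\<lambda>p. spherical_coords (fst p, snd p))"
    by (intro continuous_on_polar continuous_intros)
  then have "spherical_coords \<in> borel_measurable borel"
    by (intro borel_measurable_continuous_onI) simp
  then show ?thesis
    using spherical_coords_in_S2 by (intro measurable_restrict_space2) blast+
qed

lemma S2_measure_eq:
  "S2_measure = distr (density lborel (\<lambda>p. ennreal (S2_density p))) (restrict_space borel S2) spherical_coords"
proof -
  have "AE p in lborel. ennreal (indicator ({0..pi} \<times> {0..<2*pi}) p * sin (fst p)) = ennreal (S2_density p)"
    using AE_lborel_fst_snd_neq(2)[of "2 * pi"]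
    by eventually_elim (auto simp: S2_density_def indicator_def)
  moreover have "(\<lambda>p::real\<times>real. ennreal (indicator ({0..pi} \<times> {0..<2*pi}) p * sin (fst p))) \<in> borel_measurable lborel"
    by (auto simp: borel_prod[symmetric])
  ultimately show ?thesis
    unfolding S2_measure_def split_beta prod.collapse
    by (subst density_cong) auto
qed

lemma S1_measure_eq:
  "S1_measure = distr (density lborel (\<lambda>t. ennreal (indicator {0..2*pi} t))) (restrict_space borel S1) cis"
proof -
  have "AE t in lborel. (indicator {0..<2*pi} t :: ennreal) = ennreal (indicator {0..2*pi} t)"
    using AE_lborel_singleton[of "2 * pi"] by eventually_elim (auto simp: indicator_def)
  then show ?thesis
    unfolding S1_measure_def by (subst density_cong) auto
qed

lemma cis_measurable [measurable]: "cis \<in> measurable borel (restrict_space borel S1)"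
proof -
  have "cis \<in> borel_measurable borel"
    by (intro borel_measurable_continuous_onI continuous_intros)
  then show ?thesis by (intro measurable_restrict_space2) auto
qed

lemma space_measures [simp]: "space S2_measure = S2" "space S1_measure = S1" "space vol = S2 \<times> S1"
  by (auto simp: S2_measure_def S1_measure_def vol_def space_pair_measure space_restrict_space)

lemma sets_measures [measurable_cong]:
  "sets S2_measure = sets (restrict_space borel S2)" "sets S1_measure = sets (restrict_space borel S1)"
  by (auto simp: S2_measure_def S1_measure_def)

lemma finite_S2_measure: "finite_measure S2_measure"
proof
  have vim: "spherical_coords -` S2 = UNIV" using spherical_coords_in_S2 by blast
  have "emeasure S2_measure S2 = (\<integral>\<^sup>+p. ennreal (S2_density p) \<partial>lborel)"
    unfolding S2_measure_eq
    by (subst emeasure_distr) (auto simp: vim emeasure_density space_restrict_space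
        intro!: sets.top[of "restrict_space borel S2", simplified space_restrict_space, simplified])
  also have "\<dots> \<le> (\<integral>\<^sup>+p. indicator ({0..pi} \<times> {0..2*pi}) p \<partial>(lborel :: (real\<times>real) measure))"
    by (intro nn_integral_mono) (auto simp: S2_density_def indicator_def)
  also have "\<dots> = emeasure (lborel :: (real\<times>real) measure) ({0..pi} \<times> {0..2*pi})"
    by (intro nn_integral_indicator) (auto simp: borel_prod[symmetric])
  also have "\<dots> < \<infinity>"
    by (intro emeasure_compact_finite compact_Times) auto
  finally show "emeasure S2_measure (space S2_measure) \<noteq> \<infinity>" by simp
qed

lemma emeasure_S1_measure: "emeasure S1_measure S1 = ennreal (2 * pi)"
proof -
  have vim: "cis -` S1 = UNIV" by auto
  have "emeasure S1_measure S1 = (\<integral>\<^sup>+t. ennreal (indicator {0..2*pi} t) \<partial>lborel)"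
    unfolding S1_measure_eq
    by (subst emeasure_distr) (auto simp: vim emeasure_density space_restrict_space
        intro!: sets.top[of "restrict_space borel S1", simplified space_restrict_space, simplified])
  then show ?thesis by (simp add: ennreal_indicator)
qed

lemma finite_S1_measure: "finite_measure S1_measure"
  by standard (simp add: emeasure_S1_measure)

lemma finite_vol: "finite_measure vol"
  unfolding vol_def by (rule finite_measure_pair_measure[OF finite_S1_measure finite_S2_measure])

definition vol_density :: "(real \<times> real) \<times> real \<Rightarrow> real" where
  "vol_density q = S2_density (fst q) * indicator {0..2*pi} (snd q)"

lemma vol_density_nonneg: "0 \<le> vol_density q"
  by (auto simp: vol_density_def S2_density_nonneg)

lemma borel_param: "(borel :: ((real \<times> real) \<times> real) measure) = borel \<Otimes>\<^sub>M borel"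
  by (simp add: borel_prod)

lemma vol_density_measurable [measurable]: "vol_density \<in> borel_measurable borel"
  unfolding vol_density_def borel_param by measurable

lemma chart_split: "chart = (\<lambda>(p, t). (spherical_coords p, cis t))"
  by (rule ext) (auto split: prod.splits)

lemma chart_measurable [measurable]:
  "chart \<in> measurable borel (restrict_space borel S2 \<Otimes>\<^sub>M restrict_space borel S1)"
  unfolding chart_split borel_param by measurable

lemma vol_eq:
  "vol = distr (density lborel (\<lambda>q. ennreal (vol_density q)))
     (restrict_space borel S2 \<Otimes>\<^sub>M restrict_space borel S1) chart"
proof -
  have s1: "sigma_finite_measure (density lborel (\<lambda>t. ennreal (indicator {0..2*pi} t)))"
    by (rule finite_measure.axioms(1), rule finite_measureI)
      (simp add: emeasure_density ennreal_indicator)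
  have s2: "sigma_finite_measure (distr (density lborel (\<lambda>t. ennreal (indicator {0..2*pi} t))) (restrict_space borel S1) cis)"
    using finite_measure.axioms(1)[OF finite_S1_measure] unfolding S1_measure_eq .
  have "vol = distr (density lborel (\<lambda>p. ennreal (S2_density p)) \<Otimes>\<^sub>M density lborel (\<lambda>t. ennreal (indicator {0..2*pi} t)))
      (restrict_space borel S2 \<Otimes>\<^sub>M restrict_space borel S1) (\<lambda>(p, t). (spherical_coords p, cis t))"
    unfolding vol_def S2_measure_eq S1_measure_eq
    by (rule pair_measure_distr[OF _ _ s2]) simp_all
  also have "density lborel (\<lambda>p. ennreal (S2_density p)) \<Otimes>\<^sub>M density lborel (\<lambda>t. ennreal (indicator {0..2*pi} t))
      = density (lborel \<Otimes>\<^sub>M lborel) (\<lambda>(p, t). ennreal (S2_density p) * ennreal (indicator {0..2*pi} t))"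
    by (rule pair_measure_density[OF _ _ _ s1]) (simp_all add: lborel.sigma_finite_measure_axioms)
  also have "\<dots> = density lborel (\<lambda>q. ennreal (vol_density q))"
    unfolding lborel_prod by (rule arg_cong[where f = "density lborel"])
      (auto simp: vol_density_def ennreal_mult S2_density_nonneg)
  finally show ?thesis unfolding chart_split .
qed

lemma sets_vol [measurable_cong]: "sets vol = sets (restrict_space borel S2 \<Otimes>\<^sub>M restrict_space borel S1)"
  by (simp add: vol_eq)

lemma integral_vol:
  fixes F :: "ambient \<Rightarrow> real"
  assumes [measurable]: "F \<in> borel_measurable vol"
  shows "(LINT m|vol. F m) = (LINT q|lborel. vol_density q * F (chart q))"
proof -
  have F: "F \<in> borel_measurable (restrict_space borel S2 \<Otimes>\<^sub>M restrict_space borel S1)"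
    using assms by (simp cong: measurable_cong_sets add: sets_vol)
  have "(LINT m|vol. F m) = (LINT q|density lborel (\<lambda>q. ennreal (vol_density q)). F (chart q))"
    unfolding vol_eq by (rule integral_distr) (use F in \<open>simp_all\<close>)
  also have "\<dots> = (LINT q|lborel. vol_density q *\<^sub>R F (chart q))"
    by (rule integral_density)
       (use measurable_compose[OF chart_measurable F] in \<open>auto simp: vol_density_nonneg\<close>)
  finally show ?thesis by simp
qed

lemma borel_measurable_vol_continuous:
  fixes F :: "ambient \<Rightarrow> 'a::topological_space"
  assumes "continuous_on (S2 \<times> S1) F"
  shows "F \<in> borel_measurable vol"
proof -
  have 1: "(\<lambda>x. x) \<in> measurable (restrict_space borel S2) borel" "(\<lambda>x. x) \<in> measurable (restrict_space borel S1) borel"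
    by (auto intro!: measurable_restrict_space1)
  have "(\<lambda>m. m) \<in> measurable (restrict_space borel S2 \<Otimes>\<^sub>M restrict_space borel S1) (borel \<Otimes>\<^sub>M borel)"
    using measurable_Pair[OF measurable_compose[OF measurable_fst 1(1)] measurable_compose[OF measurable_snd 1(2)]] by simp
  then have "(\<lambda>m. m) \<in> measurable vol borel"
    unfolding borel_prod by (simp cong: measurable_cong_sets add: sets_vol)
  then have "(\<lambda>m. m) \<in> measurable vol (restrict_space borel (S2 \<times> S1))"
    by (intro measurable_restrict_space2) auto
  from measurable_compose[OF this borel_measurable_continuous_on_restrict[OF assms]]
  show ?thesis .
qed

text \<open>Fubini if \<open>f\<close> is integrable; otherwise the integral is 0 by
  convention.\<close>

lemma lborel_prod_integral_zero:
  fixes f :: "'a::euclidean_space \<times> 'b::euclidean_space \<Rightarrow> real"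
  shows "(\<And>y. (LINT x|lborel. f (x, y)) = 0) \<Longrightarrow> (LINT p|lborel. f p) = 0"
    and "(\<And>x. (LINT y|lborel. f (x, y)) = 0) \<Longrightarrow> (LINT p|lborel. f p) = 0"
proof -
  show "(LINT p|lborel. f p) = 0" if "\<And>y. (LINT x|lborel. f (x, y)) = 0"
  proof (cases "integrable lborel f")
    case True
    then have "integrable (lborel \<Otimes>\<^sub>M lborel) (\<lambda>(x, y). f (x, y))" by (simp add: lborel_prod)
    from lborel_pair.integral_snd[OF this] that show ?thesis by (simp add: lborel_prod)
  qed (rule not_integrable_integral_eq)
  show "(LINT p|lborel. f p) = 0" if "\<And>x. (LINT y|lborel. f (x, y)) = 0"
  proof (cases "integrable lborel f")
    case True
    then have "integrable (lborel \<Otimes>\<^sub>M lborel) f" by (simp add: lborel_prod)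
    from lborel_pair.integral_fst'[OF this] that show ?thesis by (simp add: lborel_prod)
  qed (rule not_integrable_integral_eq)
qed

lemma integral_derivative_zero:
  fixes G h :: "real \<Rightarrow> real"
  assumes "a \<le> b" "\<And>t. (G has_real_derivative h t) (at t)" "continuous_on UNIV h" "G a = G b"
  shows "(LINT t|lborel. indicator {a..b} t * h t) = 0"
proof -
  have "(LINT t|lborel. indicator {a..b} t *\<^sub>R h t) = G b - G a"
    by (rule integral_FTC_Icc[OF assms(1)])
      (use assms(2,3) in \<open>auto simp: has_real_derivative_iff_has_vector_derivative
        intro: has_vector_derivative_at_within continuous_on_subset\<close>)
  then show ?thesis using assms(4) by simp
qed

abbreviation param_box :: "((real \<times> real) \<times> real) set" where
  "param_box \<equiv> ({0..pi} \<times> {0..2*pi}) \<times> {0..2*pi}"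

text \<open>The divergence theorem on the box for a field with a single component: the three
  alternatives are the three coordinate directions, with \<open>G\<close> equal on opposite
  faces.\<close>

lemma integral_box_derivative_zero:
  fixes G h :: "real \<Rightarrow> real \<Rightarrow> real \<Rightarrow> real"
  assumes h: "continuous_on UNIV (\<lambda>q. h (fst (fst q)) (snd (fst q)) (snd q))"
    and "(\<forall>\<theta> \<phi> \<psi>. ((\<lambda>s. G s \<phi> \<psi>) has_real_derivative h \<theta> \<phi> \<psi>) (at \<theta>)) \<and> (\<forall>\<phi> \<psi>. G 0 \<phi> \<psi> = G pi \<phi> \<psi>)
      \<or> (\<forall>\<theta> \<phi> \<psi>. ((\<lambda>s. G \<theta> s \<psi>) has_real_derivative h \<theta> \<phi> \<psi>) (at \<phi>)) \<and> (\<forall>\<theta> \<psi>. G \<theta> 0 \<psi> = G \<theta> (2*pi) \<psi>)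
      \<or> (\<forall>\<theta> \<phi> \<psi>. ((\<lambda>s. G \<theta> \<phi> s) has_real_derivative h \<theta> \<phi> \<psi>) (at \<psi>)) \<and> (\<forall>\<theta> \<phi>. G \<theta> \<phi> 0 = G \<theta> \<phi> (2*pi))"
  shows "(LINT q|lborel. indicator param_box q * h (fst (fst q)) (snd (fst q)) (snd q)) = 0"
proof -
  have c1: "continuous_on UNIV (\<lambda>\<theta>. h \<theta> \<phi> \<psi>)" for \<phi> \<psi>
    using continuous_on_compose2[OF h, of UNIV "\<lambda>\<theta>. ((\<theta>, \<phi>), \<psi>)"] by (simp add: continuous_intros)
  have c2: "continuous_on UNIV (\<lambda>\<phi>. h \<theta> \<phi> \<psi>)" for \<theta> \<psi>
    using continuous_on_compose2[OF h, of UNIV "\<lambda>\<phi>. ((\<theta>, \<phi>), \<psi>)"] by (simp add: continuous_intros)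
  have c3: "continuous_on UNIV (\<lambda>\<psi>. h \<theta> \<phi> \<psi>)" for \<theta> \<phi>
    using continuous_on_compose2[OF h, of UNIV "\<lambda>\<psi>. ((\<theta>, \<phi>), \<psi>)"] by (simp add: continuous_intros)
  have ind: "indicator param_box ((\<theta>, \<phi>), \<psi>) =
      (indicator {0..pi} \<theta> * indicator {0..2*pi} \<phi> * indicator {0..2*pi} \<psi> :: real)" for \<theta> \<phi> \<psi>
    by (auto simp: indicator_def)
  consider (1) "\<And>\<theta> \<phi> \<psi>. ((\<lambda>s. G s \<phi> \<psi>) has_real_derivative h \<theta> \<phi> \<psi>) (at \<theta>)" "\<And>\<phi> \<psi>. G 0 \<phi> \<psi> = G pi \<phi> \<psi>"
    | (2) "\<And>\<theta> \<phi> \<psi>. ((\<lambda>s. G \<theta> s \<psi>) has_real_derivative h \<theta> \<phi> \<psi>) (at \<phi>)" "\<And>\<theta> \<psi>. G \<theta> 0 \<psi> = G \<theta> (2*pi) \<psi>"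
    | (3) "\<And>\<theta> \<phi> \<psi>. ((\<lambda>s. G \<theta> \<phi> s) has_real_derivative h \<theta> \<phi> \<psi>) (at \<psi>)" "\<And>\<theta> \<phi>. G \<theta> \<phi> 0 = G \<theta> \<phi> (2*pi)"
    using assms(2) by blast
  note cases = this
  have perm: "x * y * z * w = x * w * (y * z)" "x * y * z * w = y * w * (x * z)" "x * y * z * w = z * w * (x * y)"
    for x y z w :: real by simp_all
  from cases show ?thesis
  proof cases
    case 1
    have "(LINT \<theta>|lborel. indicator {0..pi} \<theta> * h \<theta> \<phi> \<psi>) = 0" for \<phi> \<psi>
      by (rule integral_derivative_zero[OF _ 1(1) c1 1(2)]) simp
    then have "(LINT \<theta>|lborel. indicator param_box ((\<theta>, \<phi>), \<psi>) * h \<theta> \<phi> \<psi>) = 0" for \<phi> \<psi>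
      unfolding ind perm(1) by simp
    then have "(LINT p|lborel. indicator param_box (p, \<psi>) * h (fst p) (snd p) \<psi>) = 0" for \<psi>
      by - (rule lborel_prod_integral_zero(1), simp)
    then show ?thesis
      by - (rule lborel_prod_integral_zero(1), simp)
  next
    case 2
    have "(LINT \<phi>|lborel. indicator {0..2*pi} \<phi> * h \<theta> \<phi> \<psi>) = 0" for \<theta> \<psi>
      by (rule integral_derivative_zero[OF _ 2(1) c2 2(2)]) simp
    then have "(LINT \<phi>|lborel. indicator param_box ((\<theta>, \<phi>), \<psi>) * h \<theta> \<phi> \<psi>) = 0" for \<theta> \<psi>
      unfolding ind perm(2) by simp
    then have "(LINT p|lborel. indicator param_box (p, \<psi>) * h (fst p) (snd p) \<psi>) = 0" for \<psi>
      by - (rule lborel_prod_integral_zero(2), simp)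
    then show ?thesis
      by - (rule lborel_prod_integral_zero(1), simp)
  next
    case 3
    have "(LINT \<psi>|lborel. indicator {0..2*pi} \<psi> * h \<theta> \<phi> \<psi>) = 0" for \<theta> \<phi>
      by (rule integral_derivative_zero[OF _ 3(1) c3 3(2)]) simp
    then have "(LINT \<psi>|lborel. indicator param_box ((\<theta>, \<phi>), \<psi>) * h \<theta> \<phi> \<psi>) = 0" for \<theta> \<phi>
      unfolding ind perm(3) by simp
    then show ?thesis
      by - (rule lborel_prod_integral_zero(2), simp add: split_paired_all)
  qed
qed

section \<open>Integration by parts\<close>

text \<open>By the Gauss formula the derivative of a tangent field along the curve has normal part
  \<open>- second_form\<close>, which \<open>tangent_deriv3\<close> absorbs. The remainders
  \<open>ru\<close>, \<open>rv\<close>, \<open>rw\<close> are the covariant derivatives of the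
  fields, so this is the Leibniz rule of the connection.\<close>

lemma has_real_derivative_tensor3_curve:
  fixes f u v w :: "real \<Rightarrow> ambient"
  assumes \<Phi>: "smooth_tensor3 \<Phi>"
    and f: "(f has_vector_derivative X) (at t)"
    and u: "(u has_vector_derivative - second_form (f t) X (u t) + ru) (at t)"
    and v: "(v has_vector_derivative - second_form (f t) X (v t) + rv) (at t)"
    and w: "(w has_vector_derivative - second_form (f t) X (w t) + rw) (at t)"
  shows "((\<lambda>s. \<Phi> (f s) (u s) (v s) (w s)) has_real_derivative
     (tangent_deriv3 \<Phi> (f t) X (u t) (v t) (w t) + \<Phi> (f t) ru (v t) (w t) + \<Phi> (f t) (u t) rv (w t)
        + \<Phi> (f t) (u t) (v t) rw)) (at t)"
  unfolding has_real_derivative_iff_has_vector_derivative has_vector_derivative_def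
  by (rule has_derivative_eq_rhs[OF has_derivative_tensor3_fields[OF \<Phi>
        f[unfolded has_vector_derivative_def] u[unfolded has_vector_derivative_def]
        v[unfolded has_vector_derivative_def] w[unfolded has_vector_derivative_def]]])
    (simp add: fun_eq_iff tangent_deriv3_def trilinear_simps[OF smooth_tensor3_trilinear[OF \<Phi>]]
      linear_scale[OF linear_tensor3_deriv_direction[OF \<Phi>]] algebra_simps del: add_uminus_conv_diff)

text \<open>These contain the connection coefficients of the polar frame: along a parallel
  \<open>e_theta\<close> turns by cos \<theta> towards \<open>e_phi\<close>, and
  \<open>e_phi\<close> by - cos \<theta> towards \<open>e_theta\<close>. In the last equation
  \<theta> is arbitrary, since (cos \<phi>, sin \<phi>, 0) has such a decomposition for every
  \<theta>.\<close>

lemma has_vector_derivative_polar: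
  "((\<lambda>s. spherical_coords (s, \<phi>)) has_vector_derivative e_theta \<theta> \<phi>) (at \<theta>)"
  "((\<lambda>s. e_theta s \<phi>) has_vector_derivative - spherical_coords (\<theta>, \<phi>)) (at \<theta>)"
  "((\<lambda>s. spherical_coords (\<theta>, s)) has_vector_derivative sin \<theta> *\<^sub>R e_phi \<phi>) (at \<phi>)"
  "((\<lambda>s. e_theta \<theta> s) has_vector_derivative cos \<theta> *\<^sub>R e_phi \<phi>) (at \<phi>)"
  "((\<lambda>s. e_phi s) has_vector_derivative - sin \<theta> *\<^sub>R spherical_coords (\<theta>, \<phi>) - cos \<theta> *\<^sub>R e_theta \<theta> \<phi>) (at \<phi>)"
proof -
  have *: "c * (cos \<theta> * cos \<theta>) + c * (sin \<theta> * sin \<theta>) = c"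
      "cos \<theta> * (cos \<theta> * c) + c * (sin \<theta> * sin \<theta>) = c" for c
    using sin_cos_squared_add3[of \<theta>] by algebra+
  show
  "((\<lambda>s. spherical_coords (s, \<phi>)) has_vector_derivative e_theta \<theta> \<phi>) (at \<theta>)"
  "((\<lambda>s. e_theta s \<phi>) has_vector_derivative - spherical_coords (\<theta>, \<phi>)) (at \<theta>)"
  "((\<lambda>s. spherical_coords (\<theta>, s)) has_vector_derivative sin \<theta> *\<^sub>R e_phi \<phi>) (at \<phi>)"
  "((\<lambda>s. e_theta \<theta> s) has_vector_derivative cos \<theta> *\<^sub>R e_phi \<phi>) (at \<phi>)"
  "((\<lambda>s. e_phi s) has_vector_derivative - sin \<theta> *\<^sub>R spherical_coords (\<theta>, \<phi>) - cos \<theta> *\<^sub>R e_theta \<theta> \<phi>) (at \<phi>)"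
    by (rule has_vector_derivative_vec3; auto intro!: derivative_eq_intros simp: algebra_simps *)+
qed

lemma has_vector_derivative_cis:
  "(cis has_vector_derivative (\<i> * cis \<psi>)) (at \<psi>)"
  "((\<lambda>s. \<i> * cis s) has_vector_derivative - cis \<psi>) (at \<psi>)"
proof -
  show 1: "(cis has_vector_derivative (\<i> * cis \<psi>)) (at \<psi>)"
    unfolding has_vector_derivative_complex_iff by (auto intro!: derivative_eq_intros)
  show "((\<lambda>s. \<i> * cis s) has_vector_derivative - cis \<psi>) (at \<psi>)"
    unfolding has_vector_derivative_complex_iff by (auto intro!: derivative_eq_intros)
qed

text \<open>Only the tangential part of the derivative of \<open>w\<close> is prescribed by \<open>D\<close>.\<close>
definition sphere_C1 :: "(real^3 \<Rightarrow> real) \<Rightarrow> (real^3 \<Rightarrow> real^3) \<Rightarrow> bool" where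
  "sphere_C1 w D \<longleftrightarrow> continuous_on S2 D \<and>
     (\<forall>x\<in>S2. \<exists>w'. (w has_derivative w') (at x) \<and> (\<forall>v. v \<bullet> x = 0 \<longrightarrow> w' v = D x \<bullet> v))"

lemma sphere_C1_continuous: "sphere_C1 w D \<Longrightarrow> continuous_on S2 w"
  unfolding sphere_C1_def by (meson continuous_at_imp_continuous_on has_derivative_continuous)

lemma sphere_C1_curve:
  assumes w: "sphere_C1 w D" and f: "(f has_vector_derivative v) (at t)"
    and x: "f t \<in> S2" and v: "v \<bullet> f t = 0"
  shows "((\<lambda>s. w (f s)) has_real_derivative D (f t) \<bullet> v) (at t)"
proof -
  obtain w' where w': "(w has_derivative w') (at (f t))" "\<And>v. v \<bullet> f t = 0 \<Longrightarrow> w' v = D (f t) \<bullet> v"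
    using w x unfolding sphere_C1_def by blast
  have "((\<lambda>s. w (f s)) has_derivative (\<lambda>h. w' (h *\<^sub>R v))) (at t)"
    using has_derivative_compose[OF f[unfolded has_vector_derivative_def] w'(1)] .
  then show ?thesis
    unfolding has_real_derivative_iff_has_vector_derivative has_vector_derivative_def
    by (simp add: linear_scale[OF has_derivative_linear[OF w'(1)]] w'(2)[OF v])
qed

text \<open>The integrand is the divergence of the field obtained by contracting \<Phi> with the
  tensor in its last two slots. The integral of the difference is kept whole here and split only
  once an integrable majorant is at hand.\<close>

lemma sphere_C1_divergence:
  assumes \<Phi>: "smooth_tensor3 \<Phi>" and w: "sphere_C1 w D"
  shows "(LINT m|vol. inner3 m (warp_deriv D m) (\<Phi> m) - inner2 m (warp_tensor \<kappa> w m) (cov_adjoint \<Phi> m)) = 0"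
proof -
  note tri = smooth_tensor3_trilinear[OF \<Phi>]
  let ?m = "\<lambda>\<theta> \<phi> \<psi>. (spherical_coords (\<theta>, \<phi>), cis \<psi>) :: ambient"
  let ?et = "\<lambda>\<theta> \<phi>. (e_theta \<theta> \<phi>, 0) :: ambient"
  let ?ep = "\<lambda>\<phi>. (e_phi \<phi>, 0) :: ambient"
  let ?ta = "\<lambda>\<psi>. (0, \<i> * cis \<psi>) :: ambient"
  let ?x = "\<lambda>\<theta> \<phi>. spherical_coords (\<theta>, \<phi>)"
  txt \<open>\<open>\<alpha> e\<close> is the contraction of the tensor with \<open>\<Phi> e\<close>. Multiplied by the density \<open>sin \<theta>\<close>, the integrand
    is \<open>\<partial>\<^sub>\<theta> (sin \<theta> \<alpha> e\<^sub>\<theta>) + \<partial>\<^sub>\<phi> (\<alpha> e\<^sub>\<phi>) + \<partial>\<^sub>\<psi> (sin \<theta> \<alpha> \<tau>)\<close>; these summands are \<open>h1\<close>, \<open>h2\<close>, \<open>h3\<close>.\<close>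
  define \<alpha> where "\<alpha> e \<theta> \<phi> \<psi> = \<kappa> * (\<Phi> (?m \<theta> \<phi> \<psi>) e (?et \<theta> \<phi>) (?et \<theta> \<phi>) + \<Phi> (?m \<theta> \<phi> \<psi>) e (?ep \<phi>) (?ep \<phi>))
      + w (?x \<theta> \<phi>) * \<Phi> (?m \<theta> \<phi> \<psi>) e (?ta \<psi>) (?ta \<psi>)" for e \<theta> \<phi> \<psi>
  define \<beta> where "\<beta> e \<theta> \<phi> \<psi> = \<kappa> * (tangent_deriv3 \<Phi> (?m \<theta> \<phi> \<psi>) e e (?et \<theta> \<phi>) (?et \<theta> \<phi>)
      + tangent_deriv3 \<Phi> (?m \<theta> \<phi> \<psi>) e e (?ep \<phi>) (?ep \<phi>))
      + w (?x \<theta> \<phi>) * tangent_deriv3 \<Phi> (?m \<theta> \<phi> \<psi>) e e (?ta \<psi>) (?ta \<psi>)" for e \<theta> \<phi> \<psi>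
  define \<gamma> where "\<gamma> e \<theta> \<phi> \<psi> = (D (?x \<theta> \<phi>) \<bullet> fst e) * \<Phi> (?m \<theta> \<phi> \<psi>) e (?ta \<psi>) (?ta \<psi>)" for e \<theta> \<phi> \<psi>
  define h1 where "h1 \<theta> \<phi> \<psi> = cos \<theta> * \<alpha> (?et \<theta> \<phi>) \<theta> \<phi> \<psi> + sin \<theta> * (\<beta> (?et \<theta> \<phi>) \<theta> \<phi> \<psi> + \<gamma> (?et \<theta> \<phi>) \<theta> \<phi> \<psi>)" for \<theta> \<phi> \<psi>
  define h2 where "h2 \<theta> \<phi> \<psi> = sin \<theta> * (\<beta> (?ep \<phi>) \<theta> \<phi> \<psi> + \<gamma> (?ep \<phi>) \<theta> \<phi> \<psi>) - cos \<theta> * \<alpha> (?et \<theta> \<phi>) \<theta> \<phi> \<psi>" for \<theta> \<phi> \<psi>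
  \<comment> \<open>No \<open>\<gamma>\<close> occurs because \<open>w\<close> does not depend on
    the circle coordinate.\<close>
  define h3 where "h3 \<theta> \<phi> \<psi> = sin \<theta> * \<beta> (?ta \<psi>) \<theta> \<phi> \<psi>" for \<theta> \<phi> \<psi>

  have x_in: "?x \<theta> \<phi> \<in> S2" for \<theta> \<phi> by (rule spherical_coords_in_S2)
  have lift1: "((\<lambda>s. (f s, c) :: ambient) has_vector_derivative (f', 0)) (at t)"
    if "(f has_vector_derivative f') (at t)" for f f' t and c :: complex
    using has_vector_derivative_Pair[OF that has_vector_derivative_const] .
  have lift2: "((\<lambda>s. (c, f s) :: ambient) has_vector_derivative (0, f')) (at t)"
    if "(f has_vector_derivative f') (at t)" for f f' t and c :: "real^3"
    using has_vector_derivative_Pair[OF has_vector_derivative_const that] .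

  have d1: "((\<lambda>s. \<alpha> (?et s \<phi>) s \<phi> \<psi>) has_real_derivative \<beta> (?et \<theta> \<phi>) \<theta> \<phi> \<psi> + \<gamma> (?et \<theta> \<phi>) \<theta> \<phi> \<psi>) (at \<theta>)" for \<theta> \<phi> \<psi>
  proof -
    \<comment> \<open>The whole frame is parallel along meridians, so all remainders are 0.\<close>
    have m': "((\<lambda>s. ?m s \<phi> \<psi>) has_vector_derivative ?et \<theta> \<phi>) (at \<theta>)"
      by (rule lift1 has_vector_derivative_polar)+
    have et': "((\<lambda>s. ?et s \<phi>) has_vector_derivative - second_form (?m \<theta> \<phi> \<psi>) (?et \<theta> \<phi>) (?et \<theta> \<phi>) + 0) (at \<theta>)"
      by (rule has_vector_derivative_eq_rhs, (rule lift1 has_vector_derivative_polar)+) (simp add: second_form_def)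
    have ep': "((\<lambda>s. ?ep \<phi>) has_vector_derivative - second_form (?m \<theta> \<phi> \<psi>) (?et \<theta> \<phi>) (?ep \<phi>) + 0) (at \<theta>)"
      by (rule has_vector_derivative_eq_rhs, rule has_vector_derivative_const) (simp add: second_form_def zero_prod_def)
    have ta': "((\<lambda>s. ?ta \<psi>) has_vector_derivative - second_form (?m \<theta> \<phi> \<psi>) (?et \<theta> \<phi>) (?ta \<psi>) + 0) (at \<theta>)"
      by (rule has_vector_derivative_eq_rhs, rule has_vector_derivative_const) (simp add: second_form_def zero_prod_def)
    have w': "((\<lambda>s. w (?x s \<phi>)) has_real_derivative D (?x \<theta> \<phi>) \<bullet> e_theta \<theta> \<phi>) (at \<theta>)"
      by (rule sphere_C1_curve[OF w has_vector_derivative_polar(1)]) (rule x_in, simp)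
    show ?thesis
      unfolding \<alpha>_def \<beta>_def \<gamma>_def
      by (rule derivative_eq_intros refl has_real_derivative_tensor3_curve[OF \<Phi> m' et' et' et']
          has_real_derivative_tensor3_curve[OF \<Phi> m' et' ep' ep']
          has_real_derivative_tensor3_curve[OF \<Phi> m' et' ta' ta'] w')+
        (simp add: trilinear_simps[OF tri] algebra_simps)
  qed
  have d2: "((\<lambda>s. \<alpha> (?ep s) \<theta> s \<psi>) has_real_derivative h2 \<theta> \<phi> \<psi>) (at \<phi>)" for \<theta> \<phi> \<psi>
  proof -
    have m': "((\<lambda>s. ?m \<theta> s \<psi>) has_vector_derivative sin \<theta> *\<^sub>R ?ep \<phi>) (at \<phi>)"
      by (rule has_vector_derivative_eq_rhs, (rule lift1 has_vector_derivative_polar)+) simp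
    have et': "((\<lambda>s. ?et \<theta> s) has_vector_derivative - second_form (?m \<theta> \<phi> \<psi>) (sin \<theta> *\<^sub>R ?ep \<phi>) (?et \<theta> \<phi>) + cos \<theta> *\<^sub>R ?ep \<phi>) (at \<phi>)"
      by (rule has_vector_derivative_eq_rhs, (rule lift1 has_vector_derivative_polar)+) (simp add: second_form_def)
    have ep': "((\<lambda>s. ?ep s) has_vector_derivative - second_form (?m \<theta> \<phi> \<psi>) (sin \<theta> *\<^sub>R ?ep \<phi>) (?ep \<phi>) + (- cos \<theta>) *\<^sub>R ?et \<theta> \<phi>) (at \<phi>)"
      by (rule has_vector_derivative_eq_rhs, (rule lift1 has_vector_derivative_polar(5)[where \<theta> = \<theta>])+) (simp add: second_form_def)
    have ta': "((\<lambda>s. ?ta \<psi>) has_vector_derivative - second_form (?m \<theta> \<phi> \<psi>) (sin \<theta> *\<^sub>R ?ep \<phi>) (?ta \<psi>) + 0) (at \<phi>)"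
      by (rule has_vector_derivative_eq_rhs, rule has_vector_derivative_const) (simp add: second_form_def zero_prod_def)
    have w': "((\<lambda>s. w (?x \<theta> s)) has_real_derivative D (?x \<theta> \<phi>) \<bullet> (sin \<theta> *\<^sub>R e_phi \<phi>)) (at \<phi>)"
      by (rule sphere_C1_curve[OF w has_vector_derivative_polar(3)]) (rule x_in, simp)
    \<comment> \<open>In the two contracted slots the rotations of \<open>e_theta\<close> and
      \<open>e_phi\<close> cancel, a trace being invariant under rotation. Only the rotation of the
      first slot survives, as the term with - cos \<theta> in \<open>h2\<close>; it cancels the
      derivative of sin \<theta> in \<open>h1\<close>.\<close>
    show ?thesis
      unfolding \<alpha>_def \<beta>_def \<gamma>_def h2_def
      by (rule derivative_eq_intros refl has_real_derivative_tensor3_curve[OF \<Phi> m' ep' et' et']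
          has_real_derivative_tensor3_curve[OF \<Phi> m' ep' ep' ep']
          has_real_derivative_tensor3_curve[OF \<Phi> m' ep' ta' ta'] w')+
        (simp only: trilinear_simps[OF tri] linear_scale[OF linear_tangent_deriv3(1)[OF \<Phi>]], simp add: algebra_simps)
  qed
  have d3: "((\<lambda>s. \<alpha> (?ta s) \<theta> \<phi> s) has_real_derivative \<beta> (?ta \<psi>) \<theta> \<phi> \<psi>) (at \<psi>)" for \<theta> \<phi> \<psi>
  proof -
    have m': "((\<lambda>s. ?m \<theta> \<phi> s) has_vector_derivative ?ta \<psi>) (at \<psi>)"
      by (rule lift2 has_vector_derivative_cis)+
    have et': "((\<lambda>s. ?et \<theta> \<phi>) has_vector_derivative - second_form (?m \<theta> \<phi> \<psi>) (?ta \<psi>) (?et \<theta> \<phi>) + 0) (at \<psi>)"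
      by (rule has_vector_derivative_eq_rhs, rule has_vector_derivative_const) (simp add: second_form_def zero_prod_def)
    have ep': "((\<lambda>s. ?ep \<phi>) has_vector_derivative - second_form (?m \<theta> \<phi> \<psi>) (?ta \<psi>) (?ep \<phi>) + 0) (at \<psi>)"
      by (rule has_vector_derivative_eq_rhs, rule has_vector_derivative_const) (simp add: second_form_def zero_prod_def)
    have ta': "((\<lambda>s. ?ta s) has_vector_derivative - second_form (?m \<theta> \<phi> \<psi>) (?ta \<psi>) (?ta \<psi>) + 0) (at \<psi>)"
      by (rule has_vector_derivative_eq_rhs, (rule lift2 has_vector_derivative_cis)+) (simp add: second_form_def)
    show ?thesis
      unfolding \<alpha>_def \<beta>_def
      by (rule derivative_eq_intros refl has_real_derivative_tensor3_curve[OF \<Phi> m' ta' et' et']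
          has_real_derivative_tensor3_curve[OF \<Phi> m' ta' ep' ep']
          has_real_derivative_tensor3_curve[OF \<Phi> m' ta' ta' ta'])+
        (simp add: trilinear_simps[OF tri] algebra_simps)
  qed

  have cx: "continuous_on UNIV (\<lambda>q :: (real \<times> real) \<times> real. ?x (fst (fst q)) (snd (fst q)))"
    by (intro continuous_on_polar continuous_intros)
  have cw: "continuous_on UNIV (\<lambda>q :: (real \<times> real) \<times> real. w (?x (fst (fst q)) (snd (fst q))))"
    by (rule continuous_on_compose2[OF sphere_C1_continuous[OF w] cx]) (use x_in in blast)
  have cD: "continuous_on UNIV (\<lambda>q :: (real \<times> real) \<times> real. D (?x (fst (fst q)) (snd (fst q))))"
    by (rule continuous_on_compose2[OF _ cx]) (use w x_in in \<open>auto simp: sphere_C1_def simp del: mem_sphere_0\<close>)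
  have c\<alpha>: "continuous_on UNIV (\<lambda>q. \<alpha> (?et (fst (fst q)) (snd (fst q))) (fst (fst q)) (snd (fst q)) (snd q))"
    unfolding \<alpha>_def by (intro continuous_intros continuous_on_smooth_tensor3[OF \<Phi>] continuous_on_polar continuous_on_e_phi cw)
  have ch1: "continuous_on UNIV (\<lambda>q. h1 (fst (fst q)) (snd (fst q)) (snd q))"
    unfolding h1_def \<beta>_def \<gamma>_def fst_conv
    by (intro continuous_intros continuous_on_smooth_tensor3[OF \<Phi>] continuous_on_tangent_deriv3[OF \<Phi>] continuous_on_polar continuous_on_e_phi cw cD c\<alpha>)
  have ch2: "continuous_on UNIV (\<lambda>q. h2 (fst (fst q)) (snd (fst q)) (snd q))"
    unfolding h2_def \<beta>_def \<gamma>_def fst_conv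
    by (intro continuous_intros continuous_on_smooth_tensor3[OF \<Phi>] continuous_on_tangent_deriv3[OF \<Phi>] continuous_on_polar continuous_on_e_phi cw cD c\<alpha>)
  have ch3: "continuous_on UNIV (\<lambda>q. h3 (fst (fst q)) (snd (fst q)) (snd q))"
    unfolding h3_def \<beta>_def \<gamma>_def fst_conv
    by (intro continuous_intros continuous_on_smooth_tensor3[OF \<Phi>] continuous_on_tangent_deriv3[OF \<Phi>] continuous_on_polar continuous_on_e_phi cw cD c\<alpha>)

  \<comment> \<open>The faces at the poles contribute nothing because of the factor sin \<theta>; in
    \<open>z2\<close> and \<open>z3\<close> opposite faces agree by periodicity.\<close>
  have z1: "(LINT q|lborel. indicator param_box q * h1 (fst (fst q)) (snd (fst q)) (snd q)) = 0"
  proof (rule integral_box_derivative_zero[OF ch1, of "\<lambda>\<theta> \<phi> \<psi>. sin \<theta> * \<alpha> (?et \<theta> \<phi>) \<theta> \<phi> \<psi>"], rule disjI1, intro conjI allI)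
    fix \<theta> \<phi> \<psi>
    show "((\<lambda>s. sin s * \<alpha> (?et s \<phi>) s \<phi> \<psi>) has_real_derivative h1 \<theta> \<phi> \<psi>) (at \<theta>)"
      by (rule derivative_eq_intros d1 refl)+ (simp add: h1_def)
  qed simp
  have z2: "(LINT q|lborel. indicator param_box q * h2 (fst (fst q)) (snd (fst q)) (snd q)) = 0"
  proof (rule integral_box_derivative_zero[OF ch2, of "\<lambda>\<theta> \<phi> \<psi>. \<alpha> (?ep \<phi>) \<theta> \<phi> \<psi>"], rule disjI2, rule disjI1, intro conjI allI)
    fix \<theta> \<psi>
    show "\<alpha> (?ep 0) \<theta> 0 \<psi> = \<alpha> (?ep (2 * pi)) \<theta> (2 * pi) \<psi>"
      by (simp add: \<alpha>_def e_phi_def e_theta_def spherical_coords_def)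
  qed (rule d2)
  have z3: "(LINT q|lborel. indicator param_box q * h3 (fst (fst q)) (snd (fst q)) (snd q)) = 0"
  proof (rule integral_box_derivative_zero[OF ch3, of "\<lambda>\<theta> \<phi> \<psi>. sin \<theta> * \<alpha> (?ta \<psi>) \<theta> \<phi> \<psi>"], rule disjI2, rule disjI2, intro conjI allI)
    fix \<theta> \<phi> \<psi>
    show "((\<lambda>s. sin \<theta> * \<alpha> (?ta s) \<theta> \<phi> s) has_real_derivative h3 \<theta> \<phi> \<psi>) (at \<psi>)"
      unfolding h3_def by (rule DERIV_cmult[OF d3])
    show "sin \<theta> * \<alpha> (?ta 0) \<theta> \<phi> 0 = sin \<theta> * \<alpha> (?ta (2 * pi)) \<theta> \<phi> (2 * pi)"
      by (simp add: \<alpha>_def)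
  qed

  let ?F = "\<lambda>m. inner3 m (warp_deriv D m) (\<Phi> m) - inner2 m (warp_tensor \<kappa> w m) (cov_adjoint \<Phi> m)"
  have key: "vol_density q * ?F (chart q) = indicator param_box q * h1 (fst (fst q)) (snd (fst q)) (snd q)
       + indicator param_box q * h2 (fst (fst q)) (snd (fst q)) (snd q) + indicator param_box q * h3 (fst (fst q)) (snd (fst q)) (snd q)" for q
  proof (cases q rule: chart.cases)
    case (1 \<theta> \<phi> \<psi>)
    have td: "tangent_div3 \<Phi> (?m \<theta> \<phi> \<psi>) U V = tangent_deriv3 \<Phi> (?m \<theta> \<phi> \<psi>) (?et \<theta> \<phi>) (?et \<theta> \<phi>) U V
       + tangent_deriv3 \<Phi> (?m \<theta> \<phi> \<psi>) (?ep \<phi>) (?ep \<phi>) U V + tangent_deriv3 \<Phi> (?m \<theta> \<phi> \<psi>) (?ta \<psi>) (?ta \<psi>) U V" for U V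
      using tangent_div3_frame[OF \<Phi> chart_in orthonormal_frame_polar, of \<theta> \<phi> \<psi> U V] unfolding sum_polar_frame by simp
    have 2: "?F (chart q) = \<gamma> (?et \<theta> \<phi>) \<theta> \<phi> \<psi> + \<gamma> (?ep \<phi>) \<theta> \<phi> \<psi> + \<beta> (?et \<theta> \<phi>) \<theta> \<phi> \<psi> + \<beta> (?ep \<phi>) \<theta> \<phi> \<psi> + \<beta> (?ta \<psi>) \<theta> \<phi> \<psi>"
      unfolding 1 inner2_cov_adjoint[OF \<Phi> chart_in] inner3_warp_deriv_chart[OF tri] inner2_warp_tensor_chart[OF bilinear_tangent_div3[OF \<Phi>]]
      by (simp add: td \<gamma>_def \<beta>_def algebra_simps)
    have "vol_density q = indicator param_box q * sin \<theta>"
      by (auto simp: 1 vol_density_def S2_density_def indicator_def)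
    then show ?thesis unfolding 2 by (simp add: 1 h1_def h2_def h3_def algebra_simps)
  qed
  have int: "integrable lborel (\<lambda>q. indicator param_box q * f q)" if "continuous_on UNIV f" for f :: "(real \<times> real) \<times> real \<Rightarrow> real"
    using borel_integrable_compact[of param_box f] that
    by (auto intro!: compact_Times intro: continuous_on_subset)
  have cd: "continuous_on (S2 \<times> S1) (\<lambda>m. D (fst m))" "continuous_on (S2 \<times> S1) (\<lambda>m. w (fst m))"
    using w sphere_C1_continuous[OF w] unfolding sphere_C1_def
    by (auto intro!: continuous_on_compose2[of S2 _ _ fst] continuous_intros simp del: mem_sphere_0)
  \<comment> \<open>\<open>?F\<close> is written with \<open>onb\<close>; continuity, and hence
    measurability, becomes visible only in the form without a chosen basis.\<close>
  have cF: "continuous_on (S2 \<times> S1) ?F"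
  proof (rule continuous_on_eq)
    show "continuous_on (S2 \<times> S1) (\<lambda>m. D (fst m) \<bullet> pair_field \<Phi> m - (\<kappa> * adjoint_trace g_S2 \<Phi> m + w (fst m) * adjoint_trace g_S1 \<Phi> m))"
      by (intro continuous_intros cd continuous_on_pair_field[OF \<Phi>] continuous_on_adjoint_trace[OF \<Phi>])
  qed (simp only: inner3_warp_deriv[OF \<Phi>] inner2_warp_tensor_adjoint[OF \<Phi>])
  show ?thesis
    unfolding integral_vol[OF borel_measurable_vol_continuous[OF cF]] key
    using z1 z2 z3 int[OF ch1] int[OF ch2] int[OF ch3] by simp
qed

section \<open>A uniform bound for the singular kernel\<close>

text \<open>A crude Jordan inequality. Up to pi/3 it follows from the mean value theorem, since the
  cosine is at least 1/2 there.\<close>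

lemma abs_sin_ge_half:
  fixes u :: real
  assumes "\<bar>u\<bar> \<le> pi / 2"
  shows "\<bar>u\<bar> / 2 \<le> \<bar>sin u\<bar>"
proof -
  have *: "v / 2 \<le> sin v" if v: "0 \<le> v" "v \<le> pi / 2" for v :: real
  proof (cases "v \<le> pi / 3")
    case True
    show ?thesis
    proof (cases "v = 0")
      case False
      then have "0 < v" using v by simp
      from MVT2[OF this, of sin cos] obtain z where z: "0 < z" "z < v" "sin v - sin 0 = (v - 0) * cos z"
        by (auto intro: DERIV_sin)
      have "cos (pi / 3) \<le> cos z"
        using z True by (intro cos_monotone_0_pi_le) auto
      then have "v * (1 / 2) \<le> v * cos z"
        using v by (intro mult_left_mono) (auto simp: cos_60)
      then show ?thesis using z(3) by simp
    qed simp
  next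
    \<comment> \<open>Here sin v is at least sqrt 3 / 2, hence at least 0.85, while v / 2 is at most
      0.8.\<close>
    case False
    have "sin (pi / 3) \<le> sin v"
      using False v by (intro sin_monotone_2pi_le) auto
    moreover have "1.7 \<le> sqrt 3" by (rule real_le_rsqrt) (simp add: power2_eq_square)
    moreover have "v \<le> 1.6" using v pi_less_4 pi_approx by simp
    ultimately show ?thesis by (simp add: sin_60)
  qed
  show ?thesis using *[of "\<bar>u\<bar>"] assms by (cases "u \<ge> 0") (auto simp: abs_if split: if_splits)
qed

lemma nn_integral_powr_finite:
  fixes q c :: real
  assumes "q < 1" "0 \<le> c"
  shows "(\<integral>\<^sup>+u. ennreal (indicator {-c..c} u * \<bar>u\<bar> powr (-q)) \<partial>lborel) < \<infinity>"
proof -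
  have hi: "((\<lambda>x. x powr (-q)) has_integral (c powr (-q + 1) / (-q + 1))) {0..c}"
    by (rule has_integral_powr_from_0) (use assms in auto)
  have "((\<lambda>x. indicator {0..c} x * x powr (-q)) has_integral (c powr (-q + 1) / (-q + 1))) UNIV"
    by (rule has_integral_eq[OF _ hi[unfolded has_integral_restrict_UNIV[of "{0..c}", symmetric]]]) (auto simp: indicator_def)
  then have I: "(\<integral>\<^sup>+u. ennreal (indicator {0..c} u * u powr (-q)) \<partial>lborel) = ennreal (c powr (-q + 1) / (-q + 1))"
    by (intro nn_integral_has_integral_lborel) auto
  have "(\<integral>\<^sup>+u. ennreal (indicator {-c..c} u * \<bar>u\<bar> powr (-q)) \<partial>lborel)
     \<le> (\<integral>\<^sup>+u. ennreal (indicator {0..c} u * u powr (-q)) + ennreal (indicator {0..c} (-u) * (-u) powr (-q)) \<partial>lborel)"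
    by (intro nn_integral_mono) (auto simp: indicator_def abs_if)
  also have "\<dots> = (\<integral>\<^sup>+u. ennreal (indicator {0..c} u * u powr (-q)) \<partial>lborel)
      + (\<integral>\<^sup>+u. ennreal (indicator {0..c} (-u) * (-u) powr (-q)) \<partial>lborel)"
    by (intro nn_integral_add) auto
  also have "(\<integral>\<^sup>+u. ennreal (indicator {0..c} (-u) * (-u) powr (-q)) \<partial>lborel) = (\<integral>\<^sup>+u. ennreal (indicator {0..c} u * u powr (-q)) \<partial>lborel)"
    by (subst nn_integral_real_affine[where c = "-1" and t = 0]) auto
  also have "(\<integral>\<^sup>+u. ennreal (indicator {0..c} u * u powr (-q)) \<partial>lborel) + (\<integral>\<^sup>+u. ennreal (indicator {0..c} u * u powr (-q)) \<partial>lborel) < \<infinity>"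
    unfolding I by simp
  finally show ?thesis .
qed

lemma abs_sin_minus_int_pi: "\<bar>sin (x - of_int k * pi)\<bar> = \<bar>sin x\<bar>"
proof -
  have "(cos (of_int k * pi))\<^sup>2 = 1"
    using sin_cos_squared_add[of "of_int k * pi"] by (simp add: mult.commute)
  then have "\<bar>cos (of_int k * pi)\<bar> = 1" unfolding power2_eq_1_iff by auto
  then show ?thesis by (simp add: sin_diff abs_mult mult.commute)
qed

text \<open>Near each of its zeros the sine is at least half the distance to that zero. An interval
  of length 2 pi involves at most four zeros as nearest ones, and each contributes a translate of
  the same integrable function \<open>g\<close>. Translation invariance makes the bound independent
  of \<open>d\<close>; the 8 is four zeros times 2, which bounds 2 powr q.\<close>

lemma nn_integral_sin_powr_bound:
  fixes q :: real
  assumes "0 \<le> q" "q < 1"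
  obtains M :: real where "0 \<le> M"
    "\<And>d. (\<integral>\<^sup>+t. ennreal (indicator {0..2*pi} t * \<bar>sin (t + d)\<bar> powr (-q)) \<partial>lborel) \<le> ennreal M"
proof -
  define g where "g u = indicator {-(pi/2)..pi/2} u * \<bar>u\<bar> powr (-q)" for u :: real
  have [measurable]: "g \<in> borel_measurable borel" unfolding g_def by measurable
  have g0: "g u \<ge> 0" for u by (simp add: g_def)
  have fin: "(\<integral>\<^sup>+u. ennreal (g u) \<partial>lborel) < \<infinity>"
    unfolding g_def using assms by (intro nn_integral_powr_finite) auto
  have shift: "(\<integral>\<^sup>+t. ennreal (g (t + e)) \<partial>lborel) = (\<integral>\<^sup>+u. ennreal (g u) \<partial>lborel)" for e
    by (subst (2) nn_integral_real_affine[where c = 1 and t = e]) (auto simp: add.commute)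
  define N where "N = (\<integral>\<^sup>+u. ennreal (g u) \<partial>lborel)"
  have "(\<integral>\<^sup>+t. ennreal (indicator {0..2*pi} t * \<bar>sin (t + d)\<bar> powr (-q)) \<partial>lborel) \<le> ennreal 8 * N" for d
  proof -
    \<comment> \<open>The zero nearest to \<open>t + d\<close> has index between
      \<open>round (d / pi)\<close> and \<open>round (d / pi + 2)\<close>, which lie in
      \<open>{k0..k0+3}\<close>.\<close>
    define k0 where "k0 = \<lfloor>d / pi\<rfloor>"
    have pt: "indicator {0..2*pi} t * \<bar>sin (t + d)\<bar> powr (-q) \<le> (\<Sum>k\<in>{k0..k0+3}. 2 * g (t + (d - of_int k * pi)))" for t
    proof (cases "t \<in> {0..2*pi}")
      case True
      define k where "k = round ((t + d) / pi)"
      define u where "u = t + d - of_int k * pi"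
      have "\<bar>of_int k - (t + d) / pi\<bar> \<le> 1 / 2" unfolding k_def by (rule of_int_round_abs_le)
      then have "\<bar>of_int k - (t + d) / pi\<bar> * pi \<le> 1 / 2 * pi" by (intro mult_right_mono) auto
      moreover have "\<bar>of_int k - (t + d) / pi\<bar> * pi = \<bar>u\<bar>"
      proof -
        have "(of_int k - (t + d) / pi) * pi = - u" by (simp add: u_def left_diff_distrib)
        then have "\<bar>(of_int k - (t + d) / pi) * pi\<bar> = \<bar>u\<bar>" by simp
        then show ?thesis by (simp add: abs_mult)
      qed
      ultimately have u: "\<bar>u\<bar> \<le> pi / 2" by simp
      have "d / pi \<le> (t + d) / pi" using True by (simp add: field_simps)
      then have "round (d / pi) \<le> k" unfolding k_def by (rule round_mono)
      moreover have "k0 \<le> round (d / pi)" unfolding k0_def round_def by (intro floor_mono) simp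
      ultimately have k1: "k0 \<le> k" by simp
      have "(t + d) / pi \<le> d / pi + 2" using True by (simp add: field_simps)
      then have "k \<le> round (d / pi + 2)" unfolding k_def by (rule round_mono)
      also have "\<dots> \<le> k0 + 3" unfolding k0_def round_def by linarith
      finally have k2: "k \<le> k0 + 3" .
      have "\<bar>sin (t + d)\<bar> powr (-q) \<le> 2 * g u"
      proof (cases "u = 0")
        \<comment> \<open>At the zero itself the left side is \<open>0 powr (-q)\<close>, which is 0
          by convention.\<close>
        case True
        then have "\<bar>sin (t + d)\<bar> = 0" using abs_sin_minus_int_pi[of "t + d" k] by (simp add: u_def)
        then show ?thesis using g0[of u] by simp
      next
        case False
        have "\<bar>sin (t + d)\<bar> powr (-q) = \<bar>sin u\<bar> powr (-q)" unfolding u_def abs_sin_minus_int_pi ..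
        also have "\<dots> \<le> (\<bar>u\<bar> / 2) powr (-q)"
          by (rule powr_mono2') (use abs_sin_ge_half[OF u] False assms in auto)
        also have "\<dots> = \<bar>u\<bar> powr (-q) * 2 powr q"
          by (simp add: powr_divide powr_minus divide_simps)
        also have "\<dots> \<le> \<bar>u\<bar> powr (-q) * 2 powr 1"
          using assms by (intro mult_left_mono powr_mono) auto
        also have "\<dots> = 2 * g u" using u by (auto simp: g_def indicator_def abs_le_iff)
        finally show ?thesis .
      qed
      also have "\<dots> = 2 * g (t + (d - of_int k * pi))" by (simp only: u_def add_diff_eq)
      also have "\<dots> \<le> (\<Sum>k\<in>{k0..k0+3}. 2 * g (t + (d - of_int k * pi)))"
        by (rule member_le_sum) (use k1 k2 g0 in auto)
      finally show ?thesis using True by simp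
    qed (auto intro!: sum_nonneg g0)
    have "(\<integral>\<^sup>+t. ennreal (indicator {0..2*pi} t * \<bar>sin (t + d)\<bar> powr (-q)) \<partial>lborel)
       \<le> (\<integral>\<^sup>+t. (\<Sum>k\<in>{k0..k0+3}. ennreal 2 * ennreal (g (t + (d - of_int k * pi)))) \<partial>lborel)"
      by (intro nn_integral_mono order_trans[OF ennreal_leI[OF pt]])
        (simp add: sum_ennreal[symmetric] g0 ennreal_mult del: ennreal_numeral)
    also have "\<dots> = (\<Sum>k\<in>{k0..k0+3}. ennreal 2 * N)"
      by (simp add: nn_integral_sum nn_integral_cmult shift N_def del: ennreal_numeral)
    also have "\<dots> = ennreal 8 * N"
      by (simp add: mult.assoc[symmetric])
    finally show ?thesis .
  qed
  moreover have "ennreal 8 * N < \<infinity>" using fin unfolding N_def by (simp add: ennreal_mult_less_top)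
  ultimately show thesis
    using that[of "enn2real (ennreal 8 * N)"] by simp
qed

section \<open>Negative powers of the squared sine of the distance, integrated over the
  sphere\<close>

lemma AE_sin_nonzero: "AE t in lborel. sin (t + d :: real) \<noteq> 0"
proof -
  have "{t. sin (t + d) = 0} \<subseteq> range (\<lambda>k::int. of_int k * pi - d)"
  proof
    fix t assume "t \<in> {t. sin (t + d) = 0}"
    then obtain k :: int where "t + d = of_int k * pi" unfolding mem_Collect_eq sin_zero_iff_int2 by blast
    then have "t = of_int k * pi - d" by simp
    then show "t \<in> range (\<lambda>k::int. of_int k * pi - d)" by blast
  qed
  then have "countable {t. sin (t + d) = 0}"
    by (rule countable_subset) simp
  then show ?thesis
    by (intro AE_I'[OF countable_imp_null_set_lborel[of "{t. sin (t + d) = 0}"]]) auto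
qed

lemma sphere_param:
  assumes "c \<in> S2" obtains \<alpha> \<beta> where "c = spherical_coords (\<alpha>, \<beta>)"
proof -
  have "(c, 1) \<in> S2 \<times> S1" using assms by simp
  then obtain \<theta> \<phi> \<psi> where "(c, 1) = chart ((\<theta>, \<phi>), \<psi>)" by (rule chart_surj)
  then show thesis using that[of \<theta> \<phi>] by simp
qed

text \<open>Here \<open>s\<close>, \<open>c\<close> belong to the difference of the longitudes,
  \<open>a\<close>, \<open>b\<close> and \<open>t\<close>, \<open>u\<close> to the two polar angles.
  The right side is the squared length of the projection of one point onto the tangent plane at the
  other, computed in the polar frame there.\<close>

lemma polar_distance_identity:
  fixes s c a b t u :: real
  assumes "s\<^sup>2 + c\<^sup>2 = 1" "a\<^sup>2 + b\<^sup>2 = 1" "t\<^sup>2 + u\<^sup>2 = 1"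
  shows "1 - (t * a * c + u * b)\<^sup>2 = (t * s)\<^sup>2 + (u * a - t * (c * b))\<^sup>2"
proof -
  have "(t * s)\<^sup>2 + (u * a - t * (c * b))\<^sup>2 + (t * a * c + u * b)\<^sup>2
     = t\<^sup>2 * s\<^sup>2 + (u\<^sup>2 + t\<^sup>2 * c\<^sup>2) * (a\<^sup>2 + b\<^sup>2)"
    by (simp add: power2_eq_square algebra_simps)
  also have "\<dots> = t\<^sup>2 * (s\<^sup>2 + c\<^sup>2) + u\<^sup>2" unfolding assms(2) by (simp add: algebra_simps)
  also have "\<dots> = 1" using assms by simp
  finally show ?thesis by simp
qed

text \<open>By the preceding identity and AM-GM, \<open>1 - (x \<bullet> c)\<^sup>2\<close> is at least
  \<open>sin \<theta> * \<bar>sin (\<phi> - \<beta>)\<bar> * \<bar>cos (\<phi> - \<beta>)\<bar> * \<bar>cos (\<theta> + e)\<bar>\<close> for some \<open>e\<close>, which separates the variables and makes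
  a rotation of \<open>c\<close> to the pole unnecessary.\<close>
lemma polar_kernel_bound:
  fixes \<theta> \<phi> \<alpha> \<beta> q :: real
  assumes q: "0 \<le> q" "q < 1" and S: "sin (\<phi> - \<beta>) \<noteq> 0" and C: "cos (\<phi> - \<beta>) \<noteq> 0"
  obtains d where "\<And>\<theta>. \<theta> \<in> {0..pi} \<Longrightarrow> sin \<theta> \<noteq> 0 \<Longrightarrow> sin (\<theta> + d) \<noteq> 0 \<Longrightarrow>
     sin \<theta> * (1 - (spherical_coords (\<theta>, \<phi>) \<bullet> spherical_coords (\<alpha>, \<beta>))\<^sup>2) powr (-q)
     \<le> 2 * (\<bar>sin (\<phi> - \<beta>)\<bar> powr (-q) + \<bar>cos (\<phi> - \<beta>)\<bar> powr (-q)) * \<bar>sin (\<theta> + d)\<bar> powr (-q)"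
proof -
  define s c where "s = sin (\<phi> - \<beta>)" and "c = cos (\<phi> - \<beta>)"
  have sc: "s\<^sup>2 + c\<^sup>2 = 1" by (simp add: s_def c_def)
  have nz: "s \<noteq> 0" "c \<noteq> 0" using S C by (simp_all add: s_def c_def)
  \<comment> \<open>Amplitude and phase: with this choice \<open>cos \<theta> * sin \<alpha> - sin
    \<theta> * (c * cos \<alpha>)\<close> is \<open>R * cos (\<theta> + e)\<close>, where
    \<open>R\<close> is bounded below by \<open>\<bar>c\<bar>\<close> and neither \<open>R\<close>
    nor \<open>e\<close> depends on \<theta>.\<close>
  define z where "z = Complex (sin \<alpha>) (c * cos \<alpha>)"
  define R where "R = cmod z"
  define e where "e = Arg z"
  have "z = rcis R e" by (simp add: R_def e_def rcis_cmod_Arg)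
  then have Re: "sin \<alpha> = R * cos e" "c * cos \<alpha> = R * sin e"
    unfolding z_def by (simp_all add: complex_eq_iff)
  have "R\<^sup>2 = (sin \<alpha>)\<^sup>2 + (c * cos \<alpha>)\<^sup>2" by (simp add: R_def z_def cmod_def)
  also have "\<dots> = c\<^sup>2 + (sin \<alpha> * s)\<^sup>2" proof -
    have "(sin \<alpha>)\<^sup>2 + (c * cos \<alpha>)\<^sup>2 = (sin \<alpha>)\<^sup>2 * (s\<^sup>2 + c\<^sup>2) + c\<^sup>2 * (cos \<alpha>)\<^sup>2"
      unfolding sc by (simp add: power_mult_distrib)
    also have "\<dots> = c\<^sup>2 * ((sin \<alpha>)\<^sup>2 + (cos \<alpha>)\<^sup>2) + (sin \<alpha> * s)\<^sup>2"
      by (simp only: power_mult_distrib algebra_simps)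
    finally show ?thesis by simp
  qed
  finally have "c\<^sup>2 \<le> R\<^sup>2" by simp
  then have R: "\<bar>c\<bar> \<le> R" using abs_le_square_iff[of c R] by (simp add: R_def)
  \<comment> \<open>One of \<open>\<bar>s\<bar>\<close>, \<open>\<bar>c\<bar>\<close> is at least
    1/2, and its negative power is then at most 2. The sum has only singularities of the type
    bounded by \<open>nn_integral_sin_powr_bound\<close>.\<close>
  have prod: "\<bar>s\<bar> powr (-q) * \<bar>c\<bar> powr (-q) \<le> 2 * (\<bar>s\<bar> powr (-q) + \<bar>c\<bar> powr (-q))"
  proof -
    have half: "\<bar>x\<bar> powr (-q) \<le> 2" if "\<bar>x\<bar> \<ge> 1 / 2" for x
    proof -
      have "\<bar>x\<bar> powr (-q) \<le> (1 / 2) powr (-q)" using that q by (intro powr_mono2') auto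
      also have "\<dots> = 2 powr q" by (simp add: powr_divide powr_minus)
      also have "\<dots> \<le> 2 powr 1" using q by (intro powr_mono) auto
      finally show ?thesis by simp
    qed
    have "\<bar>s\<bar> \<ge> 1 / 2 \<or> \<bar>c\<bar> \<ge> 1 / 2"
    proof (rule ccontr)
      assume "\<not> ?thesis"
      then have "s\<^sup>2 < (1/2)\<^sup>2" "c\<^sup>2 < (1/2)\<^sup>2"
        using power_strict_mono[of "\<bar>s\<bar>" "1/2" 2] power_strict_mono[of "\<bar>c\<bar>" "1/2" 2] by simp_all
      then show False using sc by (simp add: power2_eq_square)
    qed
    then show ?thesis
    proof
      assume "\<bar>s\<bar> \<ge> 1 / 2"
      then have "\<bar>s\<bar> powr (-q) * \<bar>c\<bar> powr (-q) \<le> 2 * \<bar>c\<bar> powr (-q)" by (intro mult_right_mono half) auto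
      then show ?thesis by (rule order_trans) simp
    next
      assume "\<bar>c\<bar> \<ge> 1 / 2"
      then have "\<bar>s\<bar> powr (-q) * \<bar>c\<bar> powr (-q) \<le> \<bar>s\<bar> powr (-q) * 2" by (intro mult_left_mono half) auto
      then show ?thesis by (rule order_trans) simp
    qed
  qed
  show thesis
  proof (rule that)
    fix \<theta> assume \<theta>: "\<theta> \<in> {0..pi}" "sin \<theta> \<noteq> 0" and nzc: "sin (\<theta> + (e + pi / 2)) \<noteq> 0"
    have eqc: "sin (\<theta> + (e + pi / 2)) = cos (\<theta> + e)"
      using sin_add[of "\<theta> + e" "pi / 2"] by (simp add: add.assoc)
    have pos: "sin \<theta> > 0" using \<theta> sin_ge_zero[of \<theta>] by auto
    have "spherical_coords (\<theta>, \<phi>) \<bullet> spherical_coords (\<alpha>, \<beta>) = sin \<theta> * sin \<alpha> * c + cos \<theta> * cos \<alpha>"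
      by (simp add: inner_vec3 c_def cos_diff algebra_simps)
    then have "1 - (spherical_coords (\<theta>, \<phi>) \<bullet> spherical_coords (\<alpha>, \<beta>))\<^sup>2
       = (sin \<theta> * s)\<^sup>2 + (cos \<theta> * sin \<alpha> - sin \<theta> * (c * cos \<alpha>))\<^sup>2"
      using polar_distance_identity[of s c "sin \<alpha>" "cos \<alpha>" "sin \<theta>" "cos \<theta>"] sc by simp
    also have "cos \<theta> * sin \<alpha> - sin \<theta> * (c * cos \<alpha>) = R * cos (\<theta> + e)"
      unfolding Re by (simp add: cos_add algebra_simps)
    finally have eq: "1 - (spherical_coords (\<theta>, \<phi>) \<bullet> spherical_coords (\<alpha>, \<beta>))\<^sup>2 = (sin \<theta> * s)\<^sup>2 + (R * cos (\<theta> + e))\<^sup>2" .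
    have "sin \<theta> * (\<bar>s\<bar> * \<bar>c\<bar>) * \<bar>cos (\<theta> + e)\<bar> \<le> \<bar>sin \<theta> * s\<bar> * \<bar>R * cos (\<theta> + e)\<bar>"
    proof -
      have "\<bar>sin \<theta> * s\<bar> * (\<bar>c\<bar> * \<bar>cos (\<theta> + e)\<bar>) \<le> \<bar>sin \<theta> * s\<bar> * (R * \<bar>cos (\<theta> + e)\<bar>)"
        using R by (intro mult_left_mono mult_right_mono) auto
      then show ?thesis using pos R by (simp add: abs_mult mult_ac)
    qed
    also have "\<dots> \<le> (sin \<theta> * s)\<^sup>2 + (R * cos (\<theta> + e))\<^sup>2"
    proof -
      have "x * y \<le> x\<^sup>2 + y\<^sup>2" if "0 \<le> x" "0 \<le> y" for x y :: real
        using sum_squares_bound[of x y] mult_nonneg_nonneg[OF that] by linarith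
      from this[of "\<bar>sin \<theta> * s\<bar>" "\<bar>R * cos (\<theta> + e)\<bar>"] show ?thesis by simp
    qed
    finally have le: "sin \<theta> * (\<bar>s\<bar> * \<bar>c\<bar>) * \<bar>cos (\<theta> + e)\<bar> \<le> (sin \<theta> * s)\<^sup>2 + (R * cos (\<theta> + e))\<^sup>2" .
    have "0 < sin \<theta> * (\<bar>s\<bar> * \<bar>c\<bar>) * \<bar>cos (\<theta> + e)\<bar>"
      using pos nz nzc unfolding eqc by (intro mult_pos_pos) simp_all
    from powr_mono2'[OF _ this le, of "-q"] q
    have "((sin \<theta> * s)\<^sup>2 + (R * cos (\<theta> + e))\<^sup>2) powr (-q) \<le> (sin \<theta> * (\<bar>s\<bar> * \<bar>c\<bar>) * \<bar>cos (\<theta> + e)\<bar>) powr (-q)"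
      by (simp only: neg_le_0_iff_le)
    also have "\<dots> = sin \<theta> powr (-q) * (\<bar>s\<bar> powr (-q) * \<bar>c\<bar> powr (-q)) * \<bar>cos (\<theta> + e)\<bar> powr (-q)"
      using pos by (simp only: powr_mult)
    finally have "sin \<theta> * ((sin \<theta> * s)\<^sup>2 + (R * cos (\<theta> + e))\<^sup>2) powr (-q)
      \<le> sin \<theta> * (sin \<theta> powr (-q) * (\<bar>s\<bar> powr (-q) * \<bar>c\<bar> powr (-q)) * \<bar>cos (\<theta> + e)\<bar> powr (-q))"
      using pos by (intro mult_left_mono) simp_all
    also have "\<dots> = sin \<theta> powr (1 - q) * (\<bar>s\<bar> powr (-q) * \<bar>c\<bar> powr (-q)) * \<bar>cos (\<theta> + e)\<bar> powr (-q)"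
    proof -
      have "sin \<theta> powr (1 - q) = sin \<theta> * sin \<theta> powr (-q)"
        using pos powr_add[of "sin \<theta>" 1 "-q"] by simp
      then show ?thesis by (simp only: mult.assoc)
    qed
    \<comment> \<open>The area density absorbs the singularity at the poles: sin \<theta> powr (1 -
      q) is at most 1.\<close>
    also have "\<dots> \<le> 1 * (2 * (\<bar>s\<bar> powr (-q) + \<bar>c\<bar> powr (-q))) * \<bar>cos (\<theta> + e)\<bar> powr (-q)"
      using pos q powr_le1[of "1 - q" "sin \<theta>"] by (intro mult_right_mono mult_mono prod) simp_all
    finally show "sin \<theta> * (1 - (spherical_coords (\<theta>, \<phi>) \<bullet> spherical_coords (\<alpha>, \<beta>))\<^sup>2) powr (-q)
     \<le> 2 * (\<bar>sin (\<phi> - \<beta>)\<bar> powr (-q) + \<bar>cos (\<phi> - \<beta>)\<bar> powr (-q)) * \<bar>sin (\<theta> + (e + pi / 2))\<bar> powr (-q)"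
      unfolding eq eqc by (simp add: s_def c_def)
  qed
qed

lemma nn_integral_S2_measure:
  assumes [measurable]: "f \<in> borel_measurable borel"
  shows "(\<integral>\<^sup>+x. f x \<partial>S2_measure) = (\<integral>\<^sup>+\<phi>. \<integral>\<^sup>+\<theta>. ennreal (S2_density (\<theta>, \<phi>)) * f (spherical_coords (\<theta>, \<phi>)) \<partial>lborel \<partial>lborel)"
proof -
  have f: "f \<in> borel_measurable (restrict_space borel S2)" by (rule measurable_restrict_space1) simp
  have [measurable]: "(\<lambda>p. f (spherical_coords p)) \<in> borel_measurable borel"
    by (rule measurable_compose[OF spherical_coords_measurable f])
  have "(\<integral>\<^sup>+x. f x \<partial>S2_measure) = (\<integral>\<^sup>+p. ennreal (S2_density p) * f (spherical_coords p) \<partial>lborel)"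
    unfolding S2_measure_eq using f by (subst nn_integral_distr) (simp_all add: nn_integral_density)
  also have "\<dots> = (\<integral>\<^sup>+p. ennreal (S2_density p) * f (spherical_coords p) \<partial>(lborel \<Otimes>\<^sub>M lborel))"
    by (simp add: lborel_prod)
  also have "\<dots> = (\<integral>\<^sup>+\<phi>. \<integral>\<^sup>+\<theta>. ennreal (S2_density (\<theta>, \<phi>)) * f (spherical_coords (\<theta>, \<phi>)) \<partial>lborel \<partial>lborel)"
    by (rule lborel_pair.nn_integral_snd[symmetric]) (simp add: lborel_prod)
  finally show ?thesis .
qed

text \<open>The separated bound is integrated first in \<theta>, then in \<phi>. The centre enters
  only through the shifts inside the sines, to which \<open>M\<close> is insensitive; the
  \<theta>-integral gives one \<open>M\<close>, the two summands in \<phi> give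
  \<open>2 * (M + M)\<close>.\<close>

lemma S2_kernel_integral_bound:
  fixes q :: real
  assumes q: "0 \<le> q" "q < 1"
  obtains M :: real where "0 \<le> M"
    "\<And>c. c \<in> S2 \<Longrightarrow> (\<integral>\<^sup>+x. ennreal ((1 - (x \<bullet> c)\<^sup>2) powr (-q)) \<partial>S2_measure) \<le> ennreal M"
proof -
  obtain M where M: "0 \<le> M"
    "\<And>d. (\<integral>\<^sup>+t. ennreal (indicator {0..2*pi} t * \<bar>sin (t + d)\<bar> powr (-q)) \<partial>lborel) \<le> ennreal M"
    using nn_integral_sin_powr_bound[OF q] by metis
  have "(\<integral>\<^sup>+x. ennreal ((1 - (x \<bullet> c)\<^sup>2) powr (-q)) \<partial>S2_measure) \<le> ennreal (M * (2 * (M + M)))" if c: "c \<in> S2" for c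
  proof -
    obtain \<alpha> \<beta> where cp: "c = spherical_coords (\<alpha>, \<beta>)" using sphere_param[OF c] .
    let ?k = "\<lambda>\<theta> \<phi>. ennreal (S2_density (\<theta>, \<phi>)) * ennreal ((1 - (spherical_coords (\<theta>, \<phi>) \<bullet> c)\<^sup>2) powr (-q))"
    define w where "w \<phi> = 2 * (\<bar>sin (\<phi> - \<beta>)\<bar> powr (-q) + \<bar>cos (\<phi> - \<beta>)\<bar> powr (-q))" for \<phi>
    have cs: "cos (\<phi> - \<beta>) = sin (\<phi> + (pi / 2 - \<beta>))" for \<phi>
      using sin_add[of "\<phi> - \<beta>" "pi / 2"] by (simp add: algebra_simps)
    have w0: "w \<phi> \<ge> 0" for \<phi> by (simp add: w_def)
    have inner: "(\<integral>\<^sup>+\<theta>. ?k \<theta> \<phi> \<partial>lborel) \<le> ennreal (indicator {0..2*pi} \<phi> * w \<phi>) * ennreal M"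
      if nz: "sin (\<phi> + - \<beta>) \<noteq> 0" "sin (\<phi> + (pi / 2 - \<beta>)) \<noteq> 0" for \<phi>
    proof -
      have "cos (\<phi> - \<beta>) \<noteq> 0" "sin (\<phi> - \<beta>) \<noteq> 0"
        using nz cs[of \<phi>] by simp_all
      then obtain d where d: "\<And>\<theta>. \<theta> \<in> {0..pi} \<Longrightarrow> sin \<theta> \<noteq> 0 \<Longrightarrow> sin (\<theta> + d) \<noteq> 0 \<Longrightarrow>
         sin \<theta> * (1 - (spherical_coords (\<theta>, \<phi>) \<bullet> spherical_coords (\<alpha>, \<beta>))\<^sup>2) powr (-q)
         \<le> w \<phi> * \<bar>sin (\<theta> + d)\<bar> powr (-q)"
        using polar_kernel_bound[OF q, of \<phi> \<beta> \<alpha>] unfolding w_def by metis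
      have "AE \<theta> in lborel. ?k \<theta> \<phi> \<le> ennreal (indicator {0..2*pi} \<phi> * w \<phi>) * ennreal (indicator {0..2*pi} \<theta> * \<bar>sin (\<theta> + d)\<bar> powr (-q))"
        using AE_sin_nonzero[of 0] AE_sin_nonzero[of d]
      proof eventually_elim
        case (elim \<theta>)
        show ?case
        proof (cases "\<theta> \<in> {0..pi} \<and> \<phi> \<in> {0..2*pi}")
          case True
          have "sin \<theta> * (1 - (spherical_coords (\<theta>, \<phi>) \<bullet> c)\<^sup>2) powr (-q) \<le> w \<phi> * \<bar>sin (\<theta> + d)\<bar> powr (-q)"
            unfolding cp by (rule d) (use True elim in simp_all)
          then have "ennreal (sin \<theta>) * ennreal ((1 - (spherical_coords (\<theta>, \<phi>) \<bullet> c)\<^sup>2) powr (-q))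
              \<le> ennreal (w \<phi>) * ennreal (\<bar>sin (\<theta> + d)\<bar> powr (-q))"
            using True w0[of \<phi>] by (subst (1 2) ennreal_mult[symmetric]) (simp_all add: sin_ge_zero ennreal_leI)
          moreover have "S2_density (\<theta>, \<phi>) = sin \<theta>" using True by (simp add: S2_density_def)
          ultimately show ?thesis using True by simp
        qed (auto simp: S2_density_def)
      qed
      then have "(\<integral>\<^sup>+\<theta>. ?k \<theta> \<phi> \<partial>lborel) \<le> (\<integral>\<^sup>+\<theta>. ennreal (indicator {0..2*pi} \<phi> * w \<phi>) * ennreal (indicator {0..2*pi} \<theta> * \<bar>sin (\<theta> + d)\<bar> powr (-q)) \<partial>lborel)"
        by (rule nn_integral_mono_AE)
      also have "\<dots> = ennreal (indicator {0..2*pi} \<phi> * w \<phi>) * (\<integral>\<^sup>+\<theta>. ennreal (indicator {0..2*pi} \<theta> * \<bar>sin (\<theta> + d)\<bar> powr (-q)) \<partial>lborel)"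
        by (rule nn_integral_cmult) simp
      also have "\<dots> \<le> ennreal (indicator {0..2*pi} \<phi> * w \<phi>) * ennreal M"
        by (intro mult_left_mono M) simp
      finally show ?thesis .
    qed
    have "(\<integral>\<^sup>+\<phi>. ennreal (indicator {0..2*pi} \<phi> * w \<phi>) \<partial>lborel)
       = (\<integral>\<^sup>+\<phi>. ennreal 2 * (ennreal (indicator {0..2*pi} \<phi> * \<bar>sin (\<phi> + - \<beta>)\<bar> powr (-q))
          + ennreal (indicator {0..2*pi} \<phi> * \<bar>sin (\<phi> + (pi / 2 - \<beta>))\<bar> powr (-q))) \<partial>lborel)"
    proof (rule nn_integral_cong)
      fix \<phi> :: real
      show "ennreal (indicator {0..2*pi} \<phi> * w \<phi>) = ennreal 2 * (ennreal (indicator {0..2*pi} \<phi> * \<bar>sin (\<phi> + - \<beta>)\<bar> powr (-q))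
          + ennreal (indicator {0..2*pi} \<phi> * \<bar>sin (\<phi> + (pi / 2 - \<beta>))\<bar> powr (-q)))"
        by (simp add: w_def cs ennreal_plus[symmetric] ennreal_mult[symmetric] algebra_simps del: ennreal_plus ennreal_numeral)
    qed
    also have "\<dots> = ennreal 2 * ((\<integral>\<^sup>+\<phi>. ennreal (indicator {0..2*pi} \<phi> * \<bar>sin (\<phi> + - \<beta>)\<bar> powr (-q)) \<partial>lborel)
          + (\<integral>\<^sup>+\<phi>. ennreal (indicator {0..2*pi} \<phi> * \<bar>sin (\<phi> + (pi / 2 - \<beta>))\<bar> powr (-q)) \<partial>lborel))"
      by (simp add: nn_integral_cmult nn_integral_add del: ennreal_numeral)
    also have "\<dots> \<le> ennreal 2 * (ennreal M + ennreal M)"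
      by (intro mult_left_mono add_mono M) simp
    also have "\<dots> = ennreal (2 * (M + M))"
      using M(1) by (subst ennreal_plus[symmetric], simp_all only: ennreal_mult')
    finally have A: "(\<integral>\<^sup>+\<phi>. ennreal (indicator {0..2*pi} \<phi> * w \<phi>) \<partial>lborel) \<le> ennreal (2 * (M + M))" .
    have "(\<integral>\<^sup>+x. ennreal ((1 - (x \<bullet> c)\<^sup>2) powr (-q)) \<partial>S2_measure) = (\<integral>\<^sup>+\<phi>. \<integral>\<^sup>+\<theta>. ?k \<theta> \<phi> \<partial>lborel \<partial>lborel)"
      by (rule nn_integral_S2_measure) simp
    also have "\<dots> \<le> (\<integral>\<^sup>+\<phi>. ennreal (indicator {0..2*pi} \<phi> * w \<phi>) * ennreal M \<partial>lborel)"
    proof (rule nn_integral_mono_AE)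
      show "AE \<phi> in lborel. (\<integral>\<^sup>+\<theta>. ?k \<theta> \<phi> \<partial>lborel) \<le> ennreal (indicator {0..2*pi} \<phi> * w \<phi>) * ennreal M"
        using AE_sin_nonzero[of "- \<beta>"] AE_sin_nonzero[of "pi / 2 - \<beta>"]
        by eventually_elim (rule inner)
    qed
    also have "\<dots> = (\<integral>\<^sup>+\<phi>. ennreal (indicator {0..2*pi} \<phi> * w \<phi>) \<partial>lborel) * ennreal M"
      by (rule nn_integral_multc) (simp add: w_def)
    also have "\<dots> \<le> ennreal (2 * (M + M)) * ennreal M"
      by (rule mult_right_mono[OF A]) simp
    also have "\<dots> = ennreal (M * (2 * (M + M)))"
      using M(1) by (subst ennreal_mult[symmetric]) (simp_all add: mult.commute)
    finally show ?thesis .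
  qed
  then show thesis using that[of "M * (2 * (M + M))"] M(1) by simp
qed

text \<open>Equality in Cauchy-Schwarz forces x to be c or -c. This fixes \<theta> to one of two
  values, and such parameters form null lines.\<close>

lemma AE_S2_inner_square_less_1:
  assumes c: "c \<in> S2"
  shows "AE x in S2_measure. (x \<bullet> c)\<^sup>2 < 1"
proof -
  have eqv: "x = (x \<bullet> c) *\<^sub>R c" if "x \<bullet> x = 1" "c \<bullet> c = 1" "(x \<bullet> c)\<^sup>2 = 1" for x :: "real^3"
  proof -
    have "(x - (x \<bullet> c) *\<^sub>R c) \<bullet> (x - (x \<bullet> c) *\<^sub>R c) = 0"
      using that by (simp add: inner_diff_left inner_diff_right inner_commute power2_eq_square)
    then show ?thesis unfolding inner_eq_zero_iff right_minus_eq .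
  qed
  have cc: "c \<bullet> c = 1" using c by (simp add: dot_square_norm)
  have "AE p in lborel. 0 < ennreal (S2_density p) \<longrightarrow> (spherical_coords p \<bullet> c)\<^sup>2 < 1"
    using AE_lborel_fst_snd_neq(1)[of "arccos (c $ 3)"] AE_lborel_fst_snd_neq(1)[of "arccos (- c $ 3)"]
  proof eventually_elim
    case (elim p)
    obtain \<theta> \<phi> where p: "p = (\<theta>, \<phi>)" by (cases p)
    show ?case
    proof
      assume pos: "0 < ennreal (S2_density p)"
      have "S2_density p = 0" if "\<theta> \<notin> {0..pi}"
      proof -
        have "p \<notin> {0..pi} \<times> {0..2*pi}" using that by (auto simp: p)
        then show ?thesis by (simp add: S2_density_def)
      qed
      then have "\<theta> \<in> {0..pi}" using pos by force
      then have \<theta>: "0 \<le> \<theta>" "\<theta> \<le> pi" by simp_all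
      have xx: "spherical_coords p \<bullet> spherical_coords p = 1" by (simp add: p)
      then have "norm (spherical_coords p) = 1" "norm c = 1" using c by (simp_all add: norm_eq_1)
      then have "\<bar>spherical_coords p \<bullet> c\<bar> \<le> 1" using Cauchy_Schwarz_ineq2[of "spherical_coords p" c] by simp
      then have "(spherical_coords p \<bullet> c)\<^sup>2 \<le> 1" by (simp add: abs_square_le_1)
      moreover have "(spherical_coords p \<bullet> c)\<^sup>2 \<noteq> 1"
      proof
        assume 1: "(spherical_coords p \<bullet> c)\<^sup>2 = 1"
        then have "spherical_coords p \<bullet> c = 1 \<or> spherical_coords p \<bullet> c = -1" by (simp add: power2_eq_1_iff)
        then have "spherical_coords p = c \<or> spherical_coords p = - c" using eqv[OF xx cc 1] by (metis scaleR_one scaleR_minus1_left)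
        then have "cos \<theta> = c $ 3 \<or> cos \<theta> = - c $ 3" unfolding p by (metis spherical_coords_nth(3) vector_uminus_component)
        then have "\<theta> = arccos (c $ 3) \<or> \<theta> = arccos (- c $ 3)" using arccos_cos[OF \<theta>] by metis
        then show False using elim by (auto simp: p)
      qed
      ultimately show "(spherical_coords p \<bullet> c)\<^sup>2 < 1" by simp
    qed
  qed
  then have "AE p in density lborel (\<lambda>p. ennreal (S2_density p)). (spherical_coords p \<bullet> c)\<^sup>2 < 1"
    by (subst AE_density) auto
  moreover have "{x \<in> space (restrict_space borel S2). (x \<bullet> c)\<^sup>2 < 1} \<in> sets (restrict_space borel S2)"
    by (rule measurable_sets_Collect[where N = borel, OF measurable_restrict_space1]) simp_all
  ultimately show ?thesis
    unfolding S2_measure_eq by (subst AE_distr_iff) auto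
qed

section \<open>Functions on the sphere as functions on the product\<close>

lemma borel_measurable_vol_fst:
  "f \<in> borel_measurable S2_measure \<Longrightarrow> (\<lambda>m. f (fst m)) \<in> borel_measurable vol"
  unfolding vol_def by (rule measurable_compose[OF measurable_fst])

lemma borel_measurable_S2_continuous:
  fixes f :: "real^3 \<Rightarrow> 'a::topological_space"
  assumes "continuous_on S2 f"
  shows "f \<in> borel_measurable S2_measure"
  using borel_measurable_continuous_on_restrict[OF assms] by (simp cong: measurable_cong_sets add: sets_measures)

lemma nn_integral_vol_fst:
  assumes f: "f \<in> borel_measurable S2_measure"
  shows "(\<integral>\<^sup>+m. f (fst m) \<partial>vol) = ennreal (2 * pi) * (\<integral>\<^sup>+x. f x \<partial>S2_measure)"
proof -
  interpret S1: sigma_finite_measure S1_measure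
    using finite_S1_measure by (rule finite_measure.axioms(1))
  have "(\<integral>\<^sup>+m. f (fst m) \<partial>vol) = (\<integral>\<^sup>+x. \<integral>\<^sup>+z. f x \<partial>S1_measure \<partial>S2_measure)"
    unfolding vol_def using borel_measurable_vol_fst[OF f, unfolded vol_def]
    by (subst S1.nn_integral_fst[symmetric]) simp_all
  also have "\<dots> = (\<integral>\<^sup>+x. ennreal (2 * pi) * f x \<partial>S2_measure)"
    by (simp add: emeasure_S1_measure mult.commute)
  also have "\<dots> = ennreal (2 * pi) * (\<integral>\<^sup>+x. f x \<partial>S2_measure)"
    by (rule nn_integral_cmult[OF f])
  finally show ?thesis .
qed

lemma AE_vol_fst:
  assumes "AE x in S2_measure. P x"
  shows "AE m in vol. P (fst m)"
proof -
  obtain N where N: "{x \<in> space S2_measure. \<not> P x} \<subseteq> N" "emeasure S2_measure N = 0" "N \<in> sets S2_measure"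
    using AE_E[OF assms] by metis
  interpret S1: sigma_finite_measure S1_measure
    using finite_S1_measure by (rule finite_measure.axioms(1))
  have "N \<times> S1 \<in> null_sets vol"
    unfolding vol_def using N(2,3) sets.top[of S1_measure]
    by (auto simp: null_sets_def S1.emeasure_pair_measure_Times)
  then show ?thesis
    by (rule AE_I') (use N(1) in auto)
qed

lemma integrable_vol_fst:
  fixes f :: "real^3 \<Rightarrow> real"
  assumes "integrable S2_measure f"
  shows "integrable vol (\<lambda>m. f (fst m))"
proof -
  have m: "f \<in> borel_measurable S2_measure" using assms by (rule borel_measurable_integrable)
  have "(\<integral>\<^sup>+x. ennreal (norm (f x)) \<partial>S2_measure) < \<infinity>" using assms by (simp add: integrable_iff_bounded)
  then have "(\<integral>\<^sup>+m. ennreal (norm (f (fst m))) \<partial>vol) < \<infinity>"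
    using m by (subst nn_integral_vol_fst[of "\<lambda>x. ennreal (norm (f x))"]) (auto simp: ennreal_mult_less_top)
  then show ?thesis
    using borel_measurable_vol_fst[OF m] by (simp add: integrable_iff_bounded)
qed

lemma measurable_warp_tensor:
  assumes "w \<in> borel_measurable S2_measure"
  shows "measurable_tensor2 (warp_tensor \<kappa> w)"
  unfolding measurable_tensor2_def warp_tensor_def g_S2_def g_S1_def
  by (intro allI borel_measurable_add borel_measurable_times borel_measurable_inner borel_measurable_const
      borel_measurable_vol_fst[OF assms] borel_measurable_vol_continuous continuous_intros continuous_on_tproj)

lemma measurable_warp_deriv:
  assumes "D \<in> borel_measurable S2_measure"
  shows "measurable_tensor3 (warp_deriv D)"
  unfolding measurable_tensor3_def warp_deriv_def
  by (intro allI borel_measurable_times borel_measurable_inner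
      borel_measurable_vol_fst[OF assms] borel_measurable_vol_continuous continuous_intros continuous_on_tproj)

lemma borel_measurable_norm2_warp_tensor:
  assumes "w \<in> borel_measurable S2_measure"
  shows "norm2 (warp_tensor \<kappa> w) \<in> borel_measurable vol"
proof -
  note [measurable] = borel_measurable_vol_fst[OF assms]
  have "(\<lambda>m. sqrt (2 * \<kappa>\<^sup>2 + (w (fst m))\<^sup>2)) \<in> borel_measurable vol" by measurable
  then show ?thesis
    by (subst measurable_cong[where g = "\<lambda>m. sqrt (2 * \<kappa>\<^sup>2 + (w (fst m))\<^sup>2)"]) (auto intro: norm2_warp_tensor)
qed

lemma borel_measurable_norm3_warp_deriv:
  assumes "D \<in> borel_measurable S2_measure"
  shows "norm3 (warp_deriv D) \<in> borel_measurable vol"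
proof -
  note [measurable] = borel_measurable_vol_fst[OF assms]
  have [measurable]: "fst \<in> borel_measurable vol" by (intro borel_measurable_vol_continuous continuous_intros)
  have "(\<lambda>m. norm (D (fst m) - (D (fst m) \<bullet> fst m) *\<^sub>R fst m)) \<in> borel_measurable vol" by measurable
  then show ?thesis
    by (subst measurable_cong[where g = "\<lambda>m. norm (D (fst m) - (D (fst m) \<bullet> fst m) *\<^sub>R fst m)"])
      (auto intro: norm3_warp_deriv)
qed

lemma norm2_warp_tensor_le:
  assumes "m \<in> S2 \<times> S1"
  shows "norm2 (warp_tensor \<kappa> w) m \<le> 2 * \<bar>\<kappa>\<bar> + \<bar>w (fst m)\<bar>"
  unfolding norm2_warp_tensor[OF assms]
  by (rule real_le_lsqrt) (auto simp: power2_sum power_mult_distrib)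

lemma norm_nonneg_tensor:
  assumes "m \<in> S2 \<times> S1"
  shows "0 \<le> norm2 (warp_tensor \<kappa> w) m" "0 \<le> norm3 (warp_deriv D) m"
  by (simp_all add: norm2_warp_tensor[OF assms] norm3_warp_deriv[OF assms])

lemma sphere_C1_measurable:
  assumes "sphere_C1 w D"
  shows "w \<in> borel_measurable S2_measure" "D \<in> borel_measurable S2_measure"
  using assms sphere_C1_continuous[OF assms] by (auto simp: sphere_C1_def intro!: borel_measurable_S2_continuous)

text \<open>It is applied to three kinds of sequence: a constant one for each approximating metric,
  \<open>w n\<close> itself for the limit metric, and \<open>w n - w k\<close> with k tending to
  infinity for the error.\<close>

lemma weak_cov_deriv_limit:
  fixes w :: "nat \<Rightarrow> real^3 \<Rightarrow> real" and D :: "nat \<Rightarrow> real^3 \<Rightarrow> real^3"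
  assumes C1: "\<And>n. sphere_C1 (w n) (D n)"
    and w': "w' \<in> borel_measurable S2_measure" and D': "D' \<in> borel_measurable S2_measure"
    and Y: "integrable S2_measure Y"
    and lim: "AE x in S2_measure. (\<lambda>n. w n x) \<longlonglongrightarrow> w' x \<and> (\<lambda>n. D n x) \<longlonglongrightarrow> D' x
        \<and> (\<forall>n. \<bar>w n x\<bar> \<le> Y x \<and> norm (D n x) \<le> Y x)"
  shows "weak_cov_deriv (warp_tensor \<kappa> w') (warp_deriv D')"
proof -
  note AEv = AE_vol_fst[OF lim]
  have sp: "AE m in vol. m \<in> S2 \<times> S1" by (rule AE_I2) simp
  have Yv: "integrable vol (\<lambda>m. Y (fst m))" by (rule integrable_vol_fst[OF Y])
  have cint: "integrable vol (\<lambda>m. c :: real)" for c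
    by (rule finite_measure.integrable_const[OF finite_vol])
  have bd: "AE m in vol. m \<in> S2 \<times> S1 \<and> \<bar>w' (fst m)\<bar> \<le> Y (fst m) \<and> norm (D' (fst m)) \<le> Y (fst m)"
    using AEv sp
  proof eventually_elim
    case (elim m)
    have "\<bar>w' (fst m)\<bar> \<le> Y (fst m)"
      by (rule LIMSEQ_le_const2[OF tendsto_rabs[of "\<lambda>n. w n (fst m)"]]) (use elim in auto)
    moreover have "norm (D' (fst m)) \<le> Y (fst m)"
      by (rule LIMSEQ_le_const2[OF tendsto_norm[of "\<lambda>n. D n (fst m)"]]) (use elim in auto)
    ultimately show ?case using elim by simp
  qed
  have int2: "integrable vol (norm2 (warp_tensor \<kappa> w'))"
  proof (rule Bochner_Integration.integrable_bound)
    show "integrable vol (\<lambda>m. 2 * \<bar>\<kappa>\<bar> + Y (fst m))" by (intro Bochner_Integration.integrable_add cint Yv)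
    show "AE m in vol. norm (norm2 (warp_tensor \<kappa> w') m) \<le> norm (2 * \<bar>\<kappa>\<bar> + Y (fst m))"
      using bd
    proof eventually_elim
      case (elim m)
      then show ?case using norm2_warp_tensor_le[of m \<kappa> w'] norm_nonneg_tensor(1)[of m \<kappa> w'] by simp
    qed
  qed (rule borel_measurable_norm2_warp_tensor[OF w'])
  have int3: "integrable vol (norm3 (warp_deriv D'))"
  proof (rule Bochner_Integration.integrable_bound[OF Yv])
    show "AE m in vol. norm (norm3 (warp_deriv D') m) \<le> norm (Y (fst m))"
      using bd
    proof eventually_elim
      case (elim m)
      then show ?case using norm3_warp_deriv_le[of m D'] norm_nonneg_tensor(2)[of m D'] by simp
    qed
  qed (rule borel_measurable_norm3_warp_deriv[OF D'])
  have ident: "(LINT m|vol. inner3 m (warp_deriv D' m) (\<Phi> m))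
      = (LINT m|vol. inner2 m (warp_tensor \<kappa> w' m) (cov_adjoint \<Phi> m))" if \<Phi>: "smooth_tensor3 \<Phi>" for \<Phi>
  proof -
    \<comment> \<open>In terms of these fields, continuous and so bounded on the compact manifold,
      the two pairings are affine in \<open>D\<close> and \<open>w\<close>; a multiple of
      \<open>Y\<close> plus a constant therefore dominates both.\<close>
    let ?V = "pair_field \<Phi>" and ?q0 = "adjoint_trace g_S2 \<Phi>" and ?q1 = "adjoint_trace g_S1 \<Phi>"
    obtain CV where CV: "CV \<ge> 0" "\<And>m. m \<in> S2 \<times> S1 \<Longrightarrow> norm (?V m) \<le> CV"
      using continuous_on_bounded[OF continuous_on_pair_field[OF \<Phi>]] by metis
    obtain C0 where C0: "C0 \<ge> 0" "\<And>m. m \<in> S2 \<times> S1 \<Longrightarrow> norm (?q0 m) \<le> C0"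
      using continuous_on_bounded[OF continuous_on_adjoint_trace(1)[OF \<Phi>]] by metis
    obtain C1' where C1': "C1' \<ge> 0" "\<And>m. m \<in> S2 \<times> S1 \<Longrightarrow> norm (?q1 m) \<le> C1'"
      using continuous_on_bounded[OF continuous_on_adjoint_trace(2)[OF \<Phi>]] by metis
    note [measurable] = borel_measurable_vol_continuous[OF continuous_on_pair_field[OF \<Phi>]]
      borel_measurable_vol_continuous[OF continuous_on_adjoint_trace(1)[OF \<Phi>]]
      borel_measurable_vol_continuous[OF continuous_on_adjoint_trace(2)[OF \<Phi>]]
      borel_measurable_vol_fst[OF w'] borel_measurable_vol_fst[OF D']
      borel_measurable_vol_fst[OF sphere_C1_measurable(1)[OF C1]]
      borel_measurable_vol_fst[OF sphere_C1_measurable(2)[OF C1]]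
    let ?a = "\<lambda>D m. D (fst m) \<bullet> ?V m" and ?b = "\<lambda>w m. \<kappa> * ?q0 m + w (fst m) * ?q1 m"
    let ?Ya = "\<lambda>m. CV * Y (fst m)" and ?Yb = "\<lambda>m. \<bar>\<kappa>\<bar> * C0 + C1' * Y (fst m)"
    have Yai: "integrable vol ?Ya" by (intro integrable_mult_right Yv)
    have Ybi: "integrable vol ?Yb" by (intro Bochner_Integration.integrable_add cint integrable_mult_right Yv)
    have a_le: "\<bar>v \<bullet> ?V m\<bar> \<le> CV * y" if "m \<in> S2 \<times> S1" "norm v \<le> y" for v m y
    proof -
      have "\<bar>v \<bullet> ?V m\<bar> \<le> norm v * norm (?V m)" by (rule Cauchy_Schwarz_ineq2)
      also have "\<dots> \<le> y * CV" using that CV by (intro mult_mono) (auto intro: order_trans[OF norm_ge_zero])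
      finally show ?thesis by (simp add: mult.commute)
    qed
    have b_le: "\<bar>\<kappa> * ?q0 m + t * ?q1 m\<bar> \<le> \<bar>\<kappa>\<bar> * C0 + C1' * y" if "m \<in> S2 \<times> S1" "\<bar>t\<bar> \<le> y" for t m y
    proof -
      have "\<bar>\<kappa> * ?q0 m\<bar> \<le> \<bar>\<kappa>\<bar> * C0" using C0(2)[OF that(1)] by (simp add: abs_mult mult_left_mono)
      moreover have "\<bar>t * ?q1 m\<bar> \<le> y * C1'"
        unfolding abs_mult using C1'(2)[OF that(1)] that(2) by (intro mult_mono) auto
      ultimately show ?thesis by (simp add: mult.commute)
    qed
    have lima: "(\<lambda>n. LINT m|vol. ?a (D n) m) \<longlonglongrightarrow> (LINT m|vol. ?a D' m)"
      and intan: "\<And>n. integrable vol (?a (D n))"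
    proof -
      have 1: "AE m in vol. (\<lambda>n. ?a (D n) m) \<longlonglongrightarrow> ?a D' m"
        using AEv by eventually_elim (auto intro!: tendsto_intros)
      have 2: "AE m in vol. norm (?a (D n) m) \<le> ?Ya m" for n
        using AEv sp by eventually_elim (use a_le in auto)
      show "(\<lambda>n. LINT m|vol. ?a (D n) m) \<longlonglongrightarrow> (LINT m|vol. ?a D' m)"
        by (rule integral_dominated_convergence[OF _ _ Yai 1 2]) measurable
      show "integrable vol (?a (D n))" for n
        by (rule integrable_dominated_convergence2[OF _ _ Yai 1 2]) measurable
    qed
    have limb: "(\<lambda>n. LINT m|vol. ?b (w n) m) \<longlonglongrightarrow> (LINT m|vol. ?b w' m)"
      and intbn: "\<And>n. integrable vol (?b (w n))"
    proof -
      have 1: "AE m in vol. (\<lambda>n. ?b (w n) m) \<longlonglongrightarrow> ?b w' m"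
        using AEv by eventually_elim (auto intro!: tendsto_intros)
      have 2: "AE m in vol. norm (?b (w n) m) \<le> ?Yb m" for n
        using AEv sp by eventually_elim (use b_le in auto)
      show "(\<lambda>n. LINT m|vol. ?b (w n) m) \<longlonglongrightarrow> (LINT m|vol. ?b w' m)"
        by (rule integral_dominated_convergence[OF _ _ Ybi 1 2]) measurable
      show "integrable vol (?b (w n))" for n
        by (rule integrable_dominated_convergence2[OF _ _ Ybi 1 2]) measurable
    qed
    have i3: "(LINT m|vol. inner3 m (warp_deriv E m) (\<Phi> m)) = (LINT m|vol. ?a E m)" for E
      by (rule Bochner_Integration.integral_cong) (simp_all only: space_measures inner3_warp_deriv[OF \<Phi>])
    have i2: "(LINT m|vol. inner2 m (warp_tensor \<kappa> v m) (cov_adjoint \<Phi> m)) = (LINT m|vol. ?b v m)" for v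
      by (rule Bochner_Integration.integral_cong) (simp_all only: space_measures inner2_warp_tensor_adjoint[OF \<Phi>])
    have "(LINT m|vol. ?a (D n) m) = (LINT m|vol. ?b (w n) m)" for n
    proof -
      have "(LINT m|vol. ?a (D n) m - ?b (w n) m) =
        (LINT m|vol. inner3 m (warp_deriv (D n) m) (\<Phi> m) - inner2 m (warp_tensor \<kappa> (w n) m) (cov_adjoint \<Phi> m))"
        by (rule Bochner_Integration.integral_cong)
          (simp_all only: space_measures inner3_warp_deriv[OF \<Phi>] inner2_warp_tensor_adjoint[OF \<Phi>])
      then have "(LINT m|vol. ?a (D n) m - ?b (w n) m) = 0"
        using sphere_C1_divergence[OF \<Phi> C1[of n], of \<kappa>] by simp
      then show ?thesis using Bochner_Integration.integral_diff[OF intan[of n] intbn[of n]] by simp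
    qed
    then have "(LINT m|vol. ?a D' m) = (LINT m|vol. ?b w' m)"
      using LIMSEQ_unique[OF lima] limb by simp
    then show ?thesis unfolding i3 i2 .
  qed
  show ?thesis
    unfolding weak_cov_deriv_def
    using measurable_warp_tensor[OF w'] int2 trilinear_warp_deriv measurable_warp_deriv[OF D'] int3 ident
    by blast
qed

section \<open>Dominated convergence in L^p and in the Sobolev norm\<close>

lemma Lp_norm_finite:
  "(\<integral>\<^sup>+ m. ennreal (\<bar>F m\<bar> powr p) \<partial>vol) < \<infinity> \<Longrightarrow> Lp_norm p F < \<infinity>"
  by (auto simp: Lp_norm_def Let_def)

lemma Lp_norm_tendsto_0:
  assumes "p > 0" and lim: "(\<lambda>n. \<integral>\<^sup>+ m. ennreal (\<bar>F n m\<bar> powr p) \<partial>vol) \<longlonglongrightarrow> 0"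
  shows "(\<lambda>n. Lp_norm p (F n)) \<longlonglongrightarrow> 0"
proof -
  let ?I = "\<lambda>n. \<integral>\<^sup>+ m. ennreal (\<bar>F n m\<bar> powr p) \<partial>vol"
  have "(\<lambda>n. enn2real (?I n)) \<longlonglongrightarrow> 0"
    by (rule tendsto_enn2real) (use lim in simp_all)
  then have "(\<lambda>n. enn2real (?I n) powr (1 / p)) \<longlonglongrightarrow> 0"
    by (rule tendsto_zero_powrI[OF _ tendsto_const]) (use assms(1) in auto)
  then have l: "(\<lambda>n. ennreal (enn2real (?I n) powr (1 / p))) \<longlonglongrightarrow> 0"
    using tendsto_ennrealI by fastforce
  \<comment> \<open>This rules out the infinite branch of \<open>Lp_norm\<close> for all large
    n.\<close>
  have "\<forall>\<^sub>F n in sequentially. ?I n < 1"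
    by (rule order_tendstoD(2)[OF lim]) simp
  then have "\<forall>\<^sub>F n in sequentially. ennreal (enn2real (?I n) powr (1 / p)) = Lp_norm p (F n)"
    by eventually_elim (auto simp: Lp_norm_def Let_def)
  from tendsto_cong[OF this] l show ?thesis by simp
qed

lemma Lp_norm_dominated_tendsto_0:
  assumes p: "p > 0" and F: "\<And>n. F n \<in> borel_measurable vol"
    and Y: "integrable S2_measure (\<lambda>x. Y x powr p)"
    and lim: "AE m in vol. (\<lambda>n. F n m) \<longlonglongrightarrow> 0" and le: "\<And>n. AE m in vol. \<bar>F n m\<bar> \<le> Y (fst m)"
  shows "(\<lambda>n. Lp_norm p (F n)) \<longlonglongrightarrow> 0"
proof (rule Lp_norm_tendsto_0[OF p])
  have Yv: "integrable vol (\<lambda>m. Y (fst m) powr p)" using integrable_vol_fst[OF Y] .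
  have "(\<lambda>n. \<integral>\<^sup>+ m. ennreal (\<bar>F n m\<bar> powr p) \<partial>vol) \<longlonglongrightarrow> (\<integral>\<^sup>+ m. 0 \<partial>vol)"
  proof (rule nn_integral_dominated_convergence)
    show "(\<integral>\<^sup>+ m. ennreal (Y (fst m) powr p) \<partial>vol) < \<infinity>"
      using Yv by (simp add: integrable_iff_bounded)
    show "AE m in vol. ennreal (\<bar>F n m\<bar> powr p) \<le> ennreal (Y (fst m) powr p)" for n
      using le[of n] by eventually_elim (use p in \<open>auto intro!: ennreal_leI powr_mono2\<close>)
    show "AE m in vol. (\<lambda>n. ennreal (\<bar>F n m\<bar> powr p)) \<longlonglongrightarrow> 0"
      using lim
    proof eventually_elim
      case (elim m)
      have "(\<lambda>n. \<bar>F n m\<bar> powr p) \<longlonglongrightarrow> 0"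
        by (rule tendsto_zero_powrI[OF _ tendsto_const]) (use elim p tendsto_rabs_zero in auto)
      then show ?case using tendsto_ennrealI by fastforce
    qed
  next
    show "(\<lambda>m. ennreal (\<bar>F n m\<bar> powr p)) \<in> borel_measurable vol" for n
      using F[of n] by measurable
    show "(\<lambda>m. ennreal (Y (fst m) powr p)) \<in> borel_measurable vol"
      using borel_measurable_integrable[OF Yv] by measurable
  qed simp
  then show "(\<lambda>n. \<integral>\<^sup>+ m. ennreal (\<bar>F n m\<bar> powr p) \<partial>vol) \<longlonglongrightarrow> 0" by simp
qed

lemma Lp_norm_dominated_finite:
  assumes p: "p > 0"
    and Y: "integrable S2_measure (\<lambda>x. Y x powr p)" and le: "AE m in vol. \<bar>F m\<bar> \<le> Y (fst m)"
  shows "Lp_norm p F < \<infinity>"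
proof (rule Lp_norm_finite)
  have Yv: "integrable vol (\<lambda>m. Y (fst m) powr p)" using integrable_vol_fst[OF Y] .
  have "(\<integral>\<^sup>+ m. ennreal (\<bar>F m\<bar> powr p) \<partial>vol) \<le> (\<integral>\<^sup>+ m. ennreal (Y (fst m) powr p) \<partial>vol)"
    by (rule nn_integral_mono_AE) (use le p in \<open>auto intro!: ennreal_leI powr_mono2\<close>)
  also have "\<dots> < \<infinity>" using Yv by (simp add: integrable_iff_bounded)
  finally show "(\<integral>\<^sup>+ m. ennreal (\<bar>F m\<bar> powr p) \<partial>vol) < \<infinity>" .
qed

text \<open>An upper bound for the infimum needs only one weak derivative, so uniqueness never
  enters.\<close>

lemma W1p_norm_le: "weak_cov_deriv h T \<Longrightarrow> W1p_norm p h \<le> Lp_norm p (norm2 h) + Lp_norm p (norm3 T)"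
  unfolding W1p_norm_def by (intro add_left_mono INF_lower) simp

lemma sphere_C1_diff: "sphere_C1 v D \<Longrightarrow> sphere_C1 w E \<Longrightarrow> sphere_C1 (\<lambda>x. v x - w x) (\<lambda>x. D x - E x)"
  unfolding sphere_C1_def
  by (fastforce intro!: continuous_intros has_derivative_diff simp: inner_diff_left)

lemma W1p_converges_warp_tensor:
  fixes w :: "nat \<Rightarrow> real^3 \<Rightarrow> real" and D :: "nat \<Rightarrow> real^3 \<Rightarrow> real^3"
  assumes p: "p \<ge> 1" and C1: "\<And>n. sphere_C1 (w n) (D n)"
    and w': "w' \<in> borel_measurable S2_measure" and D': "D' \<in> borel_measurable S2_measure"
    and Ym: "Y \<in> borel_measurable S2_measure" and Y: "integrable S2_measure (\<lambda>x. Y x powr p)"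
    and lim: "AE x in S2_measure. (\<lambda>n. w n x) \<longlonglongrightarrow> w' x \<and> (\<lambda>n. D n x) \<longlonglongrightarrow> D' x
        \<and> (\<forall>n. \<bar>w n x\<bar> \<le> Y x \<and> norm (D n x) \<le> Y x)"
  shows "W1p_converges p (\<lambda>n. warp_tensor 1 (w n)) (warp_tensor 1 w')"
proof -
  have p0: "p > 0" using p by simp
  note AEv = AE_vol_fst[OF lim]
  have sp: "AE m in vol. m \<in> S2 \<times> S1" by (rule AE_I2) simp
  have bd: "AE x in S2_measure. \<bar>w' x\<bar> \<le> Y x \<and> norm (D' x) \<le> Y x"
    using lim
  proof eventually_elim
    case (elim x)
    have "\<bar>w' x\<bar> \<le> Y x"
      by (rule LIMSEQ_le_const2[OF tendsto_rabs[of "\<lambda>n. w n x"]]) (use elim in auto)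
    moreover have "norm (D' x) \<le> Y x"
      by (rule LIMSEQ_le_const2[OF tendsto_norm[of "\<lambda>n. D n x"]]) (use elim in auto)
    ultimately show ?case by simp
  qed
  note bdv = AE_vol_fst[OF bd]
  have Y0: "AE x in S2_measure. 0 \<le> Y x"
    using bd by eventually_elim (use abs_ge_zero order_trans in blast)
  have one: "integrable S2_measure (\<lambda>x. c :: real)" for c
    by (rule finite_measure.integrable_const[OF finite_S2_measure])
  \<comment> \<open>The weak formulation asks for an L^1 majorant; on a finite measure
    \<open>1 + Y powr p\<close> supplies it because \<open>p\<close> is at least 1.\<close>
  have Y1: "integrable S2_measure Y"
  proof (rule Bochner_Integration.integrable_bound)
    show "integrable S2_measure (\<lambda>x. 1 + Y x powr p)" by (intro Bochner_Integration.integrable_add one Y)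
    show "AE x in S2_measure. norm (Y x) \<le> norm (1 + Y x powr p)"
      using Y0
    proof eventually_elim
      case (elim x)
      show ?case
      proof (cases "Y x \<le> 1")
        case False
        then have "Y x powr 1 \<le> Y x powr p" using p by (intro powr_mono) auto
        then show ?thesis using False by simp
      next
        case True
        moreover have "0 \<le> Y x powr p" by simp
        ultimately have "Y x \<le> 1 + Y x powr p" by linarith
        then show ?thesis using elim by simp
      qed
    qed
  qed (rule Ym)
  have Y2: "integrable S2_measure (\<lambda>x. (2 * Y x) powr p)"
  proof (rule integrable_cong_AE_imp[OF integrable_mult_right[OF Y, of "2 powr p"]])
    show "AE x in S2_measure. 2 powr p * Y x powr p = (2 * Y x) powr p"
      using Y0 by eventually_elim (simp add: powr_mult)
  qed (use Ym in measurable)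
  \<comment> \<open>For \<kappa> = 1 the pointwise norm is at most 2 + \<open>Y\<close>. The
    constant \<open>4 powr p\<close> covers the points where \<open>Y\<close> is at most 2, the
    other summand the rest.\<close>
  have Y3: "integrable S2_measure (\<lambda>x. (2 + Y x) powr p)"
  proof (rule Bochner_Integration.integrable_bound)
    show "integrable S2_measure (\<lambda>x. 4 powr p + (2 * Y x) powr p)" by (intro Bochner_Integration.integrable_add one Y2)
    show "AE x in S2_measure. norm ((2 + Y x) powr p) \<le> norm (4 powr p + (2 * Y x) powr p)"
      using Y0
    proof eventually_elim
      case (elim x)
      show ?case
      proof (cases "Y x \<le> 2")
        case True
        then have "(2 + Y x) powr p \<le> 4 powr p" using p elim by (intro powr_mono2) auto
        then show ?thesis by (simp add: add_increasing2)
      next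
        case False
        then have "(2 + Y x) powr p \<le> (2 * Y x) powr p" using p elim by (intro powr_mono2) auto
        then show ?thesis by (simp add: add_increasing)
      qed
    qed
  qed (use Ym in measurable)
  have member: "warp_tensor 1 v \<in> W1p p"
    if v: "v \<in> borel_measurable S2_measure" and wk: "weak_cov_deriv (warp_tensor 1 v) (warp_deriv E)"
      and b: "AE x in S2_measure. \<bar>v x\<bar> \<le> Y x \<and> norm (E x) \<le> Y x" for v E
  proof -
    have "Lp_norm p (norm2 (warp_tensor 1 v)) < \<infinity>"
    proof (rule Lp_norm_dominated_finite[OF p0 Y3])
      show "AE m in vol. \<bar>norm2 (warp_tensor 1 v) m\<bar> \<le> 2 + Y (fst m)"
        using AE_vol_fst[OF b] sp
      proof eventually_elim
        case (elim m)
        then show ?case using norm2_warp_tensor_le[of m 1 v] norm_nonneg_tensor(1)[of m 1 v] by simp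
      qed
    qed
    moreover have "Lp_norm p (norm3 (warp_deriv E)) < \<infinity>"
    proof (rule Lp_norm_dominated_finite[OF p0 Y])
      show "AE m in vol. \<bar>norm3 (warp_deriv E) m\<bar> \<le> Y (fst m)"
        using AE_vol_fst[OF b] sp
      proof eventually_elim
        case (elim m)
        then show ?case using norm3_warp_deriv_le[of m E] norm_nonneg_tensor(2)[of m E] by simp
      qed
    qed
    ultimately have "W1p_norm p (warp_tensor 1 v) < \<infinity>"
      using W1p_norm_le[OF wk, of p] by (simp add: order_le_less_trans)
    moreover have "symmetric_tensor2 (warp_tensor 1 v)"
      unfolding symmetric_tensor2_def using bilinear_warp_tensor
      by (auto simp: warp_tensor_def g_S2_def g_S1_def inner_commute)
    ultimately show ?thesis unfolding W1p_def using measurable_warp_tensor[OF v] by blast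
  qed
  have "warp_tensor 1 (w n) \<in> W1p p" for n
  proof (rule member)
    show "weak_cov_deriv (warp_tensor 1 (w n)) (warp_deriv (D n))"
      by (rule weak_cov_deriv_limit[of "\<lambda>_. w n" "\<lambda>_. D n", OF C1 sphere_C1_measurable[OF C1] Y1])
        (use lim in eventually_elim, auto)
    show "AE x in S2_measure. \<bar>w n x\<bar> \<le> Y x \<and> norm (D n x) \<le> Y x"
      using lim by eventually_elim auto
  qed (rule sphere_C1_measurable[OF C1])
  moreover have "warp_tensor 1 w' \<in> W1p p"
    by (rule member[OF w' weak_cov_deriv_limit[OF C1 w' D' Y1 lim] bd])
  moreover have "(\<lambda>n. W1p_norm p (\<lambda>m u v. warp_tensor 1 (w n) m u v - warp_tensor 1 w' m u v)) \<longlonglongrightarrow> 0"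
  proof -
    let ?d = "\<lambda>n x. w n x - w' x" and ?E = "\<lambda>n x. D n x - D' x"
    have dm: "?d n \<in> borel_measurable S2_measure" "?E n \<in> borel_measurable S2_measure" for n
      using sphere_C1_measurable[OF C1] w' D' by measurable
    have eq: "(\<lambda>m u v. warp_tensor 1 (w n) m u v - warp_tensor 1 w' m u v) = warp_tensor 0 (?d n)" for n
      by (simp add: fun_eq_iff warp_tensor_def algebra_simps)
    \<comment> \<open>Here \<open>n\<close> is fixed and \<open>k\<close> tends to infinity: the
      difference from the limit is itself approximated by C^1 functions.\<close>
    have wk: "weak_cov_deriv (warp_tensor 0 (?d n)) (warp_deriv (?E n))" for n
    proof (rule weak_cov_deriv_limit[of "\<lambda>k x. w n x - w k x" "\<lambda>k x. D n x - D k x"])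
      show "integrable S2_measure (\<lambda>x. 2 * Y x)" using Y1 by simp
      show "AE x in S2_measure. (\<lambda>k. w n x - w k x) \<longlonglongrightarrow> ?d n x \<and> (\<lambda>k. D n x - D k x) \<longlonglongrightarrow> ?E n x
        \<and> (\<forall>k. \<bar>w n x - w k x\<bar> \<le> 2 * Y x \<and> norm (D n x - D k x) \<le> 2 * Y x)"
        using lim
      proof eventually_elim
        case (elim x)
        have e: "\<bar>w k x\<bar> \<le> Y x" "norm (D k x) \<le> Y x" for k using elim by blast+
        have "\<bar>w n x - w k x\<bar> \<le> 2 * Y x" for k
          using e(1)[of n] e(1)[of k] by linarith
        moreover have "norm (D n x - D k x) \<le> 2 * Y x" for k
          using e(2)[of n] e(2)[of k] norm_triangle_ineq4[of "D n x" "D k x"] by linarith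
        ultimately show ?case using elim by (auto intro!: tendsto_intros)
      qed
    qed (intro sphere_C1_diff C1 dm)+
    have A: "(\<lambda>n. Lp_norm p (norm2 (warp_tensor 0 (?d n)))) \<longlonglongrightarrow> 0"
    proof (rule Lp_norm_dominated_tendsto_0[OF p0 borel_measurable_norm2_warp_tensor[OF dm(1)] Y2])
      show "AE m in vol. (\<lambda>n. norm2 (warp_tensor 0 (?d n)) m) \<longlonglongrightarrow> 0"
        using AEv sp
      proof eventually_elim
        case (elim m)
        then have "(\<lambda>n. ?d n (fst m)) \<longlonglongrightarrow> 0" by (intro LIM_zero) auto
        then show ?case using elim by (simp add: norm2_warp_tensor tendsto_rabs_zero)
      qed
      show "AE m in vol. \<bar>norm2 (warp_tensor 0 (?d n)) m\<bar> \<le> 2 * Y (fst m)" for n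
        using AEv bdv sp
      proof eventually_elim
        case (elim m)
        have "\<bar>w n (fst m)\<bar> \<le> Y (fst m)" "\<bar>w' (fst m)\<bar> \<le> Y (fst m)" using elim by blast+
        then have "\<bar>?d n (fst m)\<bar> \<le> 2 * Y (fst m)" by linarith
        then show ?case using elim by (simp add: norm2_warp_tensor)
      qed
    qed
    have B: "(\<lambda>n. Lp_norm p (norm3 (warp_deriv (?E n)))) \<longlonglongrightarrow> 0"
    proof (rule Lp_norm_dominated_tendsto_0[OF p0 borel_measurable_norm3_warp_deriv[OF dm(2)] Y2])
      show "AE m in vol. (\<lambda>n. norm3 (warp_deriv (?E n)) m) \<longlonglongrightarrow> 0"
        using AEv sp
      proof eventually_elim
        case (elim m)
        then have "(\<lambda>n. ?E n (fst m)) \<longlonglongrightarrow> 0" by (intro LIM_zero) auto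
        then have "(\<lambda>n. norm (?E n (fst m))) \<longlonglongrightarrow> 0" by (rule tendsto_norm_zero)
        then show ?case
          by (rule tendsto_sandwich[OF always_eventually always_eventually tendsto_const, rotated 2])
            (use elim norm_nonneg_tensor(2) norm3_warp_deriv_le[of m] in auto)
      qed
      show "AE m in vol. \<bar>norm3 (warp_deriv (?E n)) m\<bar> \<le> 2 * Y (fst m)" for n
        using AEv bdv sp
      proof eventually_elim
        case (elim m)
        have "norm (?E n (fst m)) \<le> norm (D n (fst m)) + norm (D' (fst m))" by (rule norm_triangle_ineq4)
        moreover have "norm (D n (fst m)) \<le> Y (fst m)" "norm (D' (fst m)) \<le> Y (fst m)" using elim by blast+
        moreover have "norm3 (warp_deriv (?E n)) m \<le> norm (?E n (fst m))" "0 \<le> norm3 (warp_deriv (?E n)) m"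
          using elim norm3_warp_deriv_le norm_nonneg_tensor(2) by blast+
        ultimately show ?case by linarith
      qed
    qed
    have "(\<lambda>n. Lp_norm p (norm2 (warp_tensor 0 (?d n))) + Lp_norm p (norm3 (warp_deriv (?E n)))) \<longlonglongrightarrow> 0"
      using tendsto_add[OF A B] by simp
    then show ?thesis
      unfolding eq
      by (rule tendsto_sandwich[OF always_eventually always_eventually tendsto_const, rotated 2])
        (auto intro: W1p_norm_le[OF wk])
  qed
  ultimately show ?thesis unfolding W1p_converges_def by blast
qed

section \<open>Weighted series of singular kernels\<close>

text \<open>Tannery's theorem, obtained as dominated convergence for the counting measure, with
  terms and range of summation varying together. The bound is asked only for i < n, which excludes n
  = 0.\<close>

lemma dominated_series_limit:
  fixes f :: "nat \<Rightarrow> nat \<Rightarrow> 'a::{banach, second_countable_topology}"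
  assumes lim: "\<And>i. (\<lambda>n. f n i) \<longlonglongrightarrow> g i" and le: "\<And>n i. i < n \<Longrightarrow> norm (f n i) \<le> M i" and M: "summable M"
  shows "(\<lambda>n. \<Sum>i<n. f n i) \<longlonglongrightarrow> (\<Sum>i. g i)" and "summable (\<lambda>i. norm (g i))"
proof -
  define h where "h n i = (if i < n then f n i else 0)" for n i
  \<comment> \<open>Taking n = \<open>Suc i\<close> makes the bound on \<open>f n i\<close>
    available for every \<open>i\<close>.\<close>
  have le0: "0 \<le> M i" for i using order_trans[OF norm_ge_zero le[of i "Suc i"]] by simp
  have hM: "AE i in count_space UNIV. norm (h n i) \<le> M i" for n
    by (simp add: AE_count_space h_def le le0)
  have hg: "AE i in count_space UNIV. (\<lambda>n. h n i) \<longlonglongrightarrow> g i"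
  proof -
    have "(\<lambda>n. h n i) \<longlonglongrightarrow> g i" for i
    proof -
      have "\<forall>\<^sub>F n in sequentially. f n i = h n i"
        using eventually_gt_at_top[of i] by eventually_elim (simp add: h_def)
      then show ?thesis using tendsto_cong[of "\<lambda>n. f n i" "\<lambda>n. h n i"] lim by blast
    qed
    then show ?thesis by (simp add: AE_count_space)
  qed
  have Mi: "integrable (count_space UNIV) M"
    unfolding integrable_count_space_nat_iff using M le0 by simp
  have gi: "integrable (count_space UNIV) g"
    by (rule integrable_dominated_convergence[OF _ _ Mi hg hM]) simp_all
  have hi: "integrable (count_space UNIV) (h n)" for n
    by (rule integrable_dominated_convergence2[OF _ _ Mi hg hM]) simp_all
  have "(\<lambda>n. integral\<^sup>L (count_space UNIV) (h n)) \<longlonglongrightarrow> integral\<^sup>L (count_space UNIV) g"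
    by (rule integral_dominated_convergence[OF _ _ Mi hg hM]) simp_all
  moreover have "integral\<^sup>L (count_space UNIV) (h n) = (\<Sum>i<n. f n i)" for n
    unfolding integral_count_space_nat[OF hi] by (subst suminf_finite[of "{..<n}"]) (auto simp: h_def)
  ultimately show "(\<lambda>n. \<Sum>i<n. f n i) \<longlonglongrightarrow> (\<Sum>i. g i)"
    by (simp add: integral_count_space_nat[OF gi])
  show "summable (\<lambda>i. norm (g i))" using gi by (simp add: integrable_count_space_nat_iff)
qed

text \<open>Jensen for the weights divided by their total \<open>a\<close>. Undoing the
  normalisation leaves \<open>a powr (p - 1)\<close>, which is at most
  \<open>K powr (p - 1)\<close>; a vanishing total has to be treated apart.\<close>

lemma weighted_sum_powr_le:
  fixes \<alpha> y :: "nat \<Rightarrow> real"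
  assumes p: "1 \<le> p" and \<alpha>: "\<And>i. 0 \<le> \<alpha> i" and y: "\<And>i. 0 < y i" and K: "(\<Sum>i<n. \<alpha> i) \<le> K"
  shows "(\<Sum>i<n. \<alpha> i * y i) powr p \<le> K powr (p - 1) * (\<Sum>i<n. \<alpha> i * y i powr p)"
proof (cases "(\<Sum>i<n. \<alpha> i) = 0")
  case True
  then have "\<alpha> i = 0" if "i < n" for i
    using sum_nonneg_eq_0_iff[of "{..<n}" \<alpha>] \<alpha> that by auto
  then show ?thesis by simp
next
  case False
  define a where "a = (\<Sum>i<n. \<alpha> i)"
  have a: "0 < a" using False sum_nonneg[of "{..<n}" \<alpha>] \<alpha> unfolding a_def by (simp add: order_less_le)
  have "(\<Sum>i<n. (\<alpha> i / a) *\<^sub>R y i) powr p \<le> (\<Sum>i<n. (\<alpha> i / a) * y i powr p)"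
  proof (rule convex_on_sum[OF _ _ powr_convex[OF p]])
    show "{..<n} \<noteq> {}" using False by auto
    show "(\<Sum>i<n. \<alpha> i / a) = 1" using a by (simp add: sum_divide_distrib[symmetric] a_def)
  qed (use \<alpha> y a in auto)
  then have "((\<Sum>i<n. \<alpha> i * y i) / a) powr p \<le> (\<Sum>i<n. \<alpha> i * y i powr p) / a"
    by (simp add: sum_divide_distrib)
  then have "(\<Sum>i<n. \<alpha> i * y i) powr p / a powr p \<le> (\<Sum>i<n. \<alpha> i * y i powr p) / a"
    using a \<alpha> y by (subst (asm) powr_divide) (auto intro!: sum_nonneg mult_nonneg_nonneg simp: less_imp_le)
  then have "(\<Sum>i<n. \<alpha> i * y i) powr p \<le> (\<Sum>i<n. \<alpha> i * y i powr p) / a * a powr p"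
    using a by (simp add: pos_divide_le_eq)
  also have "\<dots> = a powr (p - 1) * (\<Sum>i<n. \<alpha> i * y i powr p)"
    using a by (simp add: powr_diff)
  also have "\<dots> \<le> K powr (p - 1) * (\<Sum>i<n. \<alpha> i * y i powr p)"
    using a K p \<alpha> unfolding a_def by (intro mult_right_mono powr_mono2 sum_nonneg) auto
  finally show ?thesis .
qed

text \<open>Replacing both bases by the smaller one bounds a mixed product by a single power at one
  of the two centres. The double sum then factors through the total weight once for each centre,
  whence \<open>2 * K\<close>. This is what controls the function times its gradient.\<close>

lemma weighted_sum_mult_le:
  fixes \<alpha> s :: "nat \<Rightarrow> real"
  assumes \<alpha>: "\<And>i. 0 \<le> \<alpha> i" and s: "\<And>i. 0 < s i" and K: "(\<Sum>i<n. \<alpha> i) \<le> K" and pos: "0 \<le> u" "0 \<le> v"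
  shows "(\<Sum>i<n. \<alpha> i * s i powr (-u)) * (\<Sum>i<n. \<alpha> i * s i powr (-v)) \<le> 2 * K * (\<Sum>i<n. \<alpha> i * s i powr (-(u + v)))"
proof -
  have *: "s i powr (-u) * s k powr (-v) \<le> s i powr (-(u + v)) + s k powr (-(u + v))" for i k
  proof (cases "s i \<le> s k")
    case True
    have "s i powr (-u) * s k powr (-v) \<le> s i powr (-u) * s i powr (-v)"
      using True s[of i] pos by (intro mult_left_mono powr_mono2') auto
    then show ?thesis by (simp add: powr_add[symmetric] add_increasing2)
  next
    case False
    have "s i powr (-u) * s k powr (-v) \<le> s k powr (-u) * s k powr (-v)"
      using False s[of k] pos by (intro mult_right_mono powr_mono2') auto
    then show ?thesis by (simp add: powr_add[symmetric] add_increasing)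
  qed
  let ?S = "\<Sum>i<n. \<alpha> i * s i powr (-(u + v))" and ?a = "\<Sum>i<n. \<alpha> i"
  have S0: "0 \<le> ?S" by (intro sum_nonneg mult_nonneg_nonneg \<alpha>) simp
  have "(\<Sum>i<n. \<alpha> i * s i powr (-u)) * (\<Sum>i<n. \<alpha> i * s i powr (-v))
      = (\<Sum>i<n. \<Sum>k<n. (\<alpha> i * \<alpha> k) * (s i powr (-u) * s k powr (-v)))"
    by (simp add: sum_product mult_ac)
  also have "\<dots> \<le> (\<Sum>i<n. \<Sum>k<n. (\<alpha> i * \<alpha> k) * (s i powr (-(u + v)) + s k powr (-(u + v))))"
    by (intro sum_mono mult_left_mono * mult_nonneg_nonneg \<alpha>)
  also have "\<dots> = (\<Sum>i<n. \<Sum>k<n. (\<alpha> i * s i powr (-(u + v))) * \<alpha> k) + (\<Sum>i<n. \<Sum>k<n. \<alpha> i * (\<alpha> k * s k powr (-(u + v))))"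
    by (simp add: sum.distrib[symmetric] algebra_simps)
  also have "\<dots> = ?S * ?a + ?a * ?S"
    by (simp only: sum_product)
  also have "\<dots> \<le> 2 * K * ?S"
    using mult_right_mono[OF K S0] by (simp add: algebra_simps)
  finally show ?thesis .
qed

section \<open>The kernel as a function of the inner product, and bounds uniform in
  \<open>a\<close>\<close>

definition log_kernel :: "real \<Rightarrow> real \<Rightarrow> real \<Rightarrow> real" where
  "log_kernel a b t = ln ((1 + a) / (1 - t\<^sup>2 + a)) + b"

definition log_kernel_deriv :: "real \<Rightarrow> real \<Rightarrow> real" where
  "log_kernel_deriv a t = 2 * t / (1 - t\<^sup>2 + a)"

lemma abs_inner_S2_le: "x \<in> S2 \<Longrightarrow> c \<in> S2 \<Longrightarrow> \<bar>x \<bullet> c\<bar> \<le> 1"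
  using Cauchy_Schwarz_ineq2[of x c] by simp

lemma inner_square_S2_le: "x \<in> S2 \<Longrightarrow> c \<in> S2 \<Longrightarrow> (x \<bullet> c)\<^sup>2 \<le> 1"
  using abs_inner_S2_le by (simp add: abs_square_le_1)

text \<open>With t = cos r the squared sine is 1 - t^2, so the arccosine disappears. For
  \<open>0 < a\<close> what remains is differentiable in the ambient variable also at the centre and
  its antipode.\<close>

lemma f_pos_dist_S2:
  assumes "x \<in> S2" "c \<in> S2"
  shows "f_pos a b (dist_S2 x c) = log_kernel a b (x \<bullet> c)"
  using abs_inner_S2_le[OF assms] inner_square_S2_le[OF assms]
  by (simp add: f_pos_def dist_S2_def log_kernel_def sin_arccos_abs)

lemma f_zero_dist_S2:
  assumes "x \<in> S2" "c \<in> S2" and lt: "(x \<bullet> c)\<^sup>2 < 1"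
  shows "f_zero b (dist_S2 x c) = ereal (log_kernel 0 b (x \<bullet> c))"
proof -
  have t: "\<bar>x \<bullet> c\<bar> < 1" using lt by (simp add: abs_square_less_1)
  then have "arccos (x \<bullet> c) \<in> {0<..<pi}" using arccos_lt_bounded[of "x \<bullet> c"] by auto
  moreover have "ln (sqrt (1 - (x \<bullet> c)\<^sup>2)) = ln (1 - (x \<bullet> c)\<^sup>2) / 2"
    using lt by (simp add: ln_sqrt)
  ultimately show ?thesis
    using t lt by (simp add: f_zero_def dist_S2_def log_kernel_def sin_arccos_abs ln_div)
qed

text \<open>As s = 1 - t^2 is at most 1, the quotient (1 + a) / (s + a) is at most 1 / s for every
  \<open>a\<close>, and ln y is at most y powr e / e. The same s \<le> 1 lets s powr (-e) absorb the
  constant \<open>b\<close>.\<close>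

lemma log_kernel_bounds:
  assumes a: "0 \<le> a" and b: "0 \<le> b" "b \<le> B" and t: "t\<^sup>2 < 1" and e: "0 < e"
  shows "0 \<le> log_kernel a b t" "log_kernel a b t \<le> (1 / e + B) * (1 - t\<^sup>2) powr (-e)"
proof -
  define s where "s = 1 - t\<^sup>2"
  have s: "0 < s" "s \<le> 1" using t by (auto simp: s_def)
  have 1: "1 \<le> (1 + a) / (s + a)" using s a by simp
  then show "0 \<le> log_kernel a b t" using b unfolding log_kernel_def s_def[symmetric] by simp
  have "(1 + a) / (s + a) \<le> 1 / s" using s a by (simp add: field_simps mult_left_le)
  then have "ln ((1 + a) / (s + a)) \<le> ln (1 / s)" using 1 s by (subst ln_le_cancel_iff) auto
  also have "\<dots> \<le> (1 / s) powr e / e" using s e by (intro ln_powr_bound) auto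
  also have "(1 / s) powr e = s powr (-e)" using s by (simp add: powr_divide powr_minus_divide)
  finally have 2: "ln ((1 + a) / (s + a)) \<le> 1 / e * s powr (-e)" by simp
  have "1 powr (-e) \<le> s powr (-e)" using s e by (intro powr_mono2') auto
  then have "b \<le> B * s powr (-e)" using b mult_mono[of b B 1 "s powr (-e)"] by simp
  then show "log_kernel a b t \<le> (1 / e + B) * (1 - t\<^sup>2) powr (-e)"
    using 2 unfolding log_kernel_def s_def[symmetric] by (simp add: algebra_simps)
qed

lemma norm_tangential:
  fixes x c :: "real^3"
  assumes "x \<in> S2" "c \<in> S2"
  shows "norm (c - (x \<bullet> c) *\<^sub>R x) = sqrt (1 - (x \<bullet> c)\<^sup>2)"
  using unit_inner_self[OF assms(1)] unit_inner_self[OF assms(2)]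
  by (simp add: norm_eq_sqrt_inner inner_diff_left inner_diff_right inner_commute power2_eq_square)

text \<open>The tangential part of \<open>c\<close> has length sqrt s, which improves the scalar
  factor 2 / s to the power -1/2; discarding \<open>a\<close> from the denominator makes the bound
  uniform.\<close>

lemma log_kernel_deriv_bound:
  assumes x: "x \<in> S2" and c: "c \<in> S2" and lt: "(x \<bullet> c)\<^sup>2 < 1" and a: "0 \<le> a"
  shows "norm (log_kernel_deriv a (x \<bullet> c) *\<^sub>R (c - (x \<bullet> c) *\<^sub>R x)) \<le> 2 * (1 - (x \<bullet> c)\<^sup>2) powr (-(1/2))"
proof -
  define s where "s = 1 - (x \<bullet> c)\<^sup>2"
  have s: "0 < s" using lt by (simp add: s_def)
  have "\<bar>log_kernel_deriv a (x \<bullet> c)\<bar> \<le> 2 / s"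
    unfolding log_kernel_deriv_def s_def[symmetric] abs_divide
    using s a abs_inner_S2_le[OF x c] by (intro frac_le) (auto simp: abs_mult)
  then have "\<bar>log_kernel_deriv a (x \<bullet> c)\<bar> * sqrt s \<le> 2 / s * sqrt s"
    using s by (intro mult_right_mono) auto
  also have "\<dots> = 2 * s powr (-(1/2))"
    using s by (simp add: powr_minus powr_half_sqrt divide_simps)
  finally show ?thesis by (simp add: norm_tangential[OF x c] s_def)
qed

text \<open>Needed because \<open>dist_S2\<close>, built on \<open>arccos\<close>, has junk values off the sphere, where the smooth
  kernels below do not.\<close>
lemma tensor2_cong:
  assumes eq: "\<And>m. m \<in> S2 \<times> S1 \<Longrightarrow> h m = h' m"
  shows "W1p_norm p h = W1p_norm p h'" and "h \<in> W1p p \<longleftrightarrow> h' \<in> W1p p"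
proof -
  have n2: "norm2 h m = norm2 h' m" if "m \<in> space vol" for m
    using eq[of m] that unfolding norm2_def space_measures by (simp only:)
  have L: "Lp_norm p (norm2 h) = Lp_norm p (norm2 h')"
  proof -
    have "(\<integral>\<^sup>+m. ennreal (\<bar>norm2 h m\<bar> powr p) \<partial>vol) = (\<integral>\<^sup>+m. ennreal (\<bar>norm2 h' m\<bar> powr p) \<partial>vol)"
      by (rule nn_integral_cong) (simp only: n2)
    then show ?thesis unfolding Lp_norm_def by (simp only:)
  qed
  have M: "measurable_tensor2 h \<longleftrightarrow> measurable_tensor2 h'"
    unfolding measurable_tensor2_def by (intro iff_allI measurable_cong) (simp only: space_measures eq)
  have I: "integrable vol (norm2 h) \<longleftrightarrow> integrable vol (norm2 h')"
    by (rule Bochner_Integration.integrable_cong[OF refl n2])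
  have "(LINT m|vol. inner2 m (h m) (cov_adjoint \<Phi> m)) = (LINT m|vol. inner2 m (h' m) (cov_adjoint \<Phi> m))" for \<Phi>
    by (rule Bochner_Integration.integral_cong) (simp_all only: space_measures eq)
  then have W: "weak_cov_deriv h T \<longleftrightarrow> weak_cov_deriv h' T" for T
    unfolding weak_cov_deriv_def M I by (simp only:)
  show N: "W1p_norm p h = W1p_norm p h'" unfolding W1p_norm_def L W ..
  have "symmetric_tensor2 h \<longleftrightarrow> symmetric_tensor2 h'"
    unfolding symmetric_tensor2_def by (intro ball_cong refl) (simp only: eq)
  then show "h \<in> W1p p \<longleftrightarrow> h' \<in> W1p p" unfolding W1p_def by (simp only: mem_Collect_eq N M)
qed

lemma measurable_S2_borel: "f \<in> borel_measurable borel \<Longrightarrow> f \<in> borel_measurable S2_measure"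
  by (subst measurable_cong_sets[OF sets_measures(1) refl], rule measurable_restrict_space1)

text \<open>Centres and weights are counted from 0 here, while \<open>a\<close> keeps its count from
  1, so \<open>a 0\<close> is unconstrained; it occurs only together with the empty sum.\<close>

locale singular_warp =
  fixes a :: "nat \<Rightarrow> real" and \<alpha> \<beta> :: "nat \<Rightarrow> real" and \<gamma> :: "nat \<Rightarrow> real^3" and B K p :: real
  assumes a_pos: "\<And>n. 0 < n \<Longrightarrow> 0 < a n" and a_lim: "a \<longlonglongrightarrow> 0"
    and \<alpha>_nonneg: "\<And>i. 0 \<le> \<alpha> i" and \<alpha>_sums: "\<alpha> sums K"
    and \<beta>: "\<And>i. 0 \<le> \<beta> i" "\<And>i. \<beta> i \<le> B" and \<gamma>: "\<And>i. \<gamma> i \<in> S2" and p: "1 \<le> p" "p < 2"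
begin

definition F :: "nat \<Rightarrow> real^3 \<Rightarrow> real" where
  "F n x = (\<Sum>i<n. \<alpha> i * log_kernel (a n) (\<beta> i) (x \<bullet> \<gamma> i))"

text \<open>The gradient of \<open>F n\<close> on the sphere: the tangential part of
  \<open>\<gamma> i\<close> is the gradient of the inner product with
  \<open>\<gamma> i\<close>.\<close>

definition G :: "nat \<Rightarrow> real^3 \<Rightarrow> real^3" where
  "G n x = (\<Sum>i<n. \<alpha> i *\<^sub>R (log_kernel_deriv (a n) (x \<bullet> \<gamma> i) *\<^sub>R (\<gamma> i - (x \<bullet> \<gamma> i) *\<^sub>R x)))"

definition F_lim :: "real^3 \<Rightarrow> real" where
  "F_lim x = (\<Sum>i. \<alpha> i * log_kernel 0 (\<beta> i) (x \<bullet> \<gamma> i))"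

definition G_lim :: "real^3 \<Rightarrow> real^3" where
  "G_lim x = (\<Sum>i. \<alpha> i *\<^sub>R (log_kernel_deriv 0 (x \<bullet> \<gamma> i) *\<^sub>R (\<gamma> i - (x \<bullet> \<gamma> i) *\<^sub>R x)))"

text \<open>The squared sine of the distance to the i-th centre; it vanishes at the antipode too,
  where the kernel is equally singular.\<close>

definition dst :: "real^3 \<Rightarrow> nat \<Rightarrow> real" where "dst x i = 1 - (x \<bullet> \<gamma> i)\<^sup>2"

text \<open>The exponents are chosen so that \<open>p * (1/2 + \<epsilon>) = \<rho> < 1\<close>.\<close>

definition \<rho> :: real where "\<rho> = 1/2 + p/4"

definition \<epsilon> :: real where "\<epsilon> = 1 / (2 * p) - 1 / 4"

text \<open>Taken in \<open>ennreal\<close> so that it can be integrated termwise before its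
  finiteness is known.\<close>

definition Z :: "real^3 \<Rightarrow> ennreal" where
  "Z x = (\<Sum>i. ennreal (\<alpha> i * dst x i powr (-\<rho>)))"

text \<open>The set of full measure on which every pointwise estimate and limit is carried
  out.\<close>

definition good :: "real^3 \<Rightarrow> bool" where
  "good x \<longleftrightarrow> x \<in> S2 \<and> (\<forall>i. (x \<bullet> \<gamma> i)\<^sup>2 < 1) \<and> Z x < \<infinity>"

text \<open>The first summand serves the square of \<open>F\<close>. In the second, 8 is 2 from
  differentiating the square, 2 from the gradient bound, and 2 from
  \<open>weighted_sum_mult_le\<close>.\<close>

definition C :: real where "C = 2 * K * (1 / \<epsilon> + B)\<^sup>2 + 8 * K * (1 / \<epsilon> + B)"

text \<open>The p-th root of the Jensen bound, so that \<open>Y x powr p\<close> is a constant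
  multiple of the real value of \<open>Z x\<close>.\<close>

definition Y :: "real^3 \<Rightarrow> real" where
  "Y x = C * (K powr (p - 1) * enn2real (Z x)) powr (1 / p)"

text \<open>As the midpoint of p/2 and 1, \<open>\<rho>\<close> is below 1 exactly when p < 2; the
  lower bound 1/2 makes the gradient series summable at good points.\<close>

lemma \<rho>: "1 / 2 \<le> \<rho>" "\<rho> < 1"
  using p by (auto simp: \<rho>_def)

lemma \<epsilon>: "0 < \<epsilon>" "\<epsilon> \<le> 1 / 2" "p * (1/2 + \<epsilon>) = \<rho>"
proof -
  show "0 < \<epsilon>" using p by (simp add: \<epsilon>_def field_simps)
  have "1 / (2 * p) \<le> 1 / 2" using p by (intro divide_left_mono) auto
  then show "\<epsilon> \<le> 1 / 2" by (simp add: \<epsilon>_def)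
  show "p * (1/2 + \<epsilon>) = \<rho>" using p by (simp add: \<epsilon>_def \<rho>_def field_simps)
qed

lemma K_nonneg: "0 \<le> K" and sum_\<alpha>_le: "(\<Sum>i<n. \<alpha> i) \<le> K" and B_nonneg: "0 \<le> B"
proof -
  show 1: "(\<Sum>i<n. \<alpha> i) \<le> K" for n
    using sum_le_suminf[OF sums_summable[OF \<alpha>_sums], of "{..<n}"] \<alpha>_nonneg sums_unique[OF \<alpha>_sums] by simp
  show "0 \<le> K" using 1[of 0] by simp
  show "0 \<le> B" using \<beta>[of 0] by simp
qed

lemma C_nonneg: "0 \<le> C"
  unfolding C_def using K_nonneg B_nonneg \<epsilon>(1) by (intro add_nonneg_nonneg mult_nonneg_nonneg) auto

lemma dst_pos: "good x \<Longrightarrow> 0 < dst x i" and dst_le: "dst x i \<le> 1"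
  by (auto simp: good_def dst_def)

lemma Z_measurable [measurable]: "Z \<in> borel_measurable borel"
  unfolding Z_def dst_def by measurable

text \<open>The integral of each power is bounded by the same \<open>M\<close> for all centres, so
  the sum of the weights controls the whole series.\<close>

lemma Z_integral: "(\<integral>\<^sup>+x. Z x \<partial>S2_measure) < \<infinity>"
proof -
  have q: "0 \<le> \<rho>" "\<rho> < 1" using \<rho> by auto
  obtain M where M: "0 \<le> M"
    "\<And>c. c \<in> S2 \<Longrightarrow> (\<integral>\<^sup>+x. ennreal ((1 - (x \<bullet> c)\<^sup>2) powr (-\<rho>)) \<partial>S2_measure) \<le> ennreal M"
    using S2_kernel_integral_bound[OF q] by metis
  have m: "(\<lambda>x. ennreal (dst x i powr (-\<rho>))) \<in> borel_measurable S2_measure" for i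
    unfolding dst_def by (rule measurable_S2_borel) measurable
  have "(\<integral>\<^sup>+x. Z x \<partial>S2_measure) = (\<integral>\<^sup>+x. (\<Sum>i. ennreal (\<alpha> i) * ennreal (dst x i powr (-\<rho>))) \<partial>S2_measure)"
    unfolding Z_def by (simp add: ennreal_mult \<alpha>_nonneg)
  also have "\<dots> = (\<Sum>i. ennreal (\<alpha> i) * (\<integral>\<^sup>+x. ennreal (dst x i powr (-\<rho>)) \<partial>S2_measure))"
  proof -
    have "(\<lambda>x. ennreal (\<alpha> i) * ennreal (dst x i powr (-\<rho>))) \<in> borel_measurable S2_measure" for i
      using m[of i] by measurable
    then show ?thesis
      by (simp only: nn_integral_suminf nn_integral_cmult[OF m])
  qed
  also have "\<dots> \<le> (\<Sum>i. ennreal (\<alpha> i) * ennreal M)"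
  proof (rule suminf_le)
    show "ennreal (\<alpha> i) * (\<integral>\<^sup>+x. ennreal (dst x i powr (-\<rho>)) \<partial>S2_measure) \<le> ennreal (\<alpha> i) * ennreal M" for i
      unfolding dst_def by (rule mult_left_mono[OF M(2)[OF \<gamma>]]) simp
  qed simp_all
  also have "\<dots> = (\<Sum>i. ennreal (\<alpha> i)) * ennreal M"
    by (rule ennreal_suminf_multc)
  also have "\<dots> < \<infinity>"
    using suminf_ennreal_eq[OF \<alpha>_nonneg \<alpha>_sums] by (simp add: ennreal_mult_less_top)
  finally show ?thesis .
qed

lemma Z_measurable_S2: "Z \<in> borel_measurable S2_measure"
  by (rule measurable_S2_borel) measurable

lemma AE_good: "AE x in S2_measure. good x"
proof -
  have 1: "AE x in S2_measure. Z x \<noteq> \<infinity>"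
    by (rule nn_integral_PInf_AE[OF Z_measurable_S2]) (use Z_integral in auto)
  have 2: "AE x in S2_measure. \<forall>i. (x \<bullet> \<gamma> i)\<^sup>2 < 1"
    unfolding AE_all_countable using AE_S2_inner_square_less_1[OF \<gamma>] by blast
  have 3: "AE x in S2_measure. x \<in> S2" by (rule AE_I2) simp
  show ?thesis using 1 2 3 by eventually_elim (simp add: good_def top.not_eq_extremum)
qed

lemma good_summable:
  assumes x: "good x"
  shows "summable (\<lambda>i. \<alpha> i * dst x i powr (-\<rho>))" (is "summable ?z")
    and "enn2real (Z x) = (\<Sum>i. \<alpha> i * dst x i powr (-\<rho>))"
proof -
  have nn: "0 \<le> ?z i" for i by (simp add: \<alpha>_nonneg)
  show s: "summable ?z"
    by (rule summable_suminf_not_top[OF nn]) (use x in \<open>auto simp: good_def Z_def\<close>)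
  show "enn2real (Z x) = suminf ?z"
    unfolding Z_def suminf_ennreal2[OF nn s] by (rule enn2real_ennreal[OF suminf_nonneg[OF s nn]])
qed

lemma good_summable_le:
  assumes x: "good x" and r: "r \<le> \<rho>"
  shows "summable (\<lambda>i. \<alpha> i * dst x i powr (-r))"
proof (rule summable_comparison_test'[OF good_summable(1)[OF x], of 0])
  fix i
  have "dst x i powr (-r) \<le> dst x i powr (-\<rho>)"
    using dst_pos[OF x, of i] dst_le[of x i] r by (intro powr_mono') auto
  then show "norm (\<alpha> i * dst x i powr (-r)) \<le> \<alpha> i * dst x i powr (-\<rho>)"
    using \<alpha>_nonneg by (simp add: abs_mult mult_left_mono)
qed

lemma good_bounds:
  assumes x: "good x"
  shows "\<bar>F n x\<bar> \<le> (1 / \<epsilon> + B) * (\<Sum>i<n. \<alpha> i * dst x i powr (-\<epsilon>))"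
    and "norm (G n x) \<le> 2 * (\<Sum>i<n. \<alpha> i * dst x i powr (-(1/2)))"
proof -
  have xS: "x \<in> S2" and lt: "\<And>i. (x \<bullet> \<gamma> i)\<^sup>2 < 1" using x by (auto simp: good_def)
  \<comment> \<open>An index i < n exists only for positive n, where \<open>a n\<close> is
    positive.\<close>
  have an: "0 \<le> a n" if "i < n" for i using a_pos[of n] that by simp
  have "\<bar>F n x\<bar> \<le> (\<Sum>i<n. \<bar>\<alpha> i * log_kernel (a n) (\<beta> i) (x \<bullet> \<gamma> i)\<bar>)" unfolding F_def by (rule sum_abs)
  also have "\<dots> \<le> (\<Sum>i<n. \<alpha> i * ((1 / \<epsilon> + B) * dst x i powr (-\<epsilon>)))"
  proof (rule sum_mono)
    fix i assume "i \<in> {..<n}"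
    then have "0 \<le> log_kernel (a n) (\<beta> i) (x \<bullet> \<gamma> i)" "log_kernel (a n) (\<beta> i) (x \<bullet> \<gamma> i) \<le> (1 / \<epsilon> + B) * dst x i powr (-\<epsilon>)"
      unfolding dst_def using log_kernel_bounds[OF _ \<beta> lt \<epsilon>(1)] an by auto
    then show "\<bar>\<alpha> i * log_kernel (a n) (\<beta> i) (x \<bullet> \<gamma> i)\<bar> \<le> \<alpha> i * ((1 / \<epsilon> + B) * dst x i powr (-\<epsilon>))"
      using \<alpha>_nonneg[of i] by (simp add: abs_mult mult_left_mono)
  qed
  finally show "\<bar>F n x\<bar> \<le> (1 / \<epsilon> + B) * (\<Sum>i<n. \<alpha> i * dst x i powr (-\<epsilon>))"
    by (simp add: sum_distrib_left mult_ac)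
  have "norm (G n x) \<le> (\<Sum>i<n. \<alpha> i * (2 * dst x i powr (-(1/2))))"
    unfolding G_def
  proof (rule sum_norm_le)
    fix i assume "i \<in> {..<n}"
    then have "norm (log_kernel_deriv (a n) (x \<bullet> \<gamma> i) *\<^sub>R (\<gamma> i - (x \<bullet> \<gamma> i) *\<^sub>R x)) \<le> 2 * dst x i powr (-(1/2))"
      unfolding dst_def using log_kernel_deriv_bound[OF xS \<gamma> lt] an by blast
    then show "norm (\<alpha> i *\<^sub>R (log_kernel_deriv (a n) (x \<bullet> \<gamma> i) *\<^sub>R (\<gamma> i - (x \<bullet> \<gamma> i) *\<^sub>R x))) \<le> \<alpha> i * (2 * dst x i powr (-(1/2)))"
      using \<alpha>_nonneg[of i] by (simp only: norm_scaleR[of "\<alpha> i"] abs_of_nonneg mult_left_mono)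
  qed
  then show "norm (G n x) \<le> 2 * (\<Sum>i<n. \<alpha> i * dst x i powr (-(1/2)))"
    by (simp add: sum_distrib_left mult_ac)
qed

text \<open>Both quantities are bounded by the product of the sums with exponents
  \<open>\<epsilon>\<close> and 1/2, hence by one sum with exponent 1/2 + \<open>\<epsilon>\<close>,
  to which Jensen applies.\<close>

lemma Y_dominates:
  assumes x: "good x"
  shows "\<bar>(F n x)\<^sup>2\<bar> \<le> Y x" and "norm ((2 * F n x) *\<^sub>R G n x) \<le> Y x"
proof -
  let ?S = "\<lambda>r. \<Sum>i<n. \<alpha> i * dst x i powr (-r)"
  define c where "c = 1 / \<epsilon> + B"
  have c0: "0 \<le> c" using \<epsilon>(1) B_nonneg by (simp add: c_def)
  have S0: "0 \<le> ?S r" for r by (intro sum_nonneg mult_nonneg_nonneg \<alpha>_nonneg) simp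
  have S_mono: "?S \<epsilon> \<le> ?S (1/2)"
    by (intro sum_mono mult_left_mono \<alpha>_nonneg powr_mono' less_imp_le[OF dst_pos[OF x]] dst_le)
      (use \<epsilon>(2) in simp)
  note F = good_bounds(1)[OF x, of n, folded c_def] and G = good_bounds(2)[OF x, of n]
  have prod: "?S \<epsilon> * ?S (1/2) \<le> 2 * K * ?S (1/2 + \<epsilon>)"
    using weighted_sum_mult_le[of \<alpha> "dst x" n K \<epsilon> "1/2", OF \<alpha>_nonneg dst_pos[OF x] sum_\<alpha>_le] \<epsilon>(1)
    by (simp add: add.commute)
  have "(?S (1/2 + \<epsilon>)) powr p \<le> K powr (p - 1) * (\<Sum>i<n. \<alpha> i * (dst x i powr (-(1/2 + \<epsilon>))) powr p)"
  proof (rule weighted_sum_powr_le[OF p(1) \<alpha>_nonneg _ sum_\<alpha>_le])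
    show "0 < dst x i powr (-(1/2 + \<epsilon>))" for i using dst_pos[OF x, of i] by simp
  qed
  also have "(\<Sum>i<n. \<alpha> i * (dst x i powr (-(1/2 + \<epsilon>))) powr p) = (\<Sum>i<n. \<alpha> i * dst x i powr (-\<rho>))"
  proof -
    have "-(1/2 + \<epsilon>) * p = -\<rho>" unfolding \<epsilon>(3)[symmetric] by (simp only: mult_minus_left mult.commute)
    then show ?thesis by (simp only: powr_powr)
  qed
  also have "\<dots> \<le> enn2real (Z x)"
    unfolding good_summable(2)[OF x] by (rule sum_le_suminf[OF good_summable(1)[OF x]]) (auto simp: \<alpha>_nonneg)
  finally have "(?S (1/2 + \<epsilon>)) powr p \<le> K powr (p - 1) * enn2real (Z x)"
    by (simp add: mult_left_mono)
  then have "((?S (1/2 + \<epsilon>)) powr p) powr (1 / p) \<le> (K powr (p - 1) * enn2real (Z x)) powr (1 / p)"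
    using p by (intro powr_mono2) auto
  then have S_le: "?S (1/2 + \<epsilon>) \<le> (K powr (p - 1) * enn2real (Z x)) powr (1 / p)"
    using p S0[of "1/2 + \<epsilon>"] by (simp add: powr_powr)
  have CS: "C * ?S (1/2 + \<epsilon>) \<le> Y x" unfolding Y_def by (intro mult_left_mono S_le C_nonneg)
  have KS: "0 \<le> K * ?S (1/2 + \<epsilon>)" by (intro mult_nonneg_nonneg K_nonneg S0)
  have "\<bar>(F n x)\<^sup>2\<bar> = \<bar>F n x\<bar> * \<bar>F n x\<bar>" by (simp add: power2_eq_square)
  also have "\<dots> \<le> (c * ?S \<epsilon>) * (c * ?S \<epsilon>)" by (intro mult_mono F mult_nonneg_nonneg c0 S0) simp_all
  also have "\<dots> = c\<^sup>2 * (?S \<epsilon> * ?S \<epsilon>)" by (simp add: power2_eq_square)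
  \<comment> \<open>One exponent is wastefully raised from \<open>\<epsilon>\<close> to 1/2, so that
    the function and its gradient share a single majorant.\<close>
  also have "\<dots> \<le> c\<^sup>2 * (?S \<epsilon> * ?S (1/2))" by (intro mult_left_mono S_mono S0) simp
  also have "\<dots> \<le> c\<^sup>2 * (2 * K * ?S (1/2 + \<epsilon>))" by (intro mult_left_mono prod) simp
  also have "\<dots> \<le> C * ?S (1/2 + \<epsilon>)"
    using mult_nonneg_nonneg[OF c0 KS] unfolding C_def c_def[symmetric] by (simp add: algebra_simps)
  finally show "\<bar>(F n x)\<^sup>2\<bar> \<le> Y x" using CS by linarith
  have "norm ((2 * F n x) *\<^sub>R G n x) = 2 * (\<bar>F n x\<bar> * norm (G n x))" by (simp add: abs_mult)
  also have "\<dots> \<le> 2 * ((c * ?S \<epsilon>) * (2 * ?S (1/2)))"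
    by (intro mult_left_mono mult_mono F G mult_nonneg_nonneg c0 S0) simp_all
  also have "\<dots> = 4 * c * (?S \<epsilon> * ?S (1/2))" by simp
  also have "\<dots> \<le> 4 * c * (2 * K * ?S (1/2 + \<epsilon>))" using c0 by (intro mult_left_mono prod) simp
  also have "\<dots> \<le> C * ?S (1/2 + \<epsilon>)"
    using mult_nonneg_nonneg[OF zero_le_power2[of c] KS] unfolding C_def c_def[symmetric] by (simp add: algebra_simps)
  finally show "norm ((2 * F n x) *\<^sub>R G n x) \<le> Y x" using CS by linarith
qed

text \<open>The summability is what later identifies the extended real series
  \<open>warp_limit\<close> with \<open>F_lim\<close>.\<close>

lemma F_tendsto:
  assumes x: "good x"
  shows "(\<lambda>n. F n x) \<longlonglongrightarrow> F_lim x" and "summable (\<lambda>i. \<alpha> i * log_kernel 0 (\<beta> i) (x \<bullet> \<gamma> i))"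
proof -
  have lt: "\<And>i. (x \<bullet> \<gamma> i)\<^sup>2 < 1" using x by (auto simp: good_def)
  have "summable (\<lambda>i. (1 / \<epsilon> + B) * (\<alpha> i * dst x i powr (-\<epsilon>)))"
    using good_summable_le[OF x] \<epsilon>(2) \<rho> by (intro summable_mult) auto
  note * = dominated_series_limit[OF _ _ this, where f = "\<lambda>n i. \<alpha> i * log_kernel (a n) (\<beta> i) (x \<bullet> \<gamma> i)"
     and g = "\<lambda>i. \<alpha> i * log_kernel 0 (\<beta> i) (x \<bullet> \<gamma> i)"]
  have l: "(\<lambda>n. \<alpha> i * log_kernel (a n) (\<beta> i) (x \<bullet> \<gamma> i)) \<longlonglongrightarrow> \<alpha> i * log_kernel 0 (\<beta> i) (x \<bullet> \<gamma> i)" for i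
    unfolding log_kernel_def using lt[of i] by (intro tendsto_intros a_lim) auto
  have b: "norm (\<alpha> i * log_kernel (a n) (\<beta> i) (x \<bullet> \<gamma> i)) \<le> (1 / \<epsilon> + B) * (\<alpha> i * dst x i powr (-\<epsilon>))" if "i < n" for n i
  proof -
    have "0 \<le> a n" using a_pos[of n] that by simp
    then have l: "0 \<le> log_kernel (a n) (\<beta> i) (x \<bullet> \<gamma> i)" "log_kernel (a n) (\<beta> i) (x \<bullet> \<gamma> i) \<le> (1 / \<epsilon> + B) * dst x i powr (-\<epsilon>)"
      unfolding dst_def using log_kernel_bounds[OF _ \<beta> lt \<epsilon>(1)] by auto
    show ?thesis
      using mult_nonneg_nonneg[OF \<alpha>_nonneg l(1)] mult_left_mono[OF l(2) \<alpha>_nonneg]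
      by (simp only: real_norm_def abs_of_nonneg mult.left_commute)
  qed
  show "(\<lambda>n. F n x) \<longlonglongrightarrow> F_lim x" unfolding F_def F_lim_def by (rule *(1)[OF l b])
  show "summable (\<lambda>i. \<alpha> i * log_kernel 0 (\<beta> i) (x \<bullet> \<gamma> i))"
    by (rule summable_norm_cancel) (rule *(2)[OF l b])
qed

lemma G_tendsto:
  assumes x: "good x" shows "(\<lambda>n. G n x) \<longlonglongrightarrow> G_lim x"
proof -
  have xS: "x \<in> S2" and lt: "\<And>i. (x \<bullet> \<gamma> i)\<^sup>2 < 1" using x by (auto simp: good_def)
  have sm: "summable (\<lambda>i. 2 * (\<alpha> i * dst x i powr (-(1/2))))"
    using good_summable_le[OF x \<rho>(1)] by (intro summable_mult)
  show ?thesis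
    unfolding G_def G_lim_def
  proof (rule dominated_series_limit(1)[OF _ _ sm])
    show "(\<lambda>n. \<alpha> i *\<^sub>R (log_kernel_deriv (a n) (x \<bullet> \<gamma> i) *\<^sub>R (\<gamma> i - (x \<bullet> \<gamma> i) *\<^sub>R x)))
       \<longlonglongrightarrow> \<alpha> i *\<^sub>R (log_kernel_deriv 0 (x \<bullet> \<gamma> i) *\<^sub>R (\<gamma> i - (x \<bullet> \<gamma> i) *\<^sub>R x))" for i
      unfolding log_kernel_deriv_def using lt[of i] by (intro tendsto_intros a_lim) auto
    show "norm (\<alpha> i *\<^sub>R (log_kernel_deriv (a n) (x \<bullet> \<gamma> i) *\<^sub>R (\<gamma> i - (x \<bullet> \<gamma> i) *\<^sub>R x))) \<le> 2 * (\<alpha> i * dst x i powr (-(1/2)))"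
      if "i < n" for n i
    proof -
      have "0 \<le> a n" using a_pos[of n] that by simp
      then have "norm (log_kernel_deriv (a n) (x \<bullet> \<gamma> i) *\<^sub>R (\<gamma> i - (x \<bullet> \<gamma> i) *\<^sub>R x)) \<le> 2 * dst x i powr (-(1/2))"
        unfolding dst_def using log_kernel_deriv_bound[OF xS \<gamma> lt] by blast
      from mult_left_mono[OF this \<alpha>_nonneg[of i]] show ?thesis
        using \<alpha>_nonneg[of i] by (simp only: norm_scaleR[of "\<alpha> i"] abs_of_nonneg mult_ac)
    qed
  qed
qed

text \<open>A positive \<open>a n\<close> keeps the denominators and the argument of the logarithm
  positive on the whole sphere, centres included; for n = 0 the sums are empty.\<close>

lemma sphere_C1_F_square: "sphere_C1 (\<lambda>x. (F n x)\<^sup>2) (\<lambda>x. (2 * F n x) *\<^sub>R G n x)"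
  unfolding sphere_C1_def
proof (intro conjI ballI)
  have pos: "0 < 1 - (x \<bullet> \<gamma> i)\<^sup>2 + a n" if "x \<in> S2" "i < n" for x i
    using inner_square_S2_le[OF that(1) \<gamma>] a_pos[of n] that(2) by (simp add: add_nonneg_pos)
  have nz: "\<forall>x\<in>S2. 1 - (x \<bullet> \<gamma> i)\<^sup>2 + a n \<noteq> 0" "\<forall>x\<in>S2. (1 + a n) / (1 - (x \<bullet> \<gamma> i)\<^sup>2 + a n) > 0" if "i < n" for i
    using pos[OF _ that] a_pos[of n] that by (force, intro ballI divide_pos_pos) auto
  show "continuous_on S2 (\<lambda>x. (2 * F n x) *\<^sub>R G n x)"
    unfolding F_def G_def log_kernel_def log_kernel_deriv_def
    by (intro continuous_intros ballI) (use nz in force)+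
  fix x assume x: "x \<in> S2"
  have "((\<lambda>x. log_kernel (a n) (\<beta> i) (x \<bullet> \<gamma> i)) has_derivative (\<lambda>v. log_kernel_deriv (a n) (x \<bullet> \<gamma> i) * (v \<bullet> \<gamma> i))) (at x)" if i: "i < n" for i
  proof -
    have "(log_kernel (a n) (\<beta> i) has_real_derivative log_kernel_deriv (a n) (x \<bullet> \<gamma> i)) (at (x \<bullet> \<gamma> i))"
      unfolding log_kernel_def log_kernel_deriv_def
      using pos[OF x i] a_pos[of n] i
      by (auto intro!: derivative_eq_intros divide_pos_pos simp: divide_simps power2_eq_square)
    from has_derivative_compose[OF has_derivative_inner_left[OF has_derivative_ident, of "\<gamma> i"] this[unfolded has_field_derivative_def]]
    show ?thesis .
  qed
  then have F': "(F n has_derivative (\<lambda>v. \<Sum>i<n. \<alpha> i * (log_kernel_deriv (a n) (x \<bullet> \<gamma> i) * (v \<bullet> \<gamma> i)))) (at x)"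
    unfolding F_def[abs_def] by (intro has_derivative_sum has_derivative_mult_right) auto
  \<comment> \<open>The ambient derivative points along \<open>\<gamma> i\<close>; removing its
    radial part is invisible to tangent vectors.\<close>
  have "(\<Sum>i<n. \<alpha> i * (log_kernel_deriv (a n) (x \<bullet> \<gamma> i) * (v \<bullet> \<gamma> i))) = G n x \<bullet> v" if "v \<bullet> x = 0" for v
    unfolding G_def inner_sum_left using that by (intro sum.cong refl) (simp add: inner_diff_left inner_diff_right inner_commute)
  moreover have "((\<lambda>x. (F n x)\<^sup>2) has_derivative (\<lambda>v. 2 * F n x * (\<Sum>i<n. \<alpha> i * (log_kernel_deriv (a n) (x \<bullet> \<gamma> i) * (v \<bullet> \<gamma> i))))) (at x)"
    by (rule has_derivative_eq_rhs[OF has_derivative_power[OF F', of 2]]) (simp add: fun_eq_iff)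
  ultimately show "\<exists>w'. ((\<lambda>x. (F n x)\<^sup>2) has_derivative w') (at x) \<and> (\<forall>v. v \<bullet> x = 0 \<longrightarrow> w' v = (2 * F n x) *\<^sub>R G n x \<bullet> v)"
    by (intro exI conjI) auto
qed

lemma G_lim_measurable: "G_lim \<in> borel_measurable S2_measure"
  unfolding G_lim_def log_kernel_deriv_def by (rule measurable_S2_borel) measurable

lemma F_lim_measurable: "F_lim \<in> borel_measurable S2_measure"
  unfolding F_lim_def log_kernel_def by (rule measurable_S2_borel) measurable

lemma Y_measurable: "Y \<in> borel_measurable S2_measure"
  unfolding Y_def by (rule measurable_S2_borel) measurable

lemma Y_powr_integrable: "integrable S2_measure (\<lambda>x. Y x powr p)"
proof -
  have "Y x powr p = C powr p * K powr (p - 1) * enn2real (Z x)" for x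
    using p by (simp add: Y_def powr_mult powr_powr)
  moreover have "integrable S2_measure (\<lambda>x. enn2real (Z x))"
  proof (rule integrableI_bounded)
    show "(\<lambda>x. enn2real (Z x)) \<in> borel_measurable S2_measure"
      using Z_measurable_S2 by measurable
    \<comment> \<open>\<open>enn2real\<close> sends infinity to 0, so the pointwise inequality holds
      there as well.\<close>
    have "(\<integral>\<^sup>+x. ennreal (norm (enn2real (Z x))) \<partial>S2_measure) \<le> (\<integral>\<^sup>+x. Z x \<partial>S2_measure)"
      by (intro nn_integral_mono) (simp add: ennreal_enn2real_if)
    then show "(\<integral>\<^sup>+x. ennreal (norm (enn2real (Z x))) \<partial>S2_measure) < \<infinity>"
      using Z_integral by (rule order_le_less_trans)
  qed
  ultimately show ?thesis by simp
qed

text \<open>A general \<open>w'\<close> is allowed because the limit metric uses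
  \<open>real_of_ereal\<close> of an extended real series, which is compared with
  \<open>F_lim\<close> only at good points.\<close>

lemma converges:
  assumes w': "\<And>x. good x \<Longrightarrow> w' x = F_lim x" and m: "w' \<in> borel_measurable S2_measure"
  shows "W1p_converges p (\<lambda>n. warp_tensor 1 (\<lambda>x. (F n x)\<^sup>2)) (warp_tensor 1 (\<lambda>x. (w' x)\<^sup>2))"
proof (rule W1p_converges_warp_tensor[OF p(1) sphere_C1_F_square _ _ Y_measurable Y_powr_integrable])
  show "(\<lambda>x. (2 * F_lim x) *\<^sub>R G_lim x) \<in> borel_measurable S2_measure"
    using F_lim_measurable G_lim_measurable by measurable
  show "(\<lambda>x. (w' x)\<^sup>2) \<in> borel_measurable S2_measure" using m by measurable
  show "AE x in S2_measure. (\<lambda>n. (F n x)\<^sup>2) \<longlonglongrightarrow> (w' x)\<^sup>2 \<and> (\<lambda>n. (2 * F n x) *\<^sub>R G n x) \<longlonglongrightarrow> (2 * F_lim x) *\<^sub>R G_lim x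
     \<and> (\<forall>n. \<bar>(F n x)\<^sup>2\<bar> \<le> Y x \<and> norm ((2 * F n x) *\<^sub>R G n x) \<le> Y x)"
    using AE_good
  proof eventually_elim
    case (elim x)
    then show ?case using Y_dominates[OF elim] w'[OF elim] F_tendsto(1)[OF elim] G_tendsto[OF elim]
      by (auto intro!: tendsto_intros)
  qed
qed

end

text \<open>The common core of both parts of the theorem, for a sequence of centres on the sphere.
  The interpretation shifts all sequences by one except \<open>a\<close>.\<close>

lemma warped_metrics_converge_series:
  fixes a b A :: "nat \<Rightarrow> real" and c :: "nat \<Rightarrow> real^3"
  assumes a: "\<forall>j\<ge>1. 0 < a j" "a \<longlonglongrightarrow> 0" and b: "\<forall>i\<ge>1. b i \<in> {2..B}"
    and A: "\<forall>i\<ge>1. 0 \<le> A i" "(\<lambda>i. A (Suc i)) sums K" and c: "\<forall>i\<ge>1. c i \<in> S2" and p: "p \<in> {1..<2}"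
  shows "warped_metrics_converge p (warp a b A c) (warp_limit b A c)"
proof -
  interpret singular_warp a "\<lambda>i. A (Suc i)" "\<lambda>i. b (Suc i)" "\<lambda>i. c (Suc i)" B K p
    by standard (use assms in \<open>auto simp: Suc_le_eq order_trans[of 0 2]\<close>)
  have warp_eq: "warp a b A c n x = F n x" if "x \<in> S2" for n x
  proof -
    have "warp a b A c n x = (\<Sum>i<n. A (Suc i) * f_pos (a n) (b (Suc i)) (dist_S2 x (c (Suc i))))"
      unfolding warp_def by (rule sum.reindex_bij_witness[of _ Suc "\<lambda>i. i - 1"]) auto
    then show ?thesis unfolding F_def by (simp add: f_pos_dist_S2[OF that \<gamma>])
  qed
  have limit_eq: "warp_limit b A c x = ereal (F_lim x)" if x: "good x" for x
  proof -
    have "x \<in> S2" "\<And>i. (x \<bullet> c (Suc i))\<^sup>2 < 1" using x by (auto simp: good_def)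
    then have "warp_limit b A c x = (\<Sum>i. ereal (A (Suc i) * log_kernel 0 (b (Suc i)) (x \<bullet> c (Suc i))))"
      unfolding warp_limit_def by (simp add: f_zero_dist_S2[OF _ \<gamma>])
    also have "\<dots> = ereal (F_lim x)" unfolding F_lim_def by (rule suminf_ereal'[OF F_tendsto(2)[OF x]])
    finally show ?thesis .
  qed
  have limit_measurable: "warp_limit b A c \<in> borel_measurable S2_measure"
  proof -
    have "continuous_on S2 (\<lambda>x. dist_S2 x (c (Suc i)))" for i
      unfolding dist_S2_def using abs_inner_S2_le[OF _ \<gamma>] by (intro continuous_intros) (auto simp: abs_le_iff)
    note [measurable] = borel_measurable_S2_continuous[OF this]
    show ?thesis unfolding warp_limit_def f_zero_def by measurable
  qed
  have "AE x in S2_measure. \<bar>warp_limit b A c x\<bar> \<noteq> \<infinity>"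
    using AE_good by eventually_elim (simp add: limit_eq)
  moreover have "W1p_converges p (\<lambda>j. warped_metric (warp a b A c j)) (warped_metric (\<lambda>x. real_of_ereal (warp_limit b A c x)))"
  proof -
    let ?w = "\<lambda>x. real_of_ereal (warp_limit b A c x)"
    have conv: "W1p_converges p (\<lambda>n. warp_tensor 1 (\<lambda>x. (F n x)\<^sup>2)) (warp_tensor 1 (\<lambda>x. (?w x)\<^sup>2))"
      by (rule converges) (use limit_measurable in \<open>simp_all add: limit_eq\<close>)
    have e1: "warped_metric (warp a b A c n) m = warp_tensor 1 (\<lambda>x. (F n x)\<^sup>2) m" if "m \<in> S2 \<times> S1" for n m
      using that by (auto simp: fun_eq_iff warped_metric_def warp_tensor_def warp_eq)
    have e2: "warped_metric ?w = warp_tensor 1 (\<lambda>x. (?w x)\<^sup>2)"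
      by (simp add: fun_eq_iff warped_metric_def warp_tensor_def)
    have e3: "W1p_norm p (\<lambda>m u v. warped_metric (warp a b A c n) m u v - warped_metric ?w m u v)
        = W1p_norm p (\<lambda>m u v. warp_tensor 1 (\<lambda>x. (F n x)\<^sup>2) m u v - warp_tensor 1 (\<lambda>x. (?w x)\<^sup>2) m u v)" for n
      by (rule tensor2_cong) (simp only: e1 e2)
    have e4: "warped_metric (warp a b A c n) \<in> W1p p \<longleftrightarrow> warp_tensor 1 (\<lambda>x. (F n x)\<^sup>2) \<in> W1p p" for n
      by (rule tensor2_cong(2)) (rule e1)
    show ?thesis
      using conv unfolding W1p_converges_def e3 unfolding e2 e4 .
  qed
  ultimately show ?thesis unfolding warped_metrics_converge_def by blast
qed

theorem proposition4p4:
  fixes a b A :: "nat \<Rightarrow> real" and Kbar K :: real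
  assumes "\<forall>j\<ge>1. 0 < a j" and "\<forall>j\<ge>1. a (Suc j) \<le> a j" and "a \<longlonglongrightarrow> 0"
    and "2 \<le> Kbar" and "\<forall>i\<ge>1. b i \<in> {2..Kbar}"
    and "\<forall>i\<ge>1. 0 \<le> A i" and "0 < A 1" and "(\<lambda>i. A (Suc i)) sums K"
  shows "(\<forall>xbar :: nat \<Rightarrow> real^3. \<forall>xbar_inf \<in> S2.
            (\<forall>i\<ge>1. xbar i \<in> S2) \<and> xbar \<longlonglongrightarrow> xbar_inf \<longrightarrow>
            (\<forall>p \<in> {1..<2}. warped_metrics_converge p (warp a b A xbar) (warp_limit b A xbar)))
       \<and> (\<forall>(xhat :: nat \<Rightarrow> real^3) D.
            countable D \<and> D \<subseteq> S2 \<and> S2 \<subseteq> closure D \<and> xhat ` {1..} = D \<longrightarrow>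
            (\<forall>p \<in> {1..<2}. warped_metrics_converge p (warp a b A xhat) (warp_limit b A xhat)))"
proof (intro conjI allI ballI impI)
  fix xbar :: "nat \<Rightarrow> real^3" and xbar_inf and p :: real
  assume "(\<forall>i\<ge>1. xbar i \<in> S2) \<and> xbar \<longlonglongrightarrow> xbar_inf" "p \<in> {1..<2}"
  then show "warped_metrics_converge p (warp a b A xbar) (warp_limit b A xbar)"
    using warped_metrics_converge_series[OF assms(1,3,5,6,8)] by blast
next
  fix xhat :: "nat \<Rightarrow> real^3" and D and p :: real
  assume D: "countable D \<and> D \<subseteq> S2 \<and> S2 \<subseteq> closure D \<and> xhat ` {1..} = D" and p: "p \<in> {1..<2}"
  then have "\<forall>i\<ge>1. xhat i \<in> S2" by auto
  then show "warped_metrics_converge p (warp a b A xhat) (warp_limit b A xhat)"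
    using warped_metrics_converge_series[OF assms(1,3,5,6,8)] p by blast
qed

end
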